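(* Fix a real number $\alpha>463/252$. For each prime $p$ let $N=N(p)\ge 2$ with $u=\frac{\log p}{\log N}\ge 1$. Then, as $p\to\infty$, $$\#\mathcal{R}_p(N)\ll u\,N\,p^{-1/\lceil \alpha u\rceil},$$ where the implied constant may depend on $\alpha$.
   Context: For a prime $p$ and an integer $u$ with $\gcd(u,p)=1$, the Fermat quotient $q_p(u)$ is the unique integer with $q_p(u)\equiv \frac{u^{p-1}-1}{p} \pmod p$ and $0\le q_p(u)\le p-1$; also $q_p(u)=0$ if $u\equiv 0\pmod p$. For $N\ge 1$, $\mathcal{R}_p(N)=\{\ell\le N : \ell \text{ prime},\ q_p(\ell)=0\}$. The notation $U\ll V$ means $|U|\le cV$ for some constant $c>0$. *)

theory Defs
  imports "HOL-Number_Theory.Number_Theory" Complex_Main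
begin

text \<open>
  The division by \<open>p\<close> below is exact when \<open>p\<close> is prime, by Fermat's little theorem.
\<close>

definition fermat_quotient :: "nat \<Rightarrow> int \<Rightarrow> int" where
  "fermat_quotient p u =
     (if coprime u (int p)
      then (THE q. [q = (u ^ (p - 1) - 1) div int p] (mod int p) \<and> 0 \<le> q \<and> q \<le> int p - 1)
      else 0)"

definition vanishing_primes :: "nat \<Rightarrow> real \<Rightarrow> nat set" where
  "vanishing_primes p N = {l. prime l \<and> real l \<le> N \<and> fermat_quotient p (int l) = 0}"

lemma fermat_quotient_exact:
  assumes "prime p" "coprime u (int p)"
  shows "int p dvd u ^ (p - 1) - 1"
proof -
  define a where "a = nat (u mod int p)"
  have p0: "int p > 0"
    using prime_gt_0_nat[OF assms(1)] by simp
  have a: "int a = u mod int p"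
    using p0 by (simp add: a_def)
  have "\<not> int p dvd u"
  proof
    assume "int p dvd u"
    then have "int p dvd 1"
      using assms(2) by (meson coprime_common_divisor dvd_refl)
    then show False
      using prime_gt_1_nat[OF assms(1)] by simp
  qed
  then have "\<not> int p dvd int a"
    by (simp add: a dvd_mod_iff)
  then have "[a ^ (p - 1) = 1] (mod p)"
    using fermat_theorem[OF assms(1)] by simp
  then have "[int a ^ (p - 1) = 1] (mod int p)"
    by (metis cong_int_iff of_nat_1 of_nat_power)
  moreover have "[int a ^ (p - 1) = u ^ (p - 1)] (mod int p)"
    by (intro cong_pow) (simp add: a cong_def)
  ultimately have "[u ^ (p - 1) = 1] (mod int p)"
    using cong_sym cong_trans by blast
  then show ?thesis
    by (simp add: cong_iff_dvd_diff)
qed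

lemma fermat_quotient_unique:
  assumes "prime p"
  shows "\<exists>!q. [q = (u ^ (p - 1) - 1) div int p] (mod int p) \<and> 0 \<le> q \<and> q \<le> int p - 1"
proof (rule ex1I[of _ "((u ^ (p - 1) - 1) div int p) mod int p"])
  show "[((u ^ (p - 1) - 1) div int p) mod int p = (u ^ (p - 1) - 1) div int p] (mod int p) \<and>
    0 \<le> ((u ^ (p - 1) - 1) div int p) mod int p \<and>
    ((u ^ (p - 1) - 1) div int p) mod int p \<le> int p - 1"
    using prime_gt_0_nat[OF assms] by (simp add: cong_def)
next
  fix q
  assume "[q = (u ^ (p - 1) - 1) div int p] (mod int p) \<and> 0 \<le> q \<and> q \<le> int p - 1"
  then show "q = ((u ^ (p - 1) - 1) div int p) mod int p"
    by (metis cong_def mod_pos_pos_trivial zle_diff1_eq)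
qed

lemma fermat_quotient_eq_mod:
  assumes "prime p" "coprime u (int p)"
  shows "fermat_quotient p u = ((u ^ (p - 1) - 1) div int p) mod int p"
proof -
  have "(THE q. [q = (u ^ (p - 1) - 1) div int p] (mod int p) \<and> 0 \<le> q \<and> q \<le> int p - 1) =
      ((u ^ (p - 1) - 1) div int p) mod int p"
    by (rule the1_equality[OF fermat_quotient_unique[OF assms(1)]])
      (use prime_gt_0_nat[OF assms(1)] in \<open>simp add: cong_def\<close>)
  then show ?thesis
    using assms(2) by (simp add: fermat_quotient_def)
qed

lemma finite_vanishing_primes: "finite (vanishing_primes p N)"
proof (rule finite_subset)
  show "vanishing_primes p N \<subseteq> {..nat \<lfloor>N\<rfloor>}"
    by (auto simp: vanishing_primes_def le_nat_floor)
qed simp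

end

theory Submission
  imports Defs "HOL-Computational_Algebra.Polynomial" "HOL-Analysis.Convex"
begin

text \<open>
  Let \<open>G\<close> be the group of residues \<open>g\<close> modulo \<open>p^2\<close> with \<open>g^(p-1) = 1\<close>; it consists of the powers \<open>t^p\<close>. The
  products of \<open>k\<close> distinct primes \<open>l \<noteq> p\<close> with \<open>q_p(l) = 0\<close> and \<open>l \<le> N\<close> are distinct integers up to \<open>N^k\<close> lying in
  \<open>G\<close>. With \<open>k = \<lceil>\<alpha> u\<rceil>\<close> we have \<open>N^k \<ge> p^\<alpha>\<close>, so it is enough that \<open>G\<close> has \<open>O(M/p)\<close> elements in \<open>[1, M]\<close> when
  \<open>M \<ge> p^\<alpha>\<close>.

  Let \<open>S(d)\<close> be the sum of \<open>e(d g / p^2)\<close> over \<open>g\<close> in \<open>G\<close>, and \<open>K\<close> about \<open>p^2 / (6 M)\<close>. By positivity the count is at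
  most \<open>4/K\<close> times \<open>p\<close> plus twice the sum of \<open>|S(d)|\<close> over \<open>d \<le> K\<close>. As \<open>|S|\<close> is constant on the orbits of \<open>G\<close>,
  Hoelder's inequality bounds this sum by the fourth moment of \<open>S\<close>, that is the additive energy of \<open>G\<close>, and by the
  number of pairs \<open>a, b \<le> K\<close> with \<open>a/b\<close> in \<open>G\<close>.

  The energy counts solutions of \<open>F(x) = F(y)\<close> modulo \<open>p\<close>, where \<open>F = ((1 - X)^p + X^p - 1)/p\<close> behaves like a
  logarithm; Stepanov's method, after Heath-Brown and Konyagin, gives \<open>O(p^(5/2))\<close>.

  If \<open>G\<close> contains \<open>m\<close> reduced fractions of height \<open>h\<close>, then by the divisor bound it contains at least
  \<open>m^n p^(-\<epsilon>)\<close> of height \<open>h^n\<close>, while there are only \<open>O(p + h^(2n)/p)\<close> of these. Choosing \<open>n\<close> with \<open>h^n\<close> closest to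
  \<open>p\<close> yields \<open>m \<le> h p^(1/84 + \<epsilon>)\<close> for \<open>h \<le> p^(1/6)\<close>, the loss being half of \<open>1/6 - 1/7\<close>. Altogether
  the sum over \<open>d\<close> is \<open>O(p)\<close> as long as \<open>K \<le> p^(41/252 - \<epsilon>)\<close>, and \<open>41/252 = 2 - 463/252\<close>.
\<close>

section \<open>The truncated logarithm modulo \<open>p\<close>\<close>

lemma smult_sum_right: "smult a (sum f A) = (\<Sum>i\<in>A. smult a (f i))"
  by (induction A rule: infinite_finite_induct) (auto simp: smult_add_right)

locale odd_prime =
  fixes p :: nat
  assumes prime_p: "prime p" and p_gt_2: "p > 2"
begin

abbreviation X :: "int poly" where "X \<equiv> [:0, 1:]"

abbreviation U :: "int poly" where "U \<equiv> [:-1, 1:]"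

abbreviation P :: "int poly" where "P \<equiv> [:int p:]"

text \<open>Modulo \<open>p\<close> the coefficient of \<open>X^j\<close> is \<open>-1/j\<close>, so
  this is the truncated series of \<open>log (1 - X)\<close>. By its symmetry under
  \<open>X -> 1 - X\<close> it also imitates \<open>log X\<close> near \<open>X = 1\<close>.\<close>

definition F :: "int poly" where
  "F = (\<Sum>j=1..p-1. monom ((-1)^j * int ((p choose j) div p)) j)"

lemma odd_p: "odd p"
  using prime_p p_gt_2 prime_odd_nat by blast

lemma prime_int_p: "prime (int p)"
  using prime_p by simp

lemma prime_elem_P: "prime_elem P"
  using prime_int_p by (intro lift_prime_elem_poly) auto

lemma P_dvd_iff: "P dvd f \<longleftrightarrow> (\<forall>n. int p dvd coeff f n)"
  by (rule const_poly_dvd_iff)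

lemma smult_F: "smult (int p) F = [:1, -1:]^p + X^p - 1"
proof -
  have "[:1, -1:] ^ p = (monom (-1) 1 + 1 :: int poly) ^ p"
    by (simp add: monom_altdef one_pCons)
  also have "\<dots> = (\<Sum>j\<le>p. monom (int (p choose j) * (-1)^j) j)"
    by (subst binomial_ring) (simp add: monom_power of_nat_poly smult_monom)
  \<comment> \<open>The two end terms are the ones whose binomial coefficient is prime to
    \<open>p\<close>; as \<open>p\<close> is odd they give \<open>1 - X^p\<close>.\<close>
  also have "{..p} = insert 0 (insert p {1..p-1})"
    using p_gt_2 by auto
  also have "(\<Sum>j\<in>insert 0 (insert p {1..p-1}). monom (int (p choose j) * (-1)^j) j)
     = 1 - X^p + (\<Sum>j=1..p-1. monom (int (p choose j) * (-1)^j) j)"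
    using p_gt_2 odd_p by (subst sum.insert, simp, simp, subst sum.insert)
      (auto simp: monom_altdef one_pCons)
  also have "(\<Sum>j=1..p-1. monom (int (p choose j) * (-1)^j) j) =
     (\<Sum>j=1..p-1. smult (int p) (monom ((-1)^j * int ((p choose j) div p)) j))"
  proof (rule sum.cong[OF refl])
    fix j assume "j \<in> {1..p-1}"
    then have "p dvd (p choose j)"
      using p_gt_2 by (intro dvd_choose_prime prime_p) auto
    then have "int (p choose j) = int p * int ((p choose j) div p)"
      by (metis dvd_mult_div_cancel of_nat_mult)
    then show "monom (int (p choose j) * (-1)^j) j =
        smult (int p) (monom ((-1)^j * int ((p choose j) div p)) j)"
      by (simp add: smult_monom mult_ac)
  qed
  finally show ?thesis
    by (simp add: F_def smult_sum_right)
qed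

lemma P_mult_F: "P * F = [:1, -1:]^p + X^p - 1"
  using smult_F by simp

lemma degree_F: "degree F \<le> p - 1"
  unfolding F_def by (intro degree_sum_le) (auto intro: order.trans[OF degree_monom_le])

lemma neg_U: "[:1, -1:] = - U"
  by simp

lemma neg_U_odd: "[:1, -1:]^p = - (U^p)"
  unfolding neg_U using odd_p by (rule power_minus_odd)

lemma X_pow_p: "X^p = U^p + 1 + P * F"
  unfolding P_mult_F neg_U_odd by simp

lemma pderiv_F: "pderiv F = X^(p-1) - U^(p-1)"
proof -
  have "smult (int p) (pderiv F) = pderiv ([:1, -1:]^p + X^p - 1)"
    by (simp add: smult_F[symmetric] pderiv_smult)
  also have "\<dots> = smult (int p) (X^(p-1)) - smult (int p) ([:1, -1:]^(p-1))"
    using p_gt_2 by (simp add: pderiv_add pderiv_diff pderiv_power pderiv_pCons)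
  also have "[:1, -1:]^(p-1) = U^(p-1)"
    using odd_p unfolding neg_U by (intro power_minus_even) simp
  finally have "smult (int p) (pderiv F) = smult (int p) (X^(p-1) - U^(p-1))"
    by (simp add: smult_diff_right)
  then show ?thesis
    using p_gt_2 by (metis gr_implies_not0 of_nat_eq_0_iff smult_cancel)
qed

lemma X_eq_U: "X = U + 1"
  by (simp add: one_pCons)

text \<open>Modulo \<open>p\<close> and to order \<open>p - 1\<close> at \<open>X = 1\<close>,
  \<open>F\<close> satisfies the differential equation \<open>X y' = 1\<close> of the logarithm.
  Both \<open>X^p = U^p + 1 + P * F\<close> and \<open>X = U + 1\<close> enter.\<close>

lemma X_pderiv_F: "X * pderiv F = 1 - U^(p-1) + P * F"
proof -
  have "X * pderiv F = X^p - X * U^(p-1)"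
    unfolding pderiv_F using p_gt_2 by (cases p) (auto simp: algebra_simps simp del: mult_pCons_left mult_pCons_right)
  also have "X * U^(p-1) = U^p + U^(p-1)"
    using p_gt_2 by (cases p) (auto simp: X_eq_U algebra_simps simp del: mult_pCons_left mult_pCons_right)
  finally show ?thesis
    by (simp add: X_pow_p)
qed

section \<open>Order of vanishing at \<open>X = 1\<close> modulo \<open>p\<close>, as membership in
  the ideal \<open>(U^m, p)\<close>\<close>

definition vanishes :: "nat \<Rightarrow> int poly \<Rightarrow> bool" where
  "vanishes m f \<longleftrightarrow> (\<exists>g h. f = U^m * g + P * h)"

lemma vanishesI: "f = U^m * g + P * h \<Longrightarrow> vanishes m f"
  unfolding vanishes_def by blast

lemma vanishes_add:
  assumes "vanishes m f" "vanishes m g" shows "vanishes m (f + g)"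
proof -
  obtain f1 f2 g1 g2 where "f = U^m * f1 + P * f2" "g = U^m * g1 + P * g2"
    using assms unfolding vanishes_def by blast
  then show ?thesis
    by (intro vanishesI[of _ _ "f1 + g1" "f2 + g2"]) (simp only: distrib_left add_ac)
qed

lemma vanishes_mult:
  assumes "vanishes m f" shows "vanishes m (g * f)"
proof -
  obtain f1 f2 where "f = U^m * f1 + P * f2"
    using assms unfolding vanishes_def by blast
  then show ?thesis
    by (intro vanishesI[of _ _ "g * f1" "g * f2"]) (simp only: distrib_left mult_ac)
qed

lemma vanishes_mono:
  assumes "vanishes m f" "k \<le> m" shows "vanishes k f"
proof -
  obtain f1 f2 where f: "f = U^m * f1 + P * f2"
    using assms unfolding vanishes_def by blast
  have "U^m = U^k * U^(m-k)"
    using assms(2) by (simp flip: power_add)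
  then show ?thesis
    unfolding f by (intro vanishesI[of _ _ "U^(m-k) * f1" f2]) (simp only: mult_ac)
qed

lemma vanishes_P: "P dvd f \<Longrightarrow> vanishes m f"
  by (elim dvdE, intro vanishesI[of _ _ 0]) simp

lemma vanishes_U: "vanishes m (U^m * f)"
  by (intro vanishesI[of _ _ f 0]) simp

lemma vanishes_theta:
  assumes "vanishes (Suc m) f" shows "vanishes m (X * pderiv f)"
proof -
  obtain g h where f: "f = U^Suc m * g + P * h"
    using assms unfolding vanishes_def by blast
  have "pderiv f = U^m * (smult (of_nat (Suc m)) g + U * pderiv g) + P * pderiv h"
    unfolding f pderiv_add pderiv_mult pderiv_power_Suc
    by (simp add: pderiv_pCons algebra_simps)
  then have "vanishes m (pderiv f)"
    unfolding vanishes_def by blast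
  then show ?thesis by (rule vanishes_mult)
qed

lemma vanishes_at_1: "vanishes (Suc m) f \<Longrightarrow> int p dvd poly f 1"
  unfolding vanishes_def by auto

definition log_sum :: "(nat \<Rightarrow> nat \<Rightarrow> int) \<Rightarrow> int poly" where
  "log_sum c = (\<Sum>i<p. \<Sum>j<p. smult (c i j) (X^i * F^j))"

definition log_shift :: "nat \<Rightarrow> (nat \<Rightarrow> nat \<Rightarrow> int) \<Rightarrow> nat \<Rightarrow> nat \<Rightarrow> int" where
  "log_shift a c i j = (int i - int a) * c i j + int (Suc j) * c i (Suc j)"

lemma theta_monomial:
  "X * pderiv (X^i * F^j) = smult (int i) (X^i * F^j) + smult (int j) (X^i * F^(j-1)) * (X * pderiv F)"
proof -
  have "X * pderiv (X^i) = smult (int i) (X^i)"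
  proof -
    have "pderiv (X^i) = smult (int i) (X^(i-1))"
      by (simp add: pderiv_power pderiv_pCons)
    then show ?thesis by (cases i) simp_all
  qed
  moreover have "pderiv (F^j) = smult (int j) (F^(j-1) * pderiv F)"
    by (simp add: pderiv_power)
  ultimately show ?thesis
    unfolding pderiv_mult by (simp only: distrib_left mult_smult_right mult_smult_left mult_ac add_ac)
qed

text \<open>The true derivative differs from the formal one by a multiple of
  \<open>X * pderiv F - 1\<close>, which lies in the ideal \<open>(U^(p-1), p)\<close>; hence the
  bound on \<open>m\<close>.\<close>

lemma log_shift_sum:
  assumes c: "\<And>i. c i p = 0" and v: "vanishes (Suc m) (log_sum c)" and m: "m \<le> p - 1"
  shows "vanishes m (log_sum (log_shift a c))"
proof -
  define G where "G = (\<Sum>i<p. \<Sum>j<p. smult (c i j * int j) (X^i * F^(j-1)))"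
  have G: "G = (\<Sum>i<p. \<Sum>j<p. smult (int (Suc j) * c i (Suc j)) (X^i * F^j))"
    unfolding G_def
  proof (rule sum.cong[OF refl])
    fix i
    \<comment> \<open>The added term \<open>j = p\<close> is zero because \<open>c i p = 0\<close>,
      and the term \<open>j = 0\<close> is zero because of the factor \<open>int j\<close>, so
      shifting \<open>j\<close> by one keeps the range.\<close>
    have "(\<Sum>j<p. smult (c i j * int j) (X^i * F^(j-1))) = (\<Sum>j<Suc p. smult (c i j * int j) (X^i * F^(j-1)))"
      using c by simp
    also have "\<dots> = (\<Sum>j<p. smult (c i (Suc j) * int (Suc j)) (X^i * F^j))"
      by (subst sum.lessThan_Suc_shift) simp
    finally show "(\<Sum>j<p. smult (c i j * int j) (X^i * F^(j-1))) = (\<Sum>j<p. smult (int (Suc j) * c i (Suc j)) (X^i * F^j))"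
      by (simp only: mult.commute)
  qed
  have th: "X * pderiv (log_sum c) = (\<Sum>i<p. \<Sum>j<p. smult (c i j * int i) (X^i * F^j)) + G * (X * pderiv F)"
    unfolding log_sum_def G_def
    by (simp only: higher_pderiv_sum[of 1, simplified] pderiv_smult sum_distrib_left sum_distrib_right mult_smult_right theta_monomial
        smult_add_right sum.distrib mult_smult_left smult_smult)
  have "log_sum (log_shift a c) = X * pderiv (log_sum c) - smult (int a) (log_sum c) - G * (X * pderiv F - 1)"
    unfolding th
    unfolding G right_diff_distrib
    unfolding log_sum_def log_shift_def
    by (simp add: smult_sum_right sum.distrib[symmetric] sum_subtractf[symmetric] smult_add_left[symmetric]
         smult_diff_left[symmetric] algebra_simps del: of_nat_Suc)
  also have "\<dots> = X * pderiv (log_sum c) + [:- int a:] * log_sum c + (U^(p-1) * G + P * (- F * G))"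
    unfolding X_pderiv_F by (simp add: algebra_simps)
  also have "vanishes m \<dots>"
  proof (intro vanishes_add vanishes_theta v)
    show "vanishes m ([:- int a:] * log_sum c)" using v by (intro vanishes_mult vanishes_mono[OF v]) simp
    show "vanishes m (U^(p-1) * G)" using vanishes_U m by (rule vanishes_mono)
    show "vanishes m (P * (- F * G))" by (intro vanishes_P dvd_triv_left)
  qed
  finally show ?thesis .
qed

lemma small_dvd_imp: "int p dvd (int i - int a) \<Longrightarrow> i < p \<Longrightarrow> a < p \<Longrightarrow> i = a"
  by (metis cong_iff_dvd_diff cong_int_iff cong_less_modulus_unique_nat)

text \<open>Near \<open>X = 1\<close> the operator \<open>X d/dX\<close> sends \<open>F\<close> to \<open>1\<close>, as it does with \<open>log X\<close>; hence \<open>X d/dX - a\<close> removes one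
  power of \<open>F\<close> from the coefficient of \<open>X^a\<close> at the cost of one order of vanishing.\<close>

lemma log_sum_independent:
  assumes "S \<subseteq> {..<p}" "\<And>i. i \<in> S \<Longrightarrow> n i \<le> p" "sum n S = m" "m \<le> p"
    and "\<And>i j. c i j \<noteq> 0 \<Longrightarrow> i \<in> S \<and> j < n i"
    and "vanishes m (log_sum c)"
  shows "int p dvd c i j"
  using assms
proof (induction m arbitrary: n c i j)
  case 0
  have "finite S" using 0(1) finite_subset by blast
  then have "\<forall>i\<in>S. n i = 0" using 0(3) by simp
  then show ?case using 0(5)[of i j] by fastforce
next
  case (Suc m)
  have fS: "finite S" using Suc.prems(1) finite_subset by blast
  obtain a where a: "a \<in> S" "n a \<noteq> 0"
    using Suc.prems(3) fS by (metis Zero_not_Suc sum.neutral)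
  have ap: "a < p" using a Suc.prems(1) by auto
  define n' where "n' = n(a := n a - 1)"
  have supp: "j < n i" "i < p" "j < p" if "c i j \<noteq> 0" for i j
    using Suc.prems(1,2) Suc.prems(5)[OF that] by fastforce+
  have cp: "c i p = 0" for i
    using supp(3)[of i p] by auto
  have "sum n S = n a + sum n (S - {a})" "sum n' S = n' a + sum n' (S - {a})"
    using fS a(1) by (simp_all add: sum.remove)
  moreover have "sum n' (S - {a}) = sum n (S - {a})"
    unfolding n'_def by (intro sum.cong) auto
  ultimately have sn': "sum n' S = m"
    using Suc.prems(3) a(2) by (simp add: n'_def)
  have ih: "int p dvd log_shift a c i j" for i j
  proof (rule Suc.IH[where n = n'])
    show "n' i \<le> p" if "i \<in> S" for i
      using Suc.prems(2)[OF that] by (auto simp: n'_def)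
    show "vanishes m (log_sum (log_shift a c))"
      using Suc.prems by (intro log_shift_sum cp) auto
    show "i \<in> S \<and> j < n' i" if "log_shift a c i j \<noteq> 0" for i j
    proof (cases "i = a")
      case True
      with that have "c a (Suc j) \<noteq> 0" by (auto simp: log_shift_def)
      then show ?thesis using supp(1) True a(1) by (fastforce simp: n'_def)
    next
      case False
      from that have "c i j \<noteq> 0 \<or> c i (Suc j) \<noteq> 0" by (auto simp: log_shift_def)
      then show ?thesis using Suc.prems(5) False by (fastforce simp: n'_def)
    qed
  qed (use Suc.prems sn' in auto)
  \<comment> \<open>Descending induction on \<open>j\<close>, starting from \<open>j \<ge> p\<close>
    where the coefficients are zero: once \<open>c i (Suc j)\<close> is divisible by
    \<open>p\<close>, \<open>ih\<close> leaves \<open>(i - a) * c i j\<close>, and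
    \<open>i - a\<close> is a unit modulo \<open>p\<close>.\<close>
  have other: "int p dvd c i j" if "i \<noteq> a" for i j
  proof (induction "p - j" arbitrary: j)
    case 0
    then show ?case using supp(3)[of i j] by (cases "c i j = 0") auto
  next
    case (Suc k)
    then have "int p dvd c i (Suc j)" by simp
    with ih[of i j] have "int p dvd (int i - int a) * c i j"
      unfolding log_shift_def by (metis dvd_add_left_iff dvd_mult)
    moreover have "\<not> int p dvd (int i - int a)" if "c i j \<noteq> 0"
      using small_dvd_imp[of i a] supp(2)[OF that] ap \<open>i \<noteq> a\<close> by blast
    ultimately show ?case
      using prime_int_p prime_dvd_mult_iff by (metis dvd_0_right)
  qed
  \<comment> \<open>For \<open>i = a\<close> the first term of \<open>log_shift\<close> drops out,
    so \<open>ih\<close> reaches every coefficient except \<open>c a 0\<close>.\<close>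
  have a_pos: "int p dvd c a (Suc j)" for j
  proof (cases "c a (Suc j) = 0")
    case False
    have "int p dvd int (Suc j) * c a (Suc j)" using ih[of a j] by (simp add: log_shift_def)
    moreover have "\<not> int p dvd int (Suc j)"
      using supp(3)[OF False] by (meson dvd_imp_le int_dvd_int_iff less_le_not_le zero_less_Suc)
    ultimately show ?thesis using prime_int_p prime_dvd_mult_iff by blast
  qed auto
  \<comment> \<open>Only \<open>c a 0 * X^a\<close> is left modulo \<open>p\<close>, and its value
    at \<open>X = 1\<close> is the missing coefficient.\<close>
  have "P dvd log_sum c - smult (c a 0) (X^a)"
  proof -
    define c' where "c' i j = (if i = a \<and> j = 0 then 0 else c i j)" for i j
    have "int p dvd c' i j" for i j
      using other[of i j] a_pos[of "j - 1"] by (cases "i = a"; cases "j = 0") (simp_all add: c'_def)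
    then have "P dvd log_sum c'"
      unfolding log_sum_def by (intro dvd_sum) (auto simp: P_dvd_iff)
    moreover have "log_sum c = log_sum c' + (\<Sum>i<p. \<Sum>j<p. if i = a then if j = 0 then smult (c a 0) (X^a) else 0 else 0)"
      unfolding log_sum_def sum.distrib[symmetric] by (intro sum.cong) (auto simp: c'_def)
    moreover have "(\<Sum>i<p. \<Sum>j<p. if i = a then if j = 0 then smult (c a 0) (X^a) else 0 else 0) = smult (c a 0) (X^a)"
    proof -
      have "(\<Sum>i<p. \<Sum>j<p. if i = a then if j = 0 then smult (c a 0) (X^a) else 0 else 0)
         = (\<Sum>i<p. if i = a then smult (c a 0) (X^a) else 0)"
        using p_gt_2 by (intro sum.cong) auto
      also have "\<dots> = smult (c a 0) (X^a)" using ap by simp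
      finally show ?thesis .
    qed
    ultimately show ?thesis by simp
  qed
  then have "vanishes (Suc m) (- (log_sum c - smult (c a 0) (X^a)))"
    by (intro vanishes_P) (simp only: dvd_minus_iff)
  from vanishes_add[OF Suc.prems(6) this] have "vanishes (Suc m) (smult (c a 0) (X^a))"
    by simp
  then have "int p dvd c a 0" using vanishes_at_1 by fastforce
  have "int p dvd c i j" for i j
    using other[of i j] a_pos[of "j - 1"] \<open>int p dvd c a 0\<close> by (cases "i = a"; cases "j = 0") simp_all
  then show ?case .
qed

end


section \<open>Stepanov's method\<close>

lemma int_fermat:
  assumes "prime p" shows "int p dvd a^p - a"
proof (cases "coprime a (int p)")
  case True
  have "a^p - a = a * (a^(p-1) - 1)"
    using prime_gt_0_nat[OF assms] by (cases p) (auto simp: algebra_simps)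
  then show ?thesis using fermat_quotient_exact[OF assms True] by simp
next
  case False
  then have "int p dvd a"
    using assms prime_imp_coprime[of "int p" a] by (auto simp: coprime_commute)
  then show ?thesis
    using prime_gt_0_nat[OF assms] by (intro dvd_diff) (auto intro: dvd_power_same dvd_trans[OF _ dvd_power])
qed

text \<open>Siegel's lemma over the field with \<open>p\<close> elements: \<open>p^card I\<close>
  vectors have at most \<open>p^card J\<close> images, and the difference of two vectors with the
  same image is a solution.\<close>

lemma pigeonhole_mod_solution:
  fixes a :: "'i \<Rightarrow> 'j \<Rightarrow> int"
  assumes "finite I" "finite J" "card J < card I" "p > 1"
  shows "\<exists>\<mu>. (\<exists>i\<in>I. \<not> int p dvd \<mu> i) \<and> (\<forall>j\<in>J. int p dvd (\<Sum>i\<in>I. \<mu> i * a i j))"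
proof -
  define V where "V = (I \<rightarrow>\<^sub>E {0..<int p})"
  define \<Phi> where "\<Phi> l = (\<lambda>j\<in>J. (\<Sum>i\<in>I. l i * a i j) mod int p)" for l
  have "\<Phi> ` V \<subseteq> (J \<rightarrow>\<^sub>E {0..<int p})"
    using assms(4) by (auto simp: \<Phi>_def)
  then have "card (\<Phi> ` V) \<le> card (J \<rightarrow>\<^sub>E {0..<int p})"
    using assms(2) by (intro card_mono finite_PiE) auto
  also have "\<dots> = p ^ card J" using assms(2) by (simp add: card_PiE)
  also have "\<dots> < p ^ card I" using assms by simp
  also have "\<dots> = card V" using assms(1) by (simp add: V_def card_PiE)
  finally have "\<not> inj_on \<Phi> V"
    using pigeonhole by blast
  then obtain l l' where l: "l \<in> V" "l' \<in> V" "l \<noteq> l'" "\<Phi> l = \<Phi> l'"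
    by (auto simp: inj_on_def)
  show ?thesis
  proof (intro exI[of _ "\<lambda>i. l i - l' i"] conjI ballI)
    obtain i where i: "i \<in> I" "l i \<noteq> l' i"
      using l(1-3) unfolding V_def by (meson PiE_ext)
    have "l i \<in> {0..<int p}" "l' i \<in> {0..<int p}" using l i by (auto simp: V_def)
    then have "\<not> int p dvd l i - l' i"
      using i(2) by (metis atLeastLessThan_iff mod_eq_dvd_iff mod_pos_pos_trivial)
    then show "\<exists>i\<in>I. \<not> int p dvd l i - l' i" using i(1) by blast
  next
    fix j assume "j \<in> J"
    then have "(\<Sum>i\<in>I. l i * a i j) mod int p = (\<Sum>i\<in>I. l' i * a i j) mod int p"
      using fun_cong[OF l(4), of j] by (simp add: \<Phi>_def)
    then show "int p dvd (\<Sum>i\<in>I. (l i - l' i) * a i j)"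
      by (simp add: mod_eq_dvd_iff left_diff_distrib sum_subtractf)
  qed
qed

context odd_prime
begin

section \<open>Nonvanishing of the auxiliary polynomial\<close>

lemma P_dvd_poly: "P dvd f \<Longrightarrow> int p dvd poly f x"
  by (elim dvdE) simp

lemma not_P_dvd_monic: "lead_coeff f = 1 \<Longrightarrow> \<not> P dvd f"
  using p_gt_2 by (metis P_dvd_iff int_dvd_int_iff nat_dvd_1_iff_1 of_nat_1 less_numeral_extra(4) not_less_iff_gr_or_eq one_less_numeral_iff semiring_norm(76))

lemma monic_linear_power: "lead_coeff ([:- x, 1:]^n :: int poly) = 1"
  by (simp add: lead_coeff_power)

lemma vanishes_cancel:
  assumes "vanishes (k + m) (U^k * f)" shows "vanishes m f"
proof -
  obtain g h where "U^k * f = U^(k+m) * g + P * h"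
    using assms unfolding vanishes_def by blast
  then have "U^k * (f - U^m * g) = P * h"
    by (simp only: power_add) (simp add: algebra_simps)
  then have "P dvd U^k * (f - U^m * g)" by (metis dvd_triv_left)
  then have "P dvd f - U^m * g"
    using prime_elem_P prime_elem_dvd_multD not_P_dvd_monic monic_linear_power[of 1] by blast
  then obtain h' where "f - U^m * g = P * h'" by (rule dvdE)
  then have "f = U^m * g + P * h'" by (simp only: diff_eq_eq add.commute)
  then show ?thesis by (rule vanishesI)
qed

lemma vanishes_sum: "(\<And>i. i \<in> I \<Longrightarrow> vanishes m (f i)) \<Longrightarrow> vanishes m (sum f I)"
  by (induction I rule: infinite_finite_induct) (auto intro: vanishes_add vanishes_P)

text \<open>The blocks below \<open>k\<close> are zero modulo \<open>p\<close> by induction and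
  those above vanish to order at least \<open>p*k + p\<close> at \<open>X = 1\<close>. So block
  \<open>k\<close> vanishes to order \<open>p\<close> after \<open>U^(p*k)\<close> is cancelled, and
  \<open>A * B \<le> p\<close> allows \<open>log_sum_independent\<close>. In the contrapositive, one
  coefficient prime to \<open>p\<close> keeps the auxiliary polynomial nonzero modulo
  \<open>p\<close>.\<close>

lemma auxiliary_nonzero:
  fixes c :: "nat \<Rightarrow> nat \<Rightarrow> nat \<Rightarrow> int"
  assumes AB: "A * B \<le> p" and
    dvd: "P dvd (\<Sum>k<C. U^(p*k) * (\<Sum>i<A. \<Sum>j<B. smult (c i j k) (X^i * F^j)))"
    and ijk: "i < A" "j < B" "k < C"
  shows "int p dvd c i j k"
  using ijk
proof (induction k arbitrary: i j rule: less_induct)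
  case (less k)
  have AB': "A \<le> p" "B \<le> p"
  proof -
    have "A * 1 \<le> A * B" "1 * B \<le> A * B"
      using less.prems by (intro mult_le_mono; simp)+
    with AB show "A \<le> p" "B \<le> p" by linarith+
  qed
  define W where "W k = (\<Sum>i<A. \<Sum>j<B. smult (c i j k) (X^i * F^j))" for k
  have split: "U^(p*k) * W k = (\<Sum>k<C. U^(p*k) * W k) + (\<Sum>l\<in>{..<C}-{k}. (-1) * (U^(p*l) * W l))"
    using less.prems(3) by (simp add: sum.remove[of "{..<C}" k] sum_negf)
  have "vanishes (p*k + p) (\<Sum>k<C. U^(p*k) * W k)"
    using dvd by (intro vanishes_P) (simp only: W_def)
  moreover have "vanishes (p*k + p) (\<Sum>l\<in>{..<C}-{k}. (-1) * (U^(p*l) * W l))"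
  proof (rule vanishes_sum, rule vanishes_mult)
    fix l assume l: "l \<in> {..<C}-{k}"
    show "vanishes (p*k + p) (U^(p*l) * W l)"
    proof (cases "l < k")
      case True
      have "P dvd W l"
        unfolding W_def
      proof (intro dvd_sum)
        fix i j assume "i \<in> {..<A}" "j \<in> {..<B}"
        then have "int p dvd c i j l" using less.IH[OF True, of i j] l by simp
        then show "P dvd smult (c i j l) (X^i * F^j)" by (auto simp: P_dvd_iff)
      qed
      then show ?thesis by (intro vanishes_P) simp
    next
      case False
      with l have "k + 1 \<le> l" by auto
      then have "p * (k + 1) \<le> p * l" by (intro mult_le_mono2)
      then show ?thesis using vanishes_U vanishes_mono by (metis mult.commute mult_Suc_right add.commute Suc_eq_plus1)
    qed
  qed
  ultimately have "vanishes (p*k + p) (U^(p*k) * W k)"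
    unfolding split by (rule vanishes_add)
  then have van: "vanishes p (W k)" by (rule vanishes_cancel)
  define c' where "c' i j = (if i < A \<and> j < B then c i j k else 0)" for i j
  have "log_sum c' = (\<Sum>i<p. \<Sum>j<B. smult (c' i j) (X^i * F^j))"
    unfolding log_sum_def using AB' by (intro sum.cong refl sum.mono_neutral_right) (auto simp: c'_def)
  also have "\<dots> = (\<Sum>i<A. \<Sum>j<B. smult (c' i j) (X^i * F^j))"
    using AB' by (intro sum.mono_neutral_right) (auto simp: c'_def)
  also have "\<dots> = W k" unfolding W_def by (intro sum.cong refl) (simp add: c'_def)
  finally have ls: "log_sum c' = W k" .
  have "int p dvd c' i j"
  proof (rule log_sum_independent[of "{..<A}" "\<lambda>_. B" "A * B"])
    show "vanishes (A * B) (log_sum c')" unfolding ls using van AB by (rule vanishes_mono)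
    show "i \<in> {..<A} \<and> j < B" if "c' i j \<noteq> 0" for i j
      using that by (auto simp: c'_def split: if_splits)
  qed (use AB AB' in auto)
  then show ?case using less.prems by (simp add: c'_def)
qed

text \<open>Modulo \<open>p\<close> the factor \<open>X\<close> turns \<open>pderiv F\<close> into
  \<open>1 - U^(p-1)\<close>, and \<open>U\<close> turns this into \<open>U - U^p\<close>. Hence the
  span of the products of powers of \<open>X\<close>, \<open>F\<close> and \<open>U^p\<close> is
  stable modulo \<open>p\<close>.\<close>

definition XU_deriv :: "int poly \<Rightarrow> int poly" where
  "XU_deriv f = X * U * pderiv f"

lemma XU_deriv_add: "XU_deriv (f + g) = XU_deriv f + XU_deriv g"
  by (simp only: XU_deriv_def pderiv_add distrib_left)

lemma XU_deriv_smult: "XU_deriv (smult a f) = smult a (XU_deriv f)"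
  by (simp only: XU_deriv_def pderiv_smult mult_smult_right)

lemma funpow_XU_deriv_add: "(XU_deriv ^^ n) (f + g) = (XU_deriv ^^ n) f + (XU_deriv ^^ n) g"
  by (induction n) (simp_all add: XU_deriv_add)

lemma funpow_XU_deriv_smult: "(XU_deriv ^^ n) (smult a f) = smult a ((XU_deriv ^^ n) f)"
  by (induction n) (simp_all add: XU_deriv_smult)

lemma funpow_XU_deriv_sum: "(XU_deriv ^^ n) (sum f I) = (\<Sum>i\<in>I. (XU_deriv ^^ n) (f i))"
proof (induction I rule: infinite_finite_induct)
  have z: "(XU_deriv ^^ n) 0 = 0"
    using funpow_XU_deriv_smult[of n 0 0] by simp
  case empty show ?case by (simp add: z)
  case (infinite A) then show ?case using z by simp
next
  case (insert x A)
  then show ?case by (simp add: funpow_XU_deriv_add)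
qed

definition aux_monomial :: "nat \<Rightarrow> nat \<Rightarrow> nat \<Rightarrow> int poly" where
  "aux_monomial i j k = X^i * F^j * U^(p*k)"

lemma X_minus_1: "X - 1 = U"
  by (simp add: one_pCons)

text \<open>Modulo \<open>p\<close> the derivative of \<open>U^(p*k)\<close> is zero, so the
  derivation acts on \<open>X^i * F^j\<close> alone, and \<open>U = X - 1\<close> turns every term
  into an auxiliary monomial. The truncated \<open>j - 1\<close> at \<open>j = 0\<close> is harmless
  because of the factor \<open>int j\<close>.\<close>

lemma XU_deriv_aux_monomial:
  "\<exists>h. XU_deriv (aux_monomial i j k) =
     smult (int i) (aux_monomial (Suc i) j k) + smult (- int i) (aux_monomial i j k) +
     smult (int j) (aux_monomial (Suc i) (j-1) k) + smult (- int j) (aux_monomial i (j-1) k) +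
     smult (- int j) (aux_monomial i (j-1) (Suc k)) + smult (int p) h"
proof -
  have 1: "X * pderiv (X^i * F^j) = smult (int i) (X^i * F^j) + smult (int j) (X^i * F^(j-1)) * (1 - U^(p-1) + P * F)"
    using theta_monomial unfolding X_pderiv_F .
  have 2: "pderiv (U^(p*k)) = P * (smult (int k) (U^(p*k-1)))"
    by (simp add: pderiv_power pderiv_pCons mult.commute)
  have 3: "U * U^(p-1) = U^p"
    using p_gt_2 by (cases p) auto
  have "XU_deriv (aux_monomial i j k) = (X * pderiv (X^i * F^j)) * (U * U^(p*k)) + X * U * X^i * F^j * pderiv (U^(p*k))"
    unfolding XU_deriv_def aux_monomial_def pderiv_mult[of "X^i * F^j"] by (simp only: distrib_left mult_ac add_ac)
  also have "\<dots> = smult (int i) (X^i * F^j) * (U * U^(p*k)) + smult (int j) (X^i * F^(j-1)) * (U - U^p) * U^(p*k)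
      + P * (smult (int j) (X^i * F^(j-1)) * F * (U * U^(p*k)) + X * U * X^i * F^j * (smult (int k) (U^(p*k-1))))"
    unfolding 1 2 3[symmetric] by (simp only: algebra_simps)
  also have "smult (int i) (X^i * F^j) * (U * U^(p*k)) = smult (int i) (aux_monomial (Suc i) j k) + smult (- int i) (aux_monomial i j k)"
  proof -
    have "aux_monomial (Suc i) j k - aux_monomial i j k = X^i * F^j * ((X - 1) * U^(p*k))"
      by (simp only: aux_monomial_def power_Suc algebra_simps mult_1_left mult_1_right)
    then have "smult (int i) (aux_monomial (Suc i) j k - aux_monomial i j k) = smult (int i) (X^i * F^j) * (U * U^(p*k))"
      unfolding X_minus_1 by (simp only: mult_smult_left)
    then show ?thesis by (simp add: smult_diff_right)
  qed
  also have "smult (int j) (X^i * F^(j-1)) * (U - U^p) * U^(p*k) =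
     smult (int j) (aux_monomial (Suc i) (j-1) k) + smult (- int j) (aux_monomial i (j-1) k) +
     smult (- int j) (aux_monomial i (j-1) (Suc k))"
  proof -
    have "aux_monomial (Suc i) (j-1) k - aux_monomial i (j-1) k - aux_monomial i (j-1) (Suc k)
       = X^i * F^(j-1) * ((X - 1 - U^p) * U^(p*k))"
      by (simp only: aux_monomial_def power_Suc mult_Suc_right power_add algebra_simps mult_1_left mult_1_right)
    then have "smult (int j) (aux_monomial (Suc i) (j-1) k - aux_monomial i (j-1) k - aux_monomial i (j-1) (Suc k)) =
       smult (int j) (X^i * F^(j-1)) * (U - U^p) * U^(p*k)"
      unfolding X_minus_1 by (simp only: mult_smult_left mult.assoc)
    then show ?thesis by (simp add: smult_diff_right)
  qed
  finally show ?thesis by (auto simp: add.assoc)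
qed

text \<open>\<open>jet r n i j k\<close> agrees modulo \<open>p\<close> with \<open>(XU_deriv ^^ n) (aux_monomial i j k)\<close> at the integers \<open>x\<close> with
  \<open>F x = r\<close>, but has small degree because \<open>U^p\<close> is replaced by \<open>U\<close>.\<close>

fun jet :: "int \<Rightarrow> nat \<Rightarrow> nat \<Rightarrow> nat \<Rightarrow> nat \<Rightarrow> int poly" where
  "jet r 0 i j k = smult (r^j) (X^i * U^k)"
| "jet r (Suc n) i j k =
     smult (int i) (jet r n (Suc i) j k) + smult (- int i) (jet r n i j k) +
     smult (int j) (jet r n (Suc i) (j-1) k) + smult (- int j) (jet r n i (j-1) k) +
     smult (- int j) (jet r n i (j-1) (Suc k))"

lemma degree_jet: "degree (jet r n i j k) \<le> i + k + n"
proof (induction n arbitrary: i j k)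
  case 0
  have "degree (X^i * U^k) \<le> i + k"
    by (simp add: degree_mult_eq degree_power_eq)
  then show ?case by (simp only: jet.simps add_0_right) (rule order.trans[OF degree_smult_le])
next
  case (Suc n)
  show ?case
    unfolding jet.simps
    by (intro degree_add_le order.trans[OF degree_smult_le] order.trans[OF Suc.IH]) simp_all
qed

lemma jet_cong:
  assumes "int p dvd poly F x - r"
  shows "int p dvd poly ((XU_deriv ^^ n) (aux_monomial i j k)) x - poly (jet r n i j k) x"
proof (induction n arbitrary: i j k)
  case 0
  have "[poly F x = r] (mod int p)" using assms by (simp add: cong_iff_dvd_diff)
  moreover have "[(x - 1)^p = x - 1] (mod int p)"
    using int_fermat[OF prime_p] by (simp add: cong_iff_dvd_diff)
  ultimately have "[x^i * poly F x ^ j * ((x - 1)^p)^k = x^i * r^j * (x - 1)^k] (mod int p)"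
    by (intro cong_mult cong_pow cong_refl)
  then show ?case
    by (simp add: aux_monomial_def cong_iff_dvd_diff poly_power power_mult mult.assoc mult.left_commute[of "r^j"])
next
  case (Suc n)
  obtain h where h: "XU_deriv (aux_monomial i j k) =
     smult (int i) (aux_monomial (Suc i) j k) + smult (- int i) (aux_monomial i j k) +
     smult (int j) (aux_monomial (Suc i) (j-1) k) + smult (- int j) (aux_monomial i (j-1) k) +
     smult (- int j) (aux_monomial i (j-1) (Suc k)) + smult (int p) h"
    using XU_deriv_aux_monomial by blast
  have IH: "[poly ((XU_deriv ^^ n) (aux_monomial i j k)) x = poly (jet r n i j k) x] (mod int p)" for i j k
    using Suc.IH by (simp add: cong_iff_dvd_diff)
  have "[poly ((XU_deriv ^^ Suc n) (aux_monomial i j k)) x = poly (jet r (Suc n) i j k) x + int p * poly ((XU_deriv ^^ n) h) x] (mod int p)"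
    unfolding funpow_Suc_right o_apply h funpow_XU_deriv_add funpow_XU_deriv_smult jet.simps poly_add poly_smult
    by (intro cong_add cong_mult IH cong_refl)
  then show ?case
    unfolding cong_def mod_mult_self2 unfolding cong_def[symmetric] by (simp only: cong_iff_dvd_diff)
qed


text \<open>By the product rule, the value of the cofactor at \<open>x\<close> comes only from
  letting every derivation hit the linear power; each time this brings down the exponent and a
  factor \<open>x * (x - 1)\<close>.\<close>

lemma funpow_XU_deriv_linear_power:
  "\<exists>h'. (XU_deriv ^^ i) ([:-x, 1:]^(e+i) * h) = [:-x, 1:]^e * h' \<and>
     poly h' x = int (\<Prod>{e+1..e+i}) * (x * (x - 1))^i * poly h x"
proof (induction i arbitrary: e)
  case 0
  then show ?case by (intro exI[of _ h]) simp
next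
  case (Suc i)
  let ?L = "[:-x, 1:] :: int poly"
  obtain h' where h': "(XU_deriv ^^ i) (?L^(Suc e+i) * h) = ?L^Suc e * h'"
     "poly h' x = int (\<Prod>{Suc e+1..Suc e+i}) * (x * (x - 1))^i * poly h x"
    using Suc.IH[of "Suc e"] by blast
  define h'' where "h'' = smult (int (Suc e)) (X * U * h') + ?L * (X * U * pderiv h')"
  have pd: "pderiv (?L^Suc e) = smult (int (Suc e)) (?L^e)"
    by (simp only: pderiv_power_Suc) (simp add: pderiv_pCons)
  have "(XU_deriv ^^ Suc i) (?L^(e+Suc i) * h) = XU_deriv (?L^Suc e * h')"
    using h'(1) by simp
  also have "\<dots> = ?L^e * h''"
    unfolding XU_deriv_def pderiv_mult pd h''_def
    by (simp only: distrib_left mult_smult_left mult_smult_right power_Suc mult_ac add_ac)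
  finally have 1: "(XU_deriv ^^ Suc i) (?L^(e+Suc i) * h) = ?L^e * h''" .
  have "{e+1..e+Suc i} = insert (Suc e) {Suc e+1..Suc e+i}" by auto
  then have "\<Prod>{e+1..e+Suc i} = Suc e * \<Prod>{Suc e+1..Suc e+i}"
    by (simp only:) (subst prod.insert, auto)
  then have "int (\<Prod>{e+1..e+Suc i}) = int (Suc e) * int (\<Prod>{Suc e+1..Suc e+i})"
    by (simp only: of_nat_mult)
  moreover have "poly h'' x = int (Suc e) * (x * (x - 1)) * poly h' x"
    by (simp add: h''_def algebra_simps)
  ultimately have "poly h'' x = int (\<Prod>{e+1..e+Suc i}) * (x * (x - 1))^Suc i * poly h x"
    unfolding h'(2) by (simp only: power_Suc mult_ac)
  with 1 show ?case by blast
qed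

text \<open>If \<open>f = L^e * g\<close> modulo \<open>p\<close>, the \<open>e\<close>-th
  derivation at \<open>x\<close> is \<open>e! * (x * (x - 1))^e * poly g x\<close>. The first two
  factors are units because \<open>e < p\<close> and \<open>x\<close> is neither \<open>0\<close>
  nor \<open>1\<close> modulo \<open>p\<close>, so \<open>g\<close> has another root at
  \<open>x\<close>.\<close>

lemma linear_power_dvd_mod:
  assumes x: "\<not> int p dvd x" "\<not> int p dvd x - 1" and D: "D \<le> p"
    and van: "\<And>n. n < D \<Longrightarrow> int p dvd poly ((XU_deriv ^^ n) f) x"
  shows "\<exists>g h. f = [:-x, 1:]^D * g + P * h"
  using D van
proof (induction D)
  case 0
  then show ?case by (intro exI[of _ f] exI[of _ 0]) simp
next
  case (Suc e)
  let ?L = "[:-x, 1:] :: int poly"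
  obtain g h where f: "f = ?L^e * g + P * h" using Suc by force
  obtain g' where g': "(XU_deriv ^^ e) (?L^e * g) = g'" "poly g' x = int (\<Prod>{1..e}) * (x * (x - 1))^e * poly g x"
    using funpow_XU_deriv_linear_power[of e x 0 g] by auto
  have "(XU_deriv ^^ e) f = g' + smult (int p) ((XU_deriv ^^ e) h)"
    unfolding f funpow_XU_deriv_add g'(1) by (simp add: funpow_XU_deriv_smult)
  with Suc.prems(2)[of e] have "int p dvd poly g' x"
    by (simp add: dvd_add_left_iff)
  moreover have "\<not> int p dvd int (\<Prod>{1..e})"
  proof -
    have "\<Prod>{1..e} = (fact e :: nat)" by (simp add: fact_prod)
    then show ?thesis
      using prime_dvd_fact_iff[OF prime_p] Suc.prems(1) by (simp only: int_dvd_int_iff)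
  qed
  moreover have "\<not> int p dvd (x * (x - 1))^e"
    using x prime_int_p by (meson prime_dvd_mult_iff prime_dvd_power)
  ultimately have "int p dvd poly g x"
    unfolding g'(2) using prime_int_p by (meson prime_dvd_mult_iff)
  then obtain t where t: "poly g x = int p * t" by (rule dvdE)
  have "g = ?L * synthetic_div g x + [:poly g x:]"
    using synthetic_div_correct'[of x g] by simp
  then have "g = ?L * synthetic_div g x + P * [:t:]" by (simp add: t mult.commute)
  then obtain s where s: "g = ?L * s + P * [:t:]" by blast
  have "f = ?L^Suc e * s + P * (?L^e * [:t:] + h)"
    unfolding f s by (simp only: power_Suc algebra_simps)
  then show ?case by blast
qed

text \<open>Needed to multiply together the root powers at distinct points. The order is raised one
  step at a time, since cancelling \<open>L^e\<close> shows that \<open>M * a\<close> vanishes at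
  \<open>x\<close> modulo \<open>p\<close>.\<close>

lemma linear_power_dvd_mod_cancel:
  assumes M: "\<not> int p dvd poly M x" and "\<exists>a b. M * h = [:-x, 1:]^e * a + P * b"
  shows "\<exists>a b. h = [:-x, 1:]^e * a + P * b"
  using assms(2)
proof (induction e)
  case 0
  show ?case by (intro exI[of _ h] exI[of _ 0]) simp
next
  case (Suc e)
  let ?L = "[:-x, 1:] :: int poly"
  obtain c d where cd: "M * h = ?L^Suc e * c + P * d" using Suc.prems by blast
  then have "M * h = ?L^e * (?L * c) + P * d" by (simp only: power_Suc mult_ac)
  then obtain a b where h: "h = ?L^e * a + P * b" using Suc.IH by blast
  have "?L^e * (M * a - ?L * c) = M * h - P * (M * b) - ?L^Suc e * c"
    unfolding h by (simp only: algebra_simps power_Suc)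
  also have "\<dots> = P * (d - M * b)"
    unfolding cd by (simp only: algebra_simps power_Suc)
  finally have "P dvd ?L^e * (M * a - ?L * c)" by (metis dvd_triv_left)
  then have "P dvd M * a - ?L * c"
    using prime_elem_P prime_elem_dvd_multD not_P_dvd_monic monic_linear_power by blast
  from P_dvd_poly[OF this, of x] have "int p dvd poly M x * poly a x" by simp
  then have "int p dvd poly a x" using M prime_int_p by (meson prime_dvd_mult_iff)
  then obtain t where t: "poly a x = int p * t" by (rule dvdE)
  have "a = ?L * synthetic_div a x + [:poly a x:]"
    using synthetic_div_correct'[of x a] by simp
  then have "a = ?L * synthetic_div a x + P * [:t:]" by (simp add: t mult.commute)
  then obtain s where s: "a = ?L * s + P * [:t:]" by blast
  have "h = ?L^Suc e * s + P * (?L^e * [:t:] + b)"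
    unfolding h s by (simp only: power_Suc algebra_simps)
  then show ?case by blast
qed

lemma prod_linear_power_dvd_mod:
  assumes "finite Y" "Y \<subseteq> {0..<int p}" "\<And>x. x \<in> Y \<Longrightarrow> \<exists>g h. f = [:-x, 1:]^D * g + P * h"
  shows "\<exists>g h. f = (\<Prod>x\<in>Y. [:-x, 1:]^D) * g + P * h"
  using assms
proof (induction Y rule: finite_induct)
  case empty
  show ?case by (intro exI[of _ f] exI[of _ 0]) simp
next
  case (insert x Y)
  let ?M = "\<Prod>x\<in>Y. [:-x, 1:]^D :: int poly"
  obtain g h where f: "f = ?M * g + P * h" using insert by auto
  obtain a b where f': "f = [:-x, 1:]^D * a + P * b" using insert.prems(2) by blast
  have "?M * g = [:-x, 1:]^D * a + P * (b - h)"
    using trans[OF f[symmetric] f'] by (simp only: right_diff_distrib add_diff_eq eq_diff_eq)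
  moreover have "\<not> int p dvd poly ?M x"
  proof
    assume "int p dvd poly ?M x"
    then have "int p dvd (\<Prod>y\<in>Y. (x - y)^D)" by (simp add: poly_prod)
    then obtain y where y: "y \<in> Y" "int p dvd (x - y)^D"
      using prime_dvd_prod_iff[OF insert.hyps(1) prime_int_p, of "\<lambda>y. (x - y)^D"] by blast
    then have "int p dvd x - y" using prime_dvd_power[OF prime_int_p] by blast
    moreover have "x \<in> {0..<int p}" "y \<in> {0..<int p}" using y(1) insert.prems(1) by auto
    ultimately have "x = y" by (metis atLeastLessThan_iff mod_eq_dvd_iff mod_pos_pos_trivial)
    then show False using y insert.hyps by simp
  qed
  ultimately obtain a' b' where g: "g = [:-x, 1:]^D * a' + P * b'"
    using linear_power_dvd_mod_cancel[of ?M x g D] by blast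
  have "f = (\<Prod>x\<in>insert x Y. [:-x, 1:]^D) * a' + P * (?M * b' + h)"
    unfolding f g prod.insert[OF insert.hyps] by (simp only: algebra_simps)
  then show ?case by blast
qed

text \<open>As \<open>M\<close> is monic, \<open>pseudo_divmod\<close> is genuine division
  \<open>h = M * q + r\<close>. Then \<open>f - P * r\<close> is a multiple of \<open>M\<close> of
  smaller degree, hence zero.\<close>

lemma P_dvd_of_small_degree:
  assumes "lead_coeff M = 1" "f = M * g + P * h" "degree f < degree M"
  shows "P dvd f"
proof -
  obtain q r where qr: "pseudo_divmod h M = (q, r)" by fastforce
  have "M \<noteq> 0" using assms(1) by auto
  from pseudo_divmod[OF this qr] have h: "h = M * q + r" and r: "r = 0 \<or> degree r < degree M"
    using assms(1) by simp_all
  have eq: "f - P * r = M * (g + P * q)"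
    unfolding assms(2) h by (simp only: algebra_simps)
  have "degree (P * r) \<le> degree r" by (simp add: degree_smult_le)
  then have "degree (f - P * r) < degree M"
    using r assms(3) by (intro degree_diff_less) auto
  then have "g + P * q = 0"
    using assms(1) \<open>M \<noteq> 0\<close> unfolding eq by (metis degree_mult_eq le_add1 not_le)
  with eq have "f = P * r" by simp
  then show ?thesis by (metis dvd_triv_left)
qed

lemma count_multiple_roots:
  assumes "finite Y" "Y \<subseteq> {0..<int p}" "\<And>x. x \<in> Y \<Longrightarrow> \<exists>g h. f = [:-x, 1:]^D * g + P * h"
    and "\<not> P dvd f"
  shows "D * card Y \<le> degree f"
proof -
  let ?M = "\<Prod>x\<in>Y. [:-x, 1:]^D :: int poly"
  have lc: "lead_coeff ?M = 1"
    unfolding lead_coeff_prod by (intro prod.neutral ballI monic_linear_power)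
  have "degree ?M = (\<Sum>x\<in>Y. D)"
    by (subst degree_prod_eq_sum_degree) (auto simp: degree_power_eq)
  then have "degree ?M = D * card Y" by simp
  moreover obtain g h where "f = ?M * g + P * h" using prod_linear_power_dvd_mod[OF assms(1-3)] by blast
  ultimately show ?thesis using P_dvd_of_small_degree[OF lc] assms(4) by (metis not_le)
qed

text \<open>There are more coefficients than linear conditions, so some nonzero auxiliary
  polynomial vanishes to order \<open>D\<close> at every root; at a root \<open>U^p\<close> and \<open>F\<close> take the values \<open>U\<close> and \<open>r\<close>,
  which keeps the degrees of the conditions small.\<close>

lemma stepanov:
  fixes R :: "int set"
  assumes AB: "A * B \<le> p" and pos: "A > 0" "B > 0" "C > 0" and D: "D \<le> p" and R: "finite R"
    and less: "D * card R * (A + C + D) < A * B * C"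
  shows "D * card {x \<in> {2..<int p}. \<exists>r\<in>R. int p dvd poly F x - r} \<le> A + p * (B + C)"
proof -
  \<comment> \<open>The unknowns are the \<open>A * B * C\<close> coefficients. The equations are
    indexed by an order \<open>n < D\<close>, a value \<open>r\<close> and a coefficient of the jet,
    whose degree is below \<open>A + C + D\<close>.\<close>
  define I where "I = {..<A} \<times> {..<B} \<times> {..<C}"
  define J where "J = {..<D} \<times> R \<times> {..<A+C+D}"
  have "card J < card I"
    unfolding I_def J_def using less by (simp add: card_cartesian_product mult.assoc)
  moreover have "finite I" and fJ: "finite J" by (auto simp: I_def J_def R)
  ultimately have "\<exists>\<mu>. (\<exists>t\<in>I. \<not> int p dvd \<mu> t) \<and> (\<forall>e\<in>J. int p dvd (\<Sum>t\<in>I. \<mu> t * (case t of (i,j,k) \<Rightarrow> case e of (n,r,m) \<Rightarrow> coeff (jet r n i j k) m)))"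
    using p_gt_2 by (intro pigeonhole_mod_solution) simp_all
  then obtain \<mu> where \<mu>: "\<exists>t\<in>I. \<not> int p dvd \<mu> t"
    "\<And>e. e \<in> J \<Longrightarrow> int p dvd (\<Sum>t\<in>I. \<mu> t * (case t of (i,j,k) \<Rightarrow> case e of (n,r,m) \<Rightarrow> coeff (jet r n i j k) m))"
    by blast
  define f where "f = (\<Sum>(i,j,k)\<in>I. smult (\<mu> (i,j,k)) (aux_monomial i j k))"
  have jet0: "P dvd (\<Sum>(i,j,k)\<in>I. smult (\<mu> (i,j,k)) (jet r n i j k))" if "n < D" "r \<in> R" for n r
    unfolding P_dvd_iff
  proof
    fix m
    have c: "coeff (\<Sum>(i,j,k)\<in>I. smult (\<mu> (i,j,k)) (jet r n i j k)) m =
        (\<Sum>t\<in>I. \<mu> t * (case t of (i,j,k) \<Rightarrow> coeff (jet r n i j k) m))"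
      unfolding coeff_sum by (intro sum.cong) auto
    show "int p dvd coeff (\<Sum>(i,j,k)\<in>I. smult (\<mu> (i,j,k)) (jet r n i j k)) m"
    proof (cases "m < A + C + D")
      case True
      with that \<mu>(2)[of "(n, r, m)"] show ?thesis unfolding c by (simp add: J_def)
    next
      case False
      have "coeff (jet r n i j k) m = 0" if "(i,j,k) \<in> I" for i j k
        using degree_jet[of r n i j k] that False \<open>n < D\<close> by (intro coeff_eq_0) (auto simp: I_def)
      then show ?thesis unfolding c by (subst sum.neutral) auto
    qed
  qed
  \<comment> \<open>The points \<open>0\<close> and \<open>1\<close> are left out because
    \<open>X * U\<close> vanishes there.\<close>
  define Y where "Y = {x \<in> {2..<int p}. \<exists>r\<in>R. int p dvd poly F x - r}"
  have subY: "Y \<subseteq> {0..<int p}" by (auto simp: Y_def)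
  then have finY: "finite Y" using finite_subset by blast
  have "\<not> P dvd f"
  proof
    assume "P dvd f"
    also have "f = (\<Sum>k<C. U^(p*k) * (\<Sum>i<A. \<Sum>j<B. smult (\<mu> (i,j,k)) (X^i * F^j)))"
    proof -
      have "f = (\<Sum>i<A. \<Sum>j<B. \<Sum>k<C. smult (\<mu> (i,j,k)) (aux_monomial i j k))"
        unfolding f_def I_def sum.cartesian_product by simp
      also have "\<dots> = (\<Sum>i<A. \<Sum>k<C. \<Sum>j<B. smult (\<mu> (i,j,k)) (aux_monomial i j k))"
        by (intro sum.cong refl sum.swap)
      also have "\<dots> = (\<Sum>k<C. \<Sum>i<A. \<Sum>j<B. smult (\<mu> (i,j,k)) (aux_monomial i j k))"
        by (rule sum.swap)
      finally show ?thesis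
        by (simp only: sum_distrib_left aux_monomial_def mult_smult_right mult_ac)
    qed
    finally have "int p dvd \<mu> (i,j,k)" if "i < A" "j < B" "k < C" for i j k
      using auxiliary_nonzero[OF AB, where C = C and c = "\<lambda>i j k. \<mu> (i,j,k)"] that by simp
    then show False using \<mu>(1) by (auto simp: I_def)
  qed
  moreover have "\<exists>g h. f = [:-x, 1:]^D * g + P * h"
    if x: "x \<in> Y" for x
  proof (rule linear_power_dvd_mod)
    show "\<not> int p dvd x" "\<not> int p dvd x - 1" using x by (auto simp: Y_def dest: zdvd_imp_le)
    fix n assume n: "n < D"
    obtain r where r: "r \<in> R" "int p dvd poly F x - r" using x by (auto simp: Y_def)
    have "int p dvd poly ((XU_deriv ^^ n) f) x - poly (\<Sum>(i,j,k)\<in>I. smult (\<mu> (i,j,k)) (jet r n i j k)) x"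
    proof -
      have "[poly ((XU_deriv ^^ n) f) x = poly (\<Sum>(i,j,k)\<in>I. smult (\<mu> (i,j,k)) (jet r n i j k)) x] (mod int p)"
        unfolding f_def funpow_XU_deriv_sum poly_sum
      proof (rule cong_sum)
        fix t :: "nat \<times> nat \<times> nat"
        obtain i j k where t: "t = (i,j,k)" by (cases t)
        show "[poly ((XU_deriv ^^ n) (case t of (i,j,k) \<Rightarrow> smult (\<mu> (i,j,k)) (aux_monomial i j k))) x =
           poly (case t of (i,j,k) \<Rightarrow> smult (\<mu> (i,j,k)) (jet r n i j k)) x] (mod int p)"
          unfolding t prod.case funpow_XU_deriv_smult poly_smult
          using jet_cong[OF r(2)] by (intro cong_mult cong_refl) (simp only: cong_iff_dvd_diff)
      qed
      then show ?thesis by (simp only: cong_iff_dvd_diff)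
    qed
    from dvd_add[OF this P_dvd_poly[OF jet0[OF n r(1)], of x]] show "int p dvd poly ((XU_deriv ^^ n) f) x"
      by (simp only: diff_add_cancel)
  qed (use D in auto)
  ultimately have "D * card Y \<le> degree f"
    by (intro count_multiple_roots[OF finY subY])
  also have "degree f \<le> A + p * (B + C)"
    unfolding f_def
  proof (intro degree_sum_le)
    show "finite I" by fact
    fix t assume t: "t \<in> I"
    obtain i j k where ijk: "t = (i,j,k)" by (cases t)
    have "degree (F^j) \<le> p * j"
      using degree_power_le[of F j] mult_le_mono1[OF degree_F, of j] by (meson diff_le_self le_trans mult_le_mono1)
    then have "degree (aux_monomial i j k) \<le> i + p * j + p * k"
      unfolding aux_monomial_def
      by (intro order.trans[OF degree_mult_le] add_mono) (auto simp: degree_power_eq)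
    also have "\<dots> \<le> A + p * B + p * C"
      using t unfolding ijk I_def by (intro add_mono mult_le_mono2) auto
    finally show "degree (case t of (i,j,k) \<Rightarrow> smult (\<mu> (i,j,k)) (aux_monomial i j k)) \<le> A + p * (B + C)"
      unfolding ijk by (auto simp: distrib_left intro: order.trans[OF degree_smult_le])
  qed
  finally show ?thesis by (simp only: Y_def)
qed

end


section \<open>Additive energy of the \<open>p\<close>-th powers modulo \<open>p^2\<close>\<close>

text \<open>Both \<open>a - b\<close> and the cofactor in \<open>a^p - b^p\<close> are divisible by
  \<open>p\<close>, the latter as a sum of \<open>p\<close> terms congruent to
  \<open>b^(p-1)\<close>. Thus the group is parametrised by residues \<open>t\<close> modulo
  \<open>p\<close>.\<close>

lemma cong_pow_p_square:
  fixes a b :: int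
  assumes "[a = b] (mod int p)"
  shows "[a^p = b^p] (mod (int p)^2)"
proof -
  have "[(\<Sum>i<p. b^(p - Suc i) * a^i) = (\<Sum>i<p. b^(p-1))] (mod int p)"
  proof (rule cong_sum)
    fix i assume i: "i \<in> {..<p}"
    have "[b^(p - Suc i) * a^i = b^(p - Suc i) * b^i] (mod int p)"
      by (intro cong_mult cong_pow cong_refl assms)
    also have "b^(p - Suc i) * b^i = b^(p-1)"
      using i by (simp flip: power_add)
    finally show "[b^(p - Suc i) * a^i = b^(p-1)] (mod int p)" .
  qed
  then have "[(\<Sum>i<p. b^(p - Suc i) * a^i) = int p * b^(p-1)] (mod int p)" by simp
  then have "int p dvd (\<Sum>i<p. b^(p - Suc i) * a^i)"
    using cong_dvd_iff dvd_triv_left by blast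
  moreover have "int p dvd a - b" using assms by (simp add: cong_iff_dvd_diff)
  ultimately have "(int p)^2 dvd (a - b) * (\<Sum>i<p. b^(p - Suc i) * a^i)"
    unfolding power2_eq_square by (rule mult_dvd_mono[rotated])
  then show ?thesis
    unfolding cong_iff_dvd_diff power_diff_sumr2 .
qed

context odd_prime
begin

lemma p_pos: "p > 0"
  using p_gt_2 by simp

text \<open>Stepanov's method with optimised parameters: \<open>T\<close> values have at most
  \<open>150 * (p * T)^(2/3)\<close> preimages, cubed to avoid fractional exponents.\<close>

lemma stepanov_bound:
  fixes R :: "int set"
  assumes R: "finite R" "R \<noteq> {}" and T: "(card R)^2 \<le> p" and big: "p \<ge> 2500"
  shows "real (card {x \<in> {2..<int p}. \<exists>r\<in>R. int p dvd poly F x - r}) ^ 3 \<le> 150^3 * (real p * real (card R))^2"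
proof -
  define T where "T = real (card R)"
  define pr where "pr = real p"
  \<comment> \<open>The parameters will be \<open>A\<close> near \<open>a\<close>,
    \<open>B = C\<close> near \<open>b\<close> and \<open>D\<close> near \<open>a / 25\<close>. Here
    \<open>a * b = p\<close> respects \<open>A * B \<le> p\<close>, and \<open>T * a = b^2\<close>
    balances the equations against the unknowns.\<close>
  define b where "b = (pr * T) powr (1/3)"
  define a where "a = pr / b"
  define Y where "Y = {x \<in> {2..<int p}. \<exists>r\<in>R. int p dvd poly F x - r}"
  have T1: "T \<ge> 1" using R by (simp add: T_def Suc_le_eq card_gt_0_iff)
  have p1: "pr \<ge> 2500" using big by (simp add: pr_def)
  have T2: "T^2 \<le> pr" using assms(3) unfolding T_def pr_def by (metis of_nat_le_iff of_nat_power)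
  have pT: "1 \<le> pr * T" using mult_mono[of 1 pr 1 T] T1 p1 by simp
  have b0: "b \<ge> 1" unfolding b_def using pT by (simp add: ge_one_powr_ge_zero)
  have b3: "b^3 = pr * T"
    unfolding b_def using pT by (simp add: powr_powr flip: powr_numeral)
  \<comment> \<open>This is where \<open>T^2 \<le> p\<close> is used; it gives
    \<open>b \<le> a\<close>, so that \<open>a\<close> controls \<open>A + B + D\<close>.\<close>
  have b2: "b^2 \<le> pr"
  proof (rule power_le_imp_le_base[of _ 2])
    have "(b^2)^3 = pr^2 * T^2" unfolding b3[symmetric] power_mult_distrib[symmetric] by (simp add: power_mult[symmetric] mult.commute)
    also have "\<dots> \<le> pr^2 * pr" using T2 p1 by (intro mult_left_mono) auto
    finally have "(b^2)^3 \<le> pr^3" by (simp add: power3_eq_cube power2_eq_square)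
    then show "(b^2)^Suc 2 \<le> pr^Suc 2" by (simp add: numeral_3_eq_3)
  qed (use p1 in simp)
  have ab: "a * b = pr" unfolding a_def using b0 by simp
  have a0: "a > 0" using ab b0 p1 by (simp add: a_def)
  have aleb: "b \<le> a" using b2 ab b0 unfolding power2_eq_square by (metis mult_le_cancel_right_pos less_le_trans zero_less_one)
  have apr: "a \<le> pr" unfolding ab[symmetric] using b0 a0 by simp
  have a2: "a \<ge> 50"
  proof (rule ccontr)
    assume "\<not> a \<ge> 50"
    then have "a * b < 50 * 50" using aleb b0 a0 by (intro mult_strict_mono) auto
    then show False using ab p1 by simp
  qed
  have Ta: "T * a = b^2"
  proof -
    have "T * a * b = b^2 * b" using b3 ab by (simp add: power3_eq_cube power2_eq_square mult_ac)
    then show ?thesis using b0 by simp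
  qed
  \<comment> \<open>As \<open>a \<ge> 50\<close> and \<open>b \<ge> 1\<close>, rounding down loses
    at most a factor 2 each time. The divisor 25 is large enough for the comparison
    \<open>51/625 < 1/8\<close> of equations with unknowns.\<close>
  define A where "A = nat \<lfloor>a\<rfloor>"
  define B where "B = nat \<lfloor>b\<rfloor>"
  define D where "D = nat \<lfloor>a / 25\<rfloor>"
  have A: "real A \<le> a" "a / 2 \<le> real A" unfolding A_def using a2 by linarith+
  have B: "real B \<le> b" "b / 2 \<le> real B" proof -
    have "1 \<le> \<lfloor>b\<rfloor>" using b0 by simp
    then show "real B \<le> b" "b / 2 \<le> real B" unfolding B_def by linarith+
  qed
  have D: "real D \<le> a / 25" "a / 50 \<le> real D" unfolding D_def using a2 by linarith+
  have "real (A * B) \<le> real p"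
    unfolding of_nat_mult pr_def[symmetric] ab[symmetric] using A B a0 by (intro mult_mono) auto
  then have ABp: "A * B \<le> p" by (simp only: of_nat_le_iff)
  have Dp: "D \<le> p"
  proof -
    have "real D \<le> real p" using D apr a0 unfolding pr_def by linarith
    then show ?thesis by simp
  qed
  have "real (D * card R * (A + B + D)) < real (A * B * B)"
  proof -
    have "real (D * card R * (A + B + D)) \<le> (a / 25 * T) * (a + a + a / 25)"
      unfolding of_nat_mult of_nat_add T_def using A B D aleb a0 by (intro mult_mono add_mono) auto
    also have "\<dots> = (51 / 625) * (a * (T * a))" by (simp add: field_simps)
    also have "\<dots> = (51 / 625) * (a * b^2)" unfolding Ta ..
    also have "\<dots> < (a/2) * (b/2) * (b/2)" using a0 b0 by (simp add: power2_eq_square)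
    also have "\<dots> \<le> real (A * B * B)"
      unfolding of_nat_mult using A B a0 b0 by (intro mult_mono) auto
    finally show ?thesis .
  qed
  then have less: "D * card R * (A + B + D) < A * B * B" by (simp only: of_nat_less_iff)
  have "D * card Y \<le> A + p * (B + B)"
    unfolding Y_def
  proof (rule stepanov[OF ABp _ _ _ Dp R(1) less])
    show "A > 0" "B > 0" "B > 0" using A B a2 b0 by (auto intro!: gr0I)
  qed
  then have "real (D * card Y) \<le> real (A + p * (B + B))" by (simp only: of_nat_le_iff)
  then have "real D * real (card Y) \<le> real A + pr * (real B + real B)" by (simp add: pr_def)
  also have "\<dots> \<le> pr * b + pr * (b + b)"
  proof (intro add_mono mult_left_mono)
    have "pr * 1 \<le> pr * b" using b0 p1 by (intro mult_left_mono) auto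
    then show "real A \<le> pr * b" using A apr by linarith
  qed (use B p1 in auto)
  finally have 1: "real D * real (card Y) \<le> 3 * pr * b" by (simp add: algebra_simps)
  have "a / 50 * real (card Y) \<le> real D * real (card Y)" using D by (intro mult_right_mono) auto
  with 1 have "a * real (card Y) \<le> a * (150 * b^2)"
    unfolding ab[symmetric] by (simp add: power2_eq_square algebra_simps)
  then have "real (card Y) \<le> 150 * b^2" using a0 by simp
  then have "real (card Y)^3 \<le> (150 * b^2)^3" by (intro power_mono) auto
  also have "\<dots> = 150^3 * (b^3)^2" by (simp add: power_mult_distrib power_mult[symmetric] mult.commute)
  finally show ?thesis unfolding Y_def b3 T_def pr_def .
qed

text \<open>The excluded points \<open>0\<close> and \<open>1\<close> would correspond to a summand
  divisible by \<open>p\<close> in the quadruples counted later.\<close>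

definition fibre :: "int \<Rightarrow> int set" where
  "fibre r = {x \<in> {2..<int p}. int p dvd poly F x - r}"

lemma finite_fibre [simp]: "finite (fibre r)"
  unfolding fibre_def by (rule finite_subset[of _ "{2..<int p}"]) auto

lemma fibre_disjoint:
  assumes "r \<in> {0..<int p}" "s \<in> {0..<int p}" "x \<in> fibre r" "x \<in> fibre s"
  shows "r = s"
proof -
  have "int p dvd (poly F x - s) - (poly F x - r)"
    using dvd_diff[of "int p" "poly F x - s" "poly F x - r"] assms(3,4) by (simp add: fibre_def)
  then show ?thesis
    using assms(1,2) by (simp add: mod_eq_dvd_iff[symmetric])
qed

lemma card_fibre_Union:
  assumes "R \<subseteq> {0..<int p}"
  shows "card {x \<in> {2..<int p}. \<exists>r\<in>R. int p dvd poly F x - r} = (\<Sum>r\<in>R. card (fibre r))"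
proof -
  have "{x \<in> {2..<int p}. \<exists>r\<in>R. int p dvd poly F x - r} = (\<Union>r\<in>R. fibre r)"
    by (auto simp: fibre_def)
  moreover have "finite R" using assms finite_subset by blast
  ultimately show ?thesis
  proof (simp only:, intro card_UN_disjoint ballI impI)
    fix i j assume ij: "i \<in> R" "j \<in> R" "i \<noteq> j"
    then show "fibre i \<inter> fibre j = {}"
      using fibre_disjoint[of i j] assms by blast
  qed auto
qed

lemma sum_card_fibre: "(\<Sum>r\<in>{0..<int p}. card (fibre r)) \<le> p"
proof -
  have "(\<Sum>r\<in>{0..<int p}. card (fibre r)) \<le> card {2..<int p}"
    unfolding card_fibre_Union[OF order.refl, symmetric] by (intro card_mono) auto
  then show ?thesis by simp
qed

text \<open>Applied to the set \<open>L\<close> of these values, Stepanov's bound reads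
  \<open>\<tau> * card L \<le> 150 * (p * card L)^(2/3)\<close>, which is the claim if
  \<open>(card L)^2 \<le> p\<close>. The lower bound on \<open>\<tau>\<close> excludes larger
  \<open>L\<close>.\<close>

lemma level_set_bound:
  fixes \<tau> :: nat
  assumes big: "p \<ge> 2500" and \<tau>: "real \<tau> \<ge> 300 * sqrt p"
  shows "real \<tau>^3 * real (card {r \<in> {0..<int p}. \<tau> \<le> card (fibre r)}) \<le> 150^3 * (real p)^2"
proof -
  define L where "L = {r \<in> {0..<int p}. \<tau> \<le> card (fibre r)}"
  have fL: "finite L" unfolding L_def by (rule finite_subset[of _ "{0..<int p}"]) auto
  have key: "real \<tau>^3 * real (card R) \<le> 150^3 * (real p)^2" if R: "R \<subseteq> L" "(card R)^2 \<le> p" for R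
  proof (cases "R = {}")
    case False
    have fR: "finite R" using R fL finite_subset by blast
    have "\<tau> * card R = (\<Sum>r\<in>R. \<tau>)" by simp
    also have "\<dots> \<le> (\<Sum>r\<in>R. card (fibre r))" using R by (intro sum_mono) (auto simp: L_def)
    also have "\<dots> = card {x \<in> {2..<int p}. \<exists>r\<in>R. int p dvd poly F x - r}"
      using R by (intro card_fibre_Union[symmetric]) (auto simp: L_def)
    finally have "real (\<tau> * card R)^3 \<le> real (card {x \<in> {2..<int p}. \<exists>r\<in>R. int p dvd poly F x - r})^3"
      by (intro power_mono) (simp_all only: of_nat_le_iff of_nat_0_le_iff)
    also have "\<dots> \<le> 150^3 * (real p * real (card R))^2"
      using stepanov_bound[OF fR False R(2) big] .
    finally have "real (card R)^2 * (real \<tau>^3 * real (card R)) \<le> real (card R)^2 * (150^3 * (real p)^2)"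
      by (simp add: power_mult_distrib power2_eq_square power3_eq_cube mult_ac)
    then show ?thesis using False fR by (simp add: card_gt_0_iff)
  qed simp
  show ?thesis
  proof (cases "(card L)^2 \<le> p")
    case True
    then show ?thesis using key[of L] by (simp add: L_def)
  next
    case False
    \<comment> \<open>A larger \<open>L\<close> has a subset of about \<open>sqrt p\<close> values,
      and the bound for that subset would force \<open>300^3 / 2 \<le> 150^3\<close>.\<close>
    define m where "m = nat \<lfloor>sqrt p\<rfloor>"
    have s: "sqrt p \<ge> 2" using big by (intro real_le_rsqrt) simp
    have m: "real m \<le> sqrt p" "sqrt p / 2 \<le> real m" unfolding m_def using s by linarith+
    have "real m^2 \<le> (sqrt p)^2" using m by (intro power_mono) auto
    then have m2: "m^2 \<le> p" by (simp flip: of_nat_power)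
    then have "m^2 \<le> (card L)^2" using False by linarith
    then have "m \<le> card L" by (rule power2_nat_le_imp_le[rotated] | simp)
    then obtain R where R: "R \<subseteq> L" "card R = m" by (meson obtain_subset_with_card_n)
    have 1: "real \<tau>^3 * real m \<le> 150^3 * (real p)^2" using key[of R] R m2 by simp
    have 2: "(300 * sqrt p)^3 * (sqrt p / 2) \<le> real \<tau>^3 * real m"
      using \<tau> m by (intro mult_mono power_mono) auto
    have 3: "(300 * sqrt p)^3 * (sqrt p / 2) = 300^3 / 2 * (sqrt p)^4"
      by (simp add: power_mult_distrib power4_eq_xxxx power3_eq_cube)
    have 4: "(sqrt p)^4 = (real p)^2"
      using power_mult[of "sqrt p" 2 2] by simp
    have "300^3 / 2 * (real p)^2 \<le> 150^3 * (real p)^2"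
      using order.trans[OF 2 1] unfolding 3 4 .
    then show ?thesis using p_pos by simp
  qed
qed

lemma sum_inverse_squares_le:
  assumes "m > 0" "m \<le> n"
  shows "(\<Sum>k\<in>{m<..n}. 1 / (real k)^2) \<le> 1 / real m - 1 / real n"
  using assms(2)
proof (induction n rule: dec_induct)
  case (step n)
  have "{m<..Suc n} = insert (Suc n) {m<..n}" using step by auto
  moreover have "1 / (real (Suc n))^2 \<le> 1 / real n - 1 / real (Suc n)"
  proof -
    have "n > 0" using step.hyps assms(1) by simp
    then have "1 / real n - 1 / real (Suc n) = 1 / (real n * real (Suc n))"
      by (simp add: field_simps)
    also have "\<dots> \<ge> 1 / (real (Suc n))^2"
      unfolding power2_eq_square using \<open>n > 0\<close> by (intro divide_left_mono mult_right_mono) auto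
    finally show ?thesis .
  qed
  ultimately show ?case using step.IH by simp
qed simp

text \<open>Each step from \<open>N\<close> to \<open>N + 1\<close> adds at most
  \<open>2 * (N + 1)\<close> to the square. Thresholds up to \<open>m\<close> are replaced by the
  linear term, because the level set bound starts only near \<open>300 * sqrt p\<close>.\<close>

lemma layer_cake:
  fixes N m n :: nat
  assumes "N \<le> n"
  shows "N^2 \<le> m * N + (\<Sum>k\<in>{m<..n}. if k \<le> N then 2 * k else 0)"
proof -
  have "N^2 \<le> m * N + (\<Sum>k\<in>{m<..N}. 2 * k)"
  proof (induction N)
    case (Suc N)
    show ?case
    proof (cases "Suc N \<le> m")
      case True
      then show ?thesis by (metis power2_eq_square mult_le_mono1 trans_le_add1)
    next
      case False
      then have "{m<..Suc N} = insert (Suc N) {m<..N}" by auto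
      then show ?thesis using Suc False by (simp add: power2_eq_square)
    qed
  qed simp
  also have "(\<Sum>k\<in>{m<..N}. 2 * k) = (\<Sum>k\<in>{m<..n}. if k \<le> N then 2 * k else 0)"
    using assms by (intro sum.mono_neutral_cong_left) auto
  finally show ?thesis by simp
qed

text \<open>At the threshold \<open>m\<close> near \<open>300 * sqrt p\<close> the two parts
  balance: the linear terms give at most \<open>m * p\<close>, and the higher thresholds give a sum
  of \<open>p^2 / k^2\<close> over \<open>k > m\<close>, of order \<open>p^2 / m\<close>.\<close>

lemma sum_fibre_squares:
  assumes big: "p \<ge> 2500"
  shows "(\<Sum>r\<in>{0..<int p}. real (card (fibre r))^2) \<le> 23000 * (real p * sqrt p)"
proof -
  define m where "m = nat \<lceil>300 * sqrt p\<rceil>"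
  define s where "s = sqrt p"
  have s1: "s \<ge> 1" unfolding s_def using big by simp
  have ss: "s * s = p" by (simp add: s_def)
  have m: "300 * s \<le> real m" "real m \<le> 301 * s" using s1 unfolding m_def s_def by linarith+
  have m0: "m > 0" using m s1 by (auto intro!: gr0I)
  \<comment> \<open>At least \<open>p\<close> to dominate every fibre, and at least \<open>m\<close>
    for the telescoping bound.\<close>
  define n where "n = max m p"
  have le_n: "card (fibre r) \<le> n" for r
  proof -
    have "card (fibre r) \<le> card {2..<int p}" unfolding fibre_def by (intro card_mono) auto
    then show ?thesis by (simp add: n_def)
  qed
  have "(\<Sum>r\<in>{0..<int p}. real (card (fibre r))^2)
      \<le> (\<Sum>r\<in>{0..<int p}. real m * real (card (fibre r)) + (\<Sum>k\<in>{m<..n}. if k \<le> card (fibre r) then 2 * real k else 0))"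
  proof (rule sum_mono)
    fix r
    have "real ((card (fibre r))^2) \<le> real (m * card (fibre r) + (\<Sum>k\<in>{m<..n}. if k \<le> card (fibre r) then 2 * k else 0))"
      using layer_cake[OF le_n] by (simp only: of_nat_le_iff)
    also have "\<dots> = real m * real (card (fibre r)) + (\<Sum>k\<in>{m<..n}. if k \<le> card (fibre r) then 2 * real k else 0)"
      by (simp add: if_distrib cong: if_cong)
    finally show "real (card (fibre r))^2 \<le> \<dots>" by simp
  qed
  also have "\<dots> = real m * real (\<Sum>r\<in>{0..<int p}. card (fibre r)) +
       (\<Sum>k\<in>{m<..n}. \<Sum>r\<in>{0..<int p}. if k \<le> card (fibre r) then 2 * real k else 0)"
    unfolding sum.distrib sum_distrib_left[symmetric] by (subst sum.swap) simp
  also have "\<dots> \<le> real m * real p + (\<Sum>k\<in>{m<..n}. 2 * 150^3 * (real p)^2 * (1 / (real k)^2))"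
  proof (intro add_mono mult_left_mono sum_mono)
    show "real (\<Sum>r\<in>{0..<int p}. card (fibre r)) \<le> real p" using sum_card_fibre by (simp only: of_nat_le_iff)
    fix k assume k: "k \<in> {m<..n}"
    then have k0: "real k \<ge> 300 * sqrt p" "k > 0" using m by (auto simp: s_def)
    have "(\<Sum>r\<in>{0..<int p}. if k \<le> card (fibre r) then 2 * real k else 0) = 2 * real k * real (card {r \<in> {0..<int p}. k \<le> card (fibre r)})"
      by (subst sum.inter_filter[symmetric]) auto
    moreover have "real k^3 * real (card {r \<in> {0..<int p}. k \<le> card (fibre r)}) \<le> 150^3 * (real p)^2"
      by (rule level_set_bound[OF big k0(1)])
    ultimately show "(\<Sum>r\<in>{0..<int p}. if k \<le> card (fibre r) then 2 * real k else 0) \<le> 2 * 150^3 * (real p)^2 * (1 / (real k)^2)"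
      using k0 by (simp add: field_simps power3_eq_cube power2_eq_square)
  qed auto
  also have "\<dots> \<le> real m * real p + 2 * 150^3 * (real p)^2 * (1 / real m)"
  proof -
    have "(\<Sum>k\<in>{m<..n}. 1 / (real k)^2) \<le> 1 / real m - 1 / real n"
      by (rule sum_inverse_squares_le[OF m0]) (simp add: n_def)
    also have "\<dots> \<le> 1 / real m" by simp
    finally show ?thesis unfolding sum_distrib_left[symmetric] by (intro add_left_mono mult_left_mono) auto
  qed
  also have "\<dots> \<le> 301 * s * real p + 2 * 150^3 * (real p)^2 * (1 / (300 * s))"
    using m m0 s1 by (intro add_mono mult_right_mono mult_left_mono divide_left_mono) auto
  also have "2 * 150^3 * (real p)^2 * (1 / (300 * s)) = 22500 * (real p * s)"
    unfolding ss[symmetric] using s1 by (simp add: field_simps power2_eq_square)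
  also have "301 * s * real p + 22500 * (real p * s) \<le> 23000 * (real p * s)"
    using s1 by (simp add: field_simps)
  finally show ?thesis by (simp add: s_def)
qed

section \<open>Quadruples of \<open>p\<close>-th powers with equal sums\<close>

lemma poly_F: "int p * poly F x = (1 - x)^p + x^p - 1"
  using arg_cong[OF smult_F, of "\<lambda>f. poly f x"] by simp

lemma cong_pow_p: "[x^p = x] (mod int p)"
  using int_fermat[OF prime_p] by (simp add: cong_iff_dvd_diff)

text \<open>As \<open>t\<close> runs through \<open>{1..<int p}\<close>, \<open>t^p\<close> runs
  once through the group modulo \<open>p^2\<close>, so the cardinality is the additive energy of the
  group.\<close>

definition heilbronn_quads :: "(int \<times> int \<times> int \<times> int) set" where
  "heilbronn_quads = {(t1, t2, t3, t4). t1 \<in> {1..<int p} \<and> t2 \<in> {1..<int p} \<and> t3 \<in> {1..<int p} \<and> t4 \<in> {1..<int p} \<and>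
     [t1^p + t2^p = t3^p + t4^p] (mod (int p)^2)}"

text \<open>Dividing by \<open>t1 + t2\<close> turns a quadruple into a pair of points \<open>x, y\<close> with \<open>F x = F y\<close>.\<close>

lemma heilbronn_quad_nonzero:
  assumes q: "(t1, t2, t3, t4) \<in> heilbronn_quads" and nz: "\<not> int p dvd t1 + t2"
  shows "\<exists>s\<in>{1..<int p}. \<exists>x y. x \<in> {2..<int p} \<and> y \<in> {2..<int p} \<and> int p dvd poly F x - poly F y \<and>
    t1 = s * x mod int p \<and> t2 = s * (1 - x) mod int p \<and> t3 = s * y mod int p \<and> t4 = s * (1 - y) mod int p"
proof -
  let ?p = "int p"
  have t: "t1 \<in> {1..<?p}" "t2 \<in> {1..<?p}" "t3 \<in> {1..<?p}" "t4 \<in> {1..<?p}"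
    "[t1^p + t2^p = t3^p + t4^p] (mod ?p^2)"
    using q by (auto simp: heilbronn_quads_def)
  define s where "s = (t1 + t2) mod ?p"
  have sc: "[s = t1 + t2] (mod ?p)" by (simp add: s_def cong_def)
  have ns: "\<not> ?p dvd s" using nz unfolding cong_dvd_iff[OF sc] .
  have s: "s \<in> {1..<?p}"
  proof -
    have "0 \<le> s" "s < ?p" using p_pos by (simp_all add: s_def)
    moreover have "s \<noteq> 0" using ns by auto
    ultimately show ?thesis by auto
  qed
  have "[t1^p + t2^p = t3^p + t4^p] (mod ?p)"
    using t(5) by (rule cong_dvd_modulus) (simp add: power2_eq_square)
  then have sc': "[s = t3 + t4] (mod ?p)"
    using sc cong_add[OF cong_pow_p[of t1] cong_pow_p[of t2]] cong_add[OF cong_pow_p[of t3] cong_pow_p[of t4]]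
    by (meson cong_sym cong_trans)
  have "coprime s ?p" using ns prime_int_p by (metis coprime_commute prime_imp_coprime)
  then obtain i where i: "[s * i = 1] (mod ?p)" using cong_solve_coprime_int by blast
  \<comment> \<open>Here \<open>x = u/s\<close> and \<open>1 - x = v/s\<close> modulo
    \<open>p\<close>; \<open>x\<close> avoids \<open>0\<close> and \<open>1\<close> because
    \<open>u\<close> and \<open>v\<close> are prime to \<open>p\<close>.\<close>
  have red: "\<exists>x\<in>{2..<?p}. [s * x = u] (mod ?p) \<and> u = s * x mod ?p \<and> v = s * (1 - x) mod ?p \<and> [s * (1 - x) = v] (mod ?p)"
    if u: "u \<in> {1..<?p}" "v \<in> {1..<?p}" "[s = u + v] (mod ?p)" for u v
  proof -
    define x where "x = u * i mod ?p"
    have "[s * x = s * (u * i)] (mod ?p)" unfolding x_def by (intro cong_mult cong_refl) (simp add: cong_def)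
    also have "s * (u * i) = u * (s * i)" by simp
    also have "[u * (s * i) = u * 1] (mod ?p)" by (intro cong_mult cong_refl i)
    finally have c1: "[s * x = u] (mod ?p)" by simp
    have "[s - s * x = (u + v) - u] (mod ?p)" by (intro cong_diff u c1)
    then have c2: "[s * (1 - x) = v] (mod ?p)" by (simp add: algebra_simps)
    have nu: "\<not> ?p dvd u" "\<not> ?p dvd v" using u by (auto dest: zdvd_imp_le)
    have "x \<noteq> 0" using c1 nu by (auto simp: cong_0_iff cong_sym_eq[of 0])
    moreover have "x \<noteq> 1" using c2 nu by (auto simp: cong_0_iff cong_sym_eq[of 0])
    moreover have "x \<ge> 0" "x < ?p" unfolding x_def using p_pos by simp_all
    ultimately have "x \<in> {2..<?p}" by auto
    then show ?thesis using c1 c2 u by (intro bexI[of _ x]) (auto simp: cong_def)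
  qed
  obtain x where x: "x \<in> {2..<?p}" "[s * x = t1] (mod ?p)" "t1 = s * x mod ?p" "t2 = s * (1 - x) mod ?p" "[s * (1 - x) = t2] (mod ?p)"
    using red[OF t(1,2) sc] by blast
  obtain y where y: "y \<in> {2..<?p}" "[s * y = t3] (mod ?p)" "t3 = s * y mod ?p" "t4 = s * (1 - y) mod ?p" "[s * (1 - y) = t4] (mod ?p)"
    using red[OF t(3,4) sc'] by blast
  \<comment> \<open>The definition of \<open>F\<close> gives
    \<open>(s * x)^p + (s * (1 - x))^p = s^p * (1 + p * F x)\<close>, so equal sums modulo
    \<open>p^2\<close> mean equal values of \<open>F\<close> modulo \<open>p\<close>.\<close>
  have pw: "[s^p * (1 + ?p * poly F x) = u^p + v^p] (mod ?p^2)" if "[s * x = u] (mod ?p)" "[s * (1 - x) = v] (mod ?p)" for x u v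
  proof -
    have "s^p * (1 + ?p * poly F x) = (s * x)^p + (s * (1 - x))^p"
      unfolding poly_F power_mult_distrib by (simp add: distrib_left)
    also have "[\<dots> = u^p + v^p] (mod ?p^2)" using that by (intro cong_add cong_pow_p_square)
    finally show ?thesis .
  qed
  have "[s^p * (1 + ?p * poly F x) = s^p * (1 + ?p * poly F y)] (mod ?p^2)"
    using pw[OF x(2,5)] pw[OF y(2,5)] t(5) by (meson cong_sym cong_trans)
  then have "?p^2 dvd s^p * (1 + ?p * poly F x) - s^p * (1 + ?p * poly F y)" by (simp only: cong_iff_dvd_diff)
  also have "\<dots> = ?p * (s^p * (poly F x - poly F y))" by (simp add: algebra_simps)
  finally have "?p dvd s^p * (poly F x - poly F y)" using p_pos by (simp add: power2_eq_square)
  then have "?p dvd poly F x - poly F y"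
    using ns prime_int_p by (metis prime_dvd_mult_iff prime_dvd_power)
  then show ?thesis using s x y by blast
qed

lemma card_fibre_pairs:
  "card {(x, y). x \<in> {2..<int p} \<and> y \<in> {2..<int p} \<and> int p dvd poly F x - poly F y}
    \<le> (\<Sum>r\<in>{0..<int p}. (card (fibre r))^2)"
proof -
  have "{(x, y). x \<in> {2..<int p} \<and> y \<in> {2..<int p} \<and> int p dvd poly F x - poly F y}
     \<subseteq> (\<Union>r\<in>{0..<int p}. fibre r \<times> fibre r)"
  proof (clarify, rule UN_I)
    fix x y assume xy: "x \<in> {2..<int p}" "y \<in> {2..<int p}" "int p dvd poly F x - poly F y"
    let ?r = "poly F x mod int p"
    show "?r \<in> {0..<int p}" using p_pos by simp
    have x: "int p dvd poly F x - ?r" by (simp add: mod_eq_dvd_iff[symmetric])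
    have "int p dvd (poly F x - ?r) - (poly F x - poly F y)" using x xy(3) by (rule dvd_diff)
    moreover have "(a - r) - (a - b) = b - r" for a b r :: int by simp
    ultimately have "int p dvd poly F y - ?r" by (simp only:)
    then show "(x, y) \<in> fibre ?r \<times> fibre ?r" using x xy by (auto simp: fibre_def)
  qed
  then have "card {(x, y). x \<in> {2..<int p} \<and> y \<in> {2..<int p} \<and> int p dvd poly F x - poly F y}
     \<le> card (\<Union>r\<in>{0..<int p}. fibre r \<times> fibre r)"
    by (intro card_mono) auto
  also have "\<dots> \<le> (\<Sum>r\<in>{0..<int p}. card (fibre r \<times> fibre r))" by (intro card_UN_le) auto
  finally show ?thesis by (simp add: card_cartesian_product power2_eq_square)
qed

text \<open>A generic quadruple is recovered from \<open>s\<close> and two points of one fibre. If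
  \<open>p\<close> divides \<open>t1 + t2\<close>, reduction modulo \<open>p\<close> shows that it
  divides \<open>t3 + t4\<close>, so \<open>t1\<close> and \<open>t3\<close> fix the quadruple;
  there are at most \<open>p^2\<close> of these.\<close>

lemma card_heilbronn_quads:
  assumes "p \<ge> 2500"
  shows "real (card heilbronn_quads) \<le> 24000 * ((real p)^2 * sqrt p)"
proof -
  let ?p = "int p"
  define Z where "Z = {(x, y). x \<in> {2..<?p} \<and> y \<in> {2..<?p} \<and> ?p dvd poly F x - poly F y}"
  define f where "f = (\<lambda>(s, x, y). (s * x mod ?p, s * (1 - x) mod ?p, s * y mod ?p, s * (1 - y) mod ?p))"
  define g where "g = (\<lambda>(u::int, v::int). (u, ?p - u, v, ?p - v))"
  have fZ: "finite Z" unfolding Z_def by (rule finite_subset[of _ "{2..<?p} \<times> {2..<?p}"]) auto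
  have sub: "heilbronn_quads \<subseteq> f ` ({1..<?p} \<times> Z) \<union> g ` ({1..<?p} \<times> {1..<?p})"
  proof
    fix w assume w: "w \<in> heilbronn_quads"
    obtain t1 t2 t3 t4 where wt: "w = (t1, t2, t3, t4)" by (cases w)
    show "w \<in> f ` ({1..<?p} \<times> Z) \<union> g ` ({1..<?p} \<times> {1..<?p})"
    proof (cases "?p dvd t1 + t2")
      case False
      then obtain s x y where "s \<in> {1..<?p}" "(x, y) \<in> Z" "w = f (s, x, y)"
        using heilbronn_quad_nonzero[of t1 t2 t3 t4] w unfolding wt Z_def f_def by auto
      then show ?thesis by (intro UnI1 image_eqI[of _ _ "(s, x, y)"]) auto
    next
      case True
      have t: "t1 \<in> {1..<?p}" "t2 \<in> {1..<?p}" "t3 \<in> {1..<?p}" "t4 \<in> {1..<?p}"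
        "[t1^p + t2^p = t3^p + t4^p] (mod ?p^2)"
        using w unfolding wt by (auto simp: heilbronn_quads_def)
      have "[t1^p + t2^p = t3^p + t4^p] (mod ?p)"
        using t(5) by (rule cong_dvd_modulus) (simp add: power2_eq_square)
      then have "[t1 + t2 = t3 + t4] (mod ?p)"
        using cong_add[OF cong_pow_p[of t1] cong_pow_p[of t2]] cong_add[OF cong_pow_p[of t3] cong_pow_p[of t4]]
        by (meson cong_sym cong_trans)
      then have True': "?p dvd t3 + t4" using True cong_dvd_iff by blast
      have eq: "v = ?p - u" if uv: "u \<in> {1..<?p}" "v \<in> {1..<?p}" "?p dvd u + v" for u v
      proof -
        obtain k where k: "u + v = ?p * k" using uv(3) by (rule dvdE)
        have 0: "?p * 0 < ?p * k" "?p * k < ?p * 2"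
          using uv(1,2) unfolding k[symmetric] by simp_all
        have "0 < k" "k < 2"
          by (rule mult_left_less_imp_less[OF 0(1)], simp, rule mult_left_less_imp_less[OF 0(2)], simp)
        then have "k = 1" by linarith
        then show ?thesis using k by simp
      qed
      have "w = g (t1, t3)" using eq[OF t(1,2) True] eq[OF t(3,4) True'] by (simp add: g_def wt)
      then show ?thesis using t by blast
    qed
  qed
  have "card heilbronn_quads \<le> card (f ` ({1..<?p} \<times> Z) \<union> g ` ({1..<?p} \<times> {1..<?p}))"
    using fZ by (intro card_mono sub) auto
  also have "\<dots> \<le> card ({1..<?p} \<times> Z) + card ({1..<?p} \<times> {1..<?p})"
    using fZ by (intro order.trans[OF card_Un_le] add_mono card_image_le) auto
  also have "\<dots> \<le> p * card Z + p * p"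
    unfolding card_cartesian_product by (intro add_mono mult_le_mono) auto
  finally have "real (card heilbronn_quads) \<le> real (p * card Z + p * p)" by (simp only: of_nat_le_iff)
  also have "\<dots> = real p * real (card Z) + (real p)^2" by (simp add: power2_eq_square)
  also have "real (card Z) \<le> real (\<Sum>r\<in>{0..<int p}. (card (fibre r))^2)"
    unfolding Z_def using card_fibre_pairs by (simp only: of_nat_le_iff)
  also have "\<dots> \<le> 23000 * (real p * sqrt p)" using sum_fibre_squares[OF assms] by simp
  finally have "real (card heilbronn_quads) \<le> real p * (23000 * (real p * sqrt p)) + (real p)^2 * 1"
    using p_pos by simp
  also have "(real p)^2 * 1 \<le> (real p)^2 * sqrt p" using p_pos by (intro mult_left_mono) auto
  finally show ?thesis by (simp add: power2_eq_square algebra_simps)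
qed

end


section \<open>Heilbronn sums\<close>

text \<open>Hoelder's inequality as two applications of Cauchy-Schwarz: first over \<open>V\<close>,
  then over \<open>Q\<close> weighted by the number of preimages, whose squares add up to the number
  of collisions.\<close>

lemma pushforward_fourth_power:
  fixes f :: "'b \<Rightarrow> real"
  assumes V: "finite V" and Q: "finite Q" "\<phi> ` V \<subseteq> Q"
  shows "(\<Sum>v\<in>V. f (\<phi> v))^4 \<le> (real (card V))^2 * real (card {(v, w) \<in> V \<times> V. \<phi> v = \<phi> w}) * (\<Sum>x\<in>Q. f x ^ 4)"
proof -
  define r where "r x = real (card {v \<in> V. \<phi> v = x})" for x
  have 1: "(\<Sum>v\<in>V. f (\<phi> v))^2 \<le> real (card V) * (\<Sum>v\<in>V. (f (\<phi> v))^2)"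
    using Cauchy_Schwarz_ineq_sum[of "\<lambda>_. 1" "\<lambda>v. f (\<phi> v)" V] by simp
  have "(\<Sum>v\<in>V. (f (\<phi> v))^2) = (\<Sum>x\<in>Q. \<Sum>v | v \<in> V \<and> \<phi> v = x. (f (\<phi> v))^2)"
    by (rule sum.group[OF V Q, symmetric])
  also have "\<dots> = (\<Sum>x\<in>Q. r x * (f x)^2)"
    by (intro sum.cong) (auto simp: r_def)
  finally have 2: "(\<Sum>v\<in>V. (f (\<phi> v))^2) = (\<Sum>x\<in>Q. r x * (f x)^2)" .
  have 3: "(\<Sum>x\<in>Q. r x * (f x)^2)^2 \<le> (\<Sum>x\<in>Q. (r x)^2) * (\<Sum>x\<in>Q. f x ^ 4)"
    using Cauchy_Schwarz_ineq_sum[of r "\<lambda>x. (f x)^2" Q] by (simp flip: power_mult)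
  have "{(v, w) \<in> V \<times> V. \<phi> v = \<phi> w} = (\<Union>x\<in>Q. {v \<in> V. \<phi> v = x} \<times> {v \<in> V. \<phi> v = x})"
    using Q(2) by auto
  then have "card {(v, w) \<in> V \<times> V. \<phi> v = \<phi> w} = (\<Sum>x\<in>Q. card ({v \<in> V. \<phi> v = x} \<times> {v \<in> V. \<phi> v = x}))"
    using V Q(1) by (simp only:) (subst card_UN_disjoint, auto)
  then have 4: "real (card {(v, w) \<in> V \<times> V. \<phi> v = \<phi> w}) = (\<Sum>x\<in>Q. (r x)^2)"
    by (simp add: r_def card_cartesian_product power2_eq_square)
  have "(\<Sum>v\<in>V. f (\<phi> v))^4 = ((\<Sum>v\<in>V. f (\<phi> v))^2)^2" by (simp flip: power_mult)
  also have "\<dots> \<le> (real (card V) * (\<Sum>x\<in>Q. r x * (f x)^2))^2"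
    using 1 unfolding 2 by (intro power_mono) auto
  also have "\<dots> \<le> (real (card V))^2 * ((\<Sum>x\<in>Q. (r x)^2) * (\<Sum>x\<in>Q. f x ^ 4))"
    unfolding power_mult_distrib by (intro mult_left_mono 3) auto
  finally show ?thesis unfolding 4 by (simp add: mult_ac)
qed

context odd_prime
begin

section \<open>Additive characters and moments of Heilbronn sums modulo \<open>p^2\<close>\<close>

definition e :: "int \<Rightarrow> complex" where
  "e n = cis (2 * pi * real_of_int n / (real p)^2)"

lemma e_0 [simp]: "e 0 = 1"
  by (simp add: e_def)

lemma e_add: "e (m + n) = e m * e n"
  by (simp add: e_def cis_mult distrib_left add_divide_distrib)

lemma e_minus: "e (- n) = cnj (e n)"
  by (simp add: e_def cis_cnj)

lemma norm_e [simp]: "norm (e n) = 1"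
  by (simp add: e_def)

lemma e_eq_1_iff: "e n = 1 \<longleftrightarrow> (int p)^2 dvd n"
proof
  assume "e n = 1"
  then have "cos (2 * pi * real_of_int n / (real p)^2) = 1"
    by (simp add: e_def complex_eq_iff)
  then obtain k :: int where "2 * pi * real_of_int n / (real p)^2 = of_int k * 2 * pi"
    by (auto simp: cos_one_2pi_int)
  then have "real_of_int n = of_int (k * (int p)^2)"
    using p_pos by (simp add: field_simps)
  then have "n = k * (int p)^2" by (simp only: of_int_eq_iff)
  then show "(int p)^2 dvd n" by simp
next
  assume "(int p)^2 dvd n"
  then obtain k where "n = (int p)^2 * k" by (rule dvdE)
  then have "2 * pi * real_of_int n / (real p)^2 = 2 * pi * of_int k" using p_pos by simp
  then show "e n = 1" by (simp add: e_def cis_multiple_2pi)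
qed

lemma e_cong:
  assumes "[m = n] (mod (int p)^2)"
  shows "e m = e n"
proof -
  have "e (m - n) = 1" using assms by (simp add: e_eq_1_iff cong_iff_dvd_diff)
  then show ?thesis using e_add[of "m - n" n] by simp
qed

lemma e_power: "e (int x * n) = e n ^ x"
  by (induction x) (simp_all add: distrib_right e_add)

lemma sum_e: "(\<Sum>x<p^2. e (int x * n)) = (if (int p)^2 dvd n then of_nat (p^2) else 0)"
proof (cases "e n = 1")
  case True
  then have "e (int x * n) = 1" for x by (simp only: e_power power_one)
  then have "(\<Sum>x<p^2. e (int x * n)) = of_nat (p^2)" by simp
  then show ?thesis using True by (simp only: e_eq_1_iff if_True)
next
  case False
  have "e n ^ (p^2) = e (int (p^2) * n)" by (simp only: e_power)
  also have "\<dots> = 1" by (simp add: e_eq_1_iff)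
  finally show ?thesis using False geometric_sum[OF False, of "p^2"]
    by (simp add: e_power e_eq_1_iff)
qed

definition hsum :: "int \<Rightarrow> complex" where
  "hsum a = (\<Sum>t\<in>{1..<int p}. e (a * t^p))"

lemma hsum_minus: "hsum (- a) = cnj (hsum a)"
  by (simp add: hsum_def e_minus)

lemma hsum_cong: "[a = b] (mod (int p)^2) \<Longrightarrow> hsum a = hsum b"
  unfolding hsum_def by (intro sum.cong refl e_cong cong_mult cong_refl)

lemma mult_mod_bij:
  assumes s: "s \<in> {1..<int p}"
  shows "bij_betw (\<lambda>t. s * t mod int p) {1..<int p} {1..<int p}"
proof -
  have ns: "\<not> int p dvd s" using s by (auto dest: zdvd_imp_le)
  have inj: "inj_on (\<lambda>t. s * t mod int p) {1..<int p}"
  proof (rule inj_onI)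
    fix t u assume tu: "t \<in> {1..<int p}" "u \<in> {1..<int p}" "s * t mod int p = s * u mod int p"
    have "int p dvd s * t - s * u" using tu(3) by (simp only: mod_eq_dvd_iff)
    then have "int p dvd s * (t - u)" by (simp only: right_diff_distrib)
    then have "int p dvd t - u" using ns prime_dvd_mult_iff[OF prime_int_p] by blast
    then have "t mod int p = u mod int p" by (simp only: mod_eq_dvd_iff)
    then show "t = u" using tu by simp
  qed
  have "(\<lambda>t. s * t mod int p) ` {1..<int p} \<subseteq> {1..<int p}"
  proof safe
    fix t assume t: "t \<in> {1..<int p}"
    then have "\<not> int p dvd t" by (auto dest: zdvd_imp_le)
    then have "\<not> int p dvd s * t" using ns prime_dvd_mult_iff[OF prime_int_p] by blast
    then have "s * t mod int p \<noteq> 0" by (simp add: dvd_eq_mod_eq_0)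
    moreover have "0 \<le> s * t mod int p" "s * t mod int p < int p" using p_pos by simp_all
    ultimately show "s * t mod int p \<in> {1..<int p}" by auto
  qed
  then show ?thesis using inj by (simp add: bij_betw_def endo_inj_surj)
qed

text \<open>Multiplication by \<open>s\<close> permutes the nonzero residues \<open>t\<close>; thus
  \<open>hsum\<close> is constant on the orbits of the group.\<close>

lemma hsum_mult_pow:
  assumes s: "s \<in> {1..<int p}"
  shows "hsum (a * s^p) = hsum a"
proof -
  have "hsum a = (\<Sum>t\<in>{1..<int p}. e (a * (s * t mod int p)^p))"
    unfolding hsum_def by (rule sum.reindex_bij_betw[OF mult_mod_bij[OF s], symmetric])
  also have "\<dots> = (\<Sum>t\<in>{1..<int p}. e (a * s^p * t^p))"
  proof (intro sum.cong refl e_cong)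
    fix t
    have "[(s * t mod int p)^p = (s * t)^p] (mod (int p)^2)"
      by (intro cong_pow_p_square) (simp add: cong_def)
    then have "[a * (s * t mod int p)^p = a * (s * t)^p] (mod (int p)^2)"
      by (intro cong_mult cong_refl)
    then show "[a * (s * t mod int p)^p = a * s^p * t^p] (mod (int p)^2)"
      by (simp only: power_mult_distrib mult.assoc)
  qed
  finally show ?thesis by (simp add: hsum_def)
qed

text \<open>The fourth power expands into characters at \<open>t1^p + t2^p - t3^p - t4^p\<close>,
  and orthogonality keeps the quadruples where this is zero modulo \<open>p^2\<close>.\<close>

lemma sum_hsum_fourth_power:
  "(\<Sum>x<p^2. norm (hsum (int x)) ^ 4) = (real p)^2 * real (card heilbronn_quads)"
proof -
  let ?T = "{1..<int p}"
  let ?W = "(?T \<times> ?T) \<times> (?T \<times> ?T)"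
  define h where "h = (\<lambda>((t1, t2), (t3, t4)). (t1^p + t2^p) - (t3^p + t4^p :: int))"
  have square: "hsum a * hsum a = (\<Sum>(t1, t2)\<in>?T \<times> ?T. e (a * (t1^p + t2^p)))" for a
    unfolding hsum_def sum_product sum.cartesian_product
    by (intro sum.cong) (auto simp: distrib_left e_add)
  have expand: "of_real (norm (hsum a) ^ 4) = (\<Sum>w\<in>?W. e (a * h w))" for a
  proof -
    have "of_real (norm (hsum a) ^ 4) = (hsum a * cnj (hsum a))^2"
      by (simp add: complex_norm_square[symmetric] flip: power_mult)
    also have "\<dots> = (hsum a * hsum a) * (hsum (- a) * hsum (- a))"
      by (simp add: power2_eq_square hsum_minus mult_ac)
    also have "\<dots> = (\<Sum>w\<in>?W. e (a * h w))"
      unfolding square sum_product sum.cartesian_product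
      by (intro sum.cong refl) (auto simp: h_def e_add[symmetric] right_diff_distrib)
    finally show ?thesis .
  qed
  have "of_real (\<Sum>x<p^2. norm (hsum (int x)) ^ 4) = (\<Sum>x<p^2. \<Sum>w\<in>?W. e (int x * h w))"
    by (simp only: of_real_sum expand)
  also have "\<dots> = (\<Sum>w\<in>?W. if (int p)^2 dvd h w then of_nat (p^2) else 0)"
    by (subst sum.swap) (simp only: sum_e)
  also have "\<dots> = of_nat (p^2) * of_nat (card {w \<in> ?W. (int p)^2 dvd h w})"
    by (subst sum.inter_filter[symmetric]) auto
  also have "card {w \<in> ?W. (int p)^2 dvd h w} = card heilbronn_quads"
    by (rule bij_betw_same_card[of "\<lambda>((t1, t2), (t3, t4)). (t1, t2, t3, t4)"],
        rule bij_betwI[where g = "\<lambda>(t1, t2, t3, t4). ((t1, t2), (t3, t4))"])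
      (auto simp: heilbronn_quads_def h_def cong_iff_dvd_diff)
  also have "of_nat (p^2) * of_nat (card heilbronn_quads) = (of_real ((real p)^2 * real (card heilbronn_quads)) :: complex)"
    by simp
  finally show ?thesis by (simp only: of_real_eq_iff)
qed

text \<open>For \<open>a, b\<close> prime to \<open>p\<close> this says that \<open>a/b\<close> is a \<open>p\<close>-th power modulo \<open>p^2\<close>.\<close>

definition sim :: "nat \<Rightarrow> nat \<Rightarrow> bool" where
  "sim a b \<longleftrightarrow> [a^(p-1) = b^(p-1)] (mod p^2)"

definition sim_pairs :: "nat \<Rightarrow> (nat \<times> nat) set" where
  "sim_pairs K = {(a, b) \<in> {1..K} \<times> {1..K}. sim a b}"

lemma finite_sim_pairs [simp]: "finite (sim_pairs K)"
  unfolding sim_pairs_def by (rule finite_subset[of _ "{1..K} \<times> {1..K}"]) auto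

lemma sim_int: "sim a b \<longleftrightarrow> [int a^(p-1) = int b^(p-1)] (mod (int p)^2)"
  unfolding sim_def by (simp flip: of_nat_power add: cong_int_iff)

lemma pow_p_pow_pred:
  assumes "t \<in> {1..<int p}"
  shows "[(t^p)^(p-1) = 1] (mod (int p)^2)"
proof -
  have "\<not> int p dvd t" using assms by (auto dest: zdvd_imp_le)
  then have "coprime t (int p)" using prime_int_p by (metis coprime_commute prime_imp_coprime)
  then have "[t^(p-1) = 1] (mod int p)"
    using fermat_quotient_exact[OF prime_p] by (simp add: cong_iff_dvd_diff)
  from cong_pow_p_square[OF this] show ?thesis
    by (simp add: power_mult[symmetric] mult.commute)
qed

text \<open>Raising \<open>d * t^p = d' * t'^p\<close> to the power \<open>p - 1\<close> removes the
  group elements and leaves \<open>sim d d'\<close>. Given \<open>t\<close>, \<open>d\<close> and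
  \<open>d'\<close>, the parameter \<open>t'\<close> is determined, since
  \<open>d' \<le> K < p\<close> is a unit.\<close>

lemma card_hsum_collisions:
  assumes K: "K < p"
  shows "card {(v, w) \<in> ({1..K} \<times> {1..<int p}) \<times> ({1..K} \<times> {1..<int p}).
      nat (int (fst v) * snd v^p mod (int p)^2) = nat (int (fst w) * snd w^p mod (int p)^2)}
    \<le> p * card (sim_pairs K)" (is "card ?Z \<le> _")
proof -
  let ?p = "int p"
  define \<psi> where "\<psi> = (\<lambda>((d::nat, t::int), (d'::nat, t'::int)). (t, (d, d')))"
  have cZ: "[int d * t^p = int d' * t'^p] (mod ?p^2)" if "((d, t), (d', t')) \<in> ?Z" for d t d' t'
  proof -
    have "int d * t^p mod ?p^2 = int d' * t'^p mod ?p^2"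
      using that p_pos by (auto simp: nat_eq_iff)
    then show ?thesis by (simp only: cong_def)
  qed
  have "inj_on \<psi> ?Z"
  proof (rule inj_onI)
    fix v w assume vw: "v \<in> ?Z" "w \<in> ?Z" "\<psi> v = \<psi> w"
    obtain d t d' t' where v: "v = ((d, t), (d', t'))" by (metis surj_pair)
    obtain t'' where w: "w = ((d, t), (d', t''))" using vw(3) unfolding v \<psi>_def by (cases w) auto
    have "[int d' * t'^p = int d' * t''^p] (mod ?p^2)"
      using cZ vw(1,2) unfolding v w by (meson cong_sym cong_trans)
    then have "[int d' * t'^p = int d' * t''^p] (mod ?p)"
      by (rule cong_dvd_modulus) (simp add: power2_eq_square)
    moreover have "[int d' * u^p = int d' * u] (mod ?p)" for u
      by (intro cong_mult cong_refl cong_pow_p)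
    ultimately have "[int d' * t' = int d' * t''] (mod ?p)" by (meson cong_sym cong_trans)
    then have "?p dvd int d' * t' - int d' * t''" by (simp only: cong_iff_dvd_diff)
    then have "?p dvd int d' * (t' - t'')" by (simp only: right_diff_distrib)
    moreover have "\<not> ?p dvd int d'"
      using vw(1) K unfolding v int_dvd_int_iff by (auto dest!: dvd_imp_le)
    ultimately have "?p dvd t' - t''" using prime_dvd_mult_iff[OF prime_int_p] by blast
    then have "t' mod ?p = t'' mod ?p" by (simp only: mod_eq_dvd_iff)
    then have "t' = t''" using vw(1,2) unfolding v w by auto
    then show "v = w" unfolding v w by simp
  qed
  moreover have "\<psi> ` ?Z \<subseteq> {1..<?p} \<times> sim_pairs K"
  proof
    fix y assume "y \<in> \<psi> ` ?Z"
    then obtain d t d' t' where y: "y = (t, (d, d'))" "((d, t), (d', t')) \<in> ?Z"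
      unfolding \<psi>_def by auto
    have t: "t \<in> {1..<?p}" "t' \<in> {1..<?p}" "d \<in> {1..K}" "d' \<in> {1..K}" using y(2) by auto
    have 1: "[(int d)^(p-1) * (t^p)^(p-1) = (int d')^(p-1) * (t'^p)^(p-1)] (mod ?p^2)"
      using cong_pow[OF cZ[OF y(2)], of "p-1"] by (simp only: power_mult_distrib)
    have 2: "[(int c)^(p-1) * (u^p)^(p-1) = (int c)^(p-1) * 1] (mod ?p^2)" if "u \<in> {1..<?p}" for c u
      by (intro cong_mult cong_refl pow_p_pow_pred that)
    have "[(int d)^(p-1) = (int d')^(p-1)] (mod ?p^2)"
      using 1 2[OF t(1), of d] 2[OF t(2), of d'] unfolding mult_1_right by (meson cong_sym cong_trans)
    then show "y \<in> {1..<?p} \<times> sim_pairs K"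
      using t unfolding y(1) sim_pairs_def by (simp add: sim_int)
  qed
  ultimately have "card ?Z \<le> card ({1..<?p} \<times> sim_pairs K)"
    by (intro card_inj_on_le) auto
  also have "\<dots> \<le> p * card (sim_pairs K)"
    unfolding card_cartesian_product by (intro mult_le_mono1) simp
  finally show ?thesis .
qed

text \<open>Repeating each \<open>hsum d\<close> over the orbit \<open>d * t^p\<close> gives
  \<open>p - 1\<close> copies of the sum. Hoelder's inequality then separates the number of
  collisions from the complete fourth moment.\<close>

lemma sum_norm_hsum:
  assumes K: "K < p" and big: "p \<ge> 2500"
  shows "(\<Sum>d=1..K. norm (hsum (int d)))^4 \<le> 96000 * ((real K)^2 * real (card (sim_pairs K)) * ((real p)^3 * sqrt p))"
proof -
  let ?T = "{1..<int p}"
  define \<phi> where "\<phi> v = nat (int (fst v) * snd v^p mod (int p)^2)" for v :: "nat \<times> int"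
  define \<Sigma> where "\<Sigma> = (\<Sum>d=1..K. norm (hsum (int d)))"
  define V where "V = {1..K} \<times> ?T"
  have \<phi>: "int (\<phi> v) = int (fst v) * snd v^p mod (int p)^2" for v
    using p_pos by (simp add: \<phi>_def)
  have "norm (hsum (int (\<phi> (d, t)))) = norm (hsum (int d))" if "t \<in> ?T" for d t
  proof -
    have "hsum (int (\<phi> (d, t))) = hsum (int d * t^p)" unfolding \<phi> by (intro hsum_cong) (simp add: cong_def)
    then show ?thesis using hsum_mult_pow[OF that] by simp
  qed
  then have "(\<Sum>v\<in>V. norm (hsum (int (\<phi> v)))) = (\<Sum>d=1..K. \<Sum>t\<in>?T. norm (hsum (int d)))"
    unfolding V_def sum.cartesian_product by (intro sum.cong) auto
  also have "\<dots> = (real p - 1) * \<Sigma>"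
    using p_pos by (simp add: \<Sigma>_def sum_distrib_left of_nat_diff)
  finally have lhs: "(\<Sum>v\<in>V. norm (hsum (int (\<phi> v)))) = (real p - 1) * \<Sigma>" .
  have "\<phi> ` V \<subseteq> {..<p^2}"
  proof
    fix x assume "x \<in> \<phi> ` V"
    then obtain v where "int x = int (fst v) * snd v^p mod (int p)^2" using \<phi> by auto
    also have "\<dots> < (int p)^2" using p_pos by simp
    finally show "x \<in> {..<p^2}" by (simp flip: of_nat_power)
  qed
  then have "((real p - 1) * \<Sigma>)^4 \<le> (real (card V))^2 * real (card {(v, w) \<in> V \<times> V. \<phi> v = \<phi> w}) * (\<Sum>x<p^2. norm (hsum (int x)) ^ 4)"
    unfolding lhs[symmetric] by (intro pushforward_fourth_power) (auto simp: V_def)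
  also have "\<dots> \<le> (real K * (real p - 1))^2 * real (p * card (sim_pairs K)) * ((real p)^2 * (24000 * ((real p)^2 * sqrt p)))"
  proof (intro mult_mono)
    show "(real (card V))^2 \<le> (real K * (real p - 1))^2"
      using p_pos by (simp add: V_def card_cartesian_product of_nat_diff)
    show "real (card {(v, w) \<in> V \<times> V. \<phi> v = \<phi> w}) \<le> real (p * card (sim_pairs K))"
      unfolding V_def \<phi>_def using card_hsum_collisions[OF K] by (simp only: of_nat_le_iff)
    show "(\<Sum>x<p^2. norm (hsum (int x)) ^ 4) \<le> (real p)^2 * (24000 * ((real p)^2 * sqrt p))"
      unfolding sum_hsum_fourth_power by (intro mult_left_mono card_heilbronn_quads[OF big]) auto
  qed (auto intro!: sum_nonneg)
  finally have 0: "((real p - 1) * \<Sigma>)^4 \<le> \<dots>" .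
  \<comment> \<open>Since \<open>m \<ge> p / 2\<close>, passing from \<open>m^2\<close> to
    \<open>p^2\<close> costs a factor 4, which turns 24000 into 96000.\<close>
  define m where "m = real p - 1"
  have m: "m > 0" "real p / 2 \<le> m" using p_gt_2 by (simp_all add: m_def)
  have "m^2 * (m^2 * \<Sigma>^4) = (m * \<Sigma>)^4"
    by (simp add: power_mult_distrib flip: power_add)
  also have "\<dots> \<le> m^2 * (24000 * ((real K)^2 * real (card (sim_pairs K)) * ((real p)^5 * sqrt p)))"
    using 0 unfolding m_def[symmetric] by (simp add: power_mult_distrib power2_eq_square eval_nat_numeral mult_ac)
  finally have 1: "m^2 * (m^2 * \<Sigma>^4) \<le> m^2 * (24000 * ((real K)^2 * real (card (sim_pairs K)) * ((real p)^5 * sqrt p)))" .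
  have "m^2 * \<Sigma>^4 \<le> 24000 * ((real K)^2 * real (card (sim_pairs K)) * ((real p)^5 * sqrt p))"
    by (rule mult_left_le_imp_le[OF 1]) (use m in simp)
  moreover have "(real p / 2)^2 * \<Sigma>^4 \<le> m^2 * \<Sigma>^4"
    using m by (intro mult_right_mono power_mono) auto
  ultimately have "(real p)^2 * \<Sigma>^4 \<le> (real p)^2 * (96000 * ((real K)^2 * real (card (sim_pairs K)) * ((real p)^3 * sqrt p)))"
    by (simp add: power2_eq_square eval_nat_numeral field_simps)
  then show ?thesis using p_pos by (simp add: \<Sigma>_def)
qed

text \<open>If \<open>t^p\<close> reduces into \<open>[1, M]\<close>, the phases of \<open>e (a t^p)\<close>, \<open>a < K\<close>, are at most \<open>2 pi / 6\<close>, so the sum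
  over \<open>a\<close> is large; its mean square over \<open>t\<close> only involves the sums \<open>hsum d\<close> with \<open>|d| < K\<close>.\<close>

lemma card_small_pow:
  fixes K M :: nat
  assumes K: "K > 0" and KM: "6 * K * M \<le> p^2"
  shows "real K * real (card {t \<in> {1..<int p}. t^p mod (int p)^2 \<in> {1..int M}})
    \<le> 4 * (real p + 2 * (\<Sum>d=1..K. norm (hsum (int d))))"
proof -
  let ?T = "{1..<int p}"
  define J where "J = {t \<in> ?T. t^p mod (int p)^2 \<in> {1..int M}}"
  define \<Sigma> where "\<Sigma> = (\<Sum>d=1..K. norm (hsum (int d)))"
  define D where "D t = (\<Sum>a<K. e (int a * t^p))" for t
  have fJ: "finite J" unfolding J_def by (rule finite_subset[of _ ?T]) auto
  have large: "(real K / 2)^2 \<le> (norm (D t))^2" if t: "t \<in> J" for t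
  proof -
    define g where "g = t^p mod (int p)^2"
    have g: "1 \<le> g" "g \<le> int M" using t by (auto simp: J_def g_def)
    have "D t = (\<Sum>a<K. e (int a * g))"
      unfolding D_def g_def by (intro sum.cong refl e_cong cong_mult cong_refl) (simp add: cong_def)
    moreover have "1 / 2 \<le> Re (e (int a * g))" if "a < K" for a
    proof -
      define \<theta> where "\<theta> = 2 * pi * real_of_int (int a * g) / (real p)^2"
      have "int a * g \<le> int K * int M" using that g by (intro mult_mono) auto
      then have "6 * (int a * g) \<le> int (6 * K * M)" by simp
      also have "\<dots> \<le> int (p^2)" using KM by (simp only: of_nat_le_iff)
      finally have "real_of_int (6 * (int a * g)) \<le> real_of_int (int (p^2))" by (simp only: of_int_le_iff)
      then have "real_of_int (int a * g) / (real p)^2 \<le> 1 / 6" using p_pos by (simp add: field_simps)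
      then have "2 * pi * (real_of_int (int a * g) / (real p)^2) \<le> 2 * pi * (1 / 6)"
        by (intro mult_left_mono) auto
      then have "\<theta> \<le> pi / 3" by (simp add: \<theta>_def)
      moreover have "0 \<le> \<theta>" using g by (simp add: \<theta>_def)
      ultimately have "cos (pi / 3) \<le> cos \<theta>" by (intro cos_monotone_0_pi_le) auto
      then show ?thesis by (simp add: e_def \<theta>_def cos_60)
    qed
    ultimately have "(\<Sum>a<K. 1 / 2) \<le> Re (D t)"
      by (simp only: Re_sum) (intro sum_mono, simp)
    also have "\<dots> \<le> norm (D t)" by (rule complex_Re_le_cmod)
    finally show ?thesis by (intro power_mono) auto
  qed
  have "real (card J) * (real K / 2)^2 = (\<Sum>t\<in>J. (real K / 2)^2)" by simp
  also have "\<dots> \<le> (\<Sum>t\<in>J. (norm (D t))^2)" using large by (rule sum_mono)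
  also have "\<dots> \<le> (\<Sum>t\<in>?T. (norm (D t))^2)" by (intro sum_mono2) (auto simp: J_def)
  also have "\<dots> \<le> real K * (real p + 2 * \<Sigma>)"
  proof -
    have "of_real (\<Sum>t\<in>?T. (norm (D t))^2) = (\<Sum>t\<in>?T. \<Sum>a<K. \<Sum>b<K. e ((int a - int b) * t^p))"
      unfolding of_real_sum
    proof (rule sum.cong[OF refl])
      fix t
      have "of_real ((norm (D t))^2) = D t * cnj (D t)" by (rule complex_norm_square)
      also have "\<dots> = (\<Sum>a<K. \<Sum>b<K. e (int a * t^p) * cnj (e (int b * t^p)))"
        unfolding D_def cnj_sum sum_product ..
      also have "\<dots> = (\<Sum>a<K. \<Sum>b<K. e ((int a - int b) * t^p))"
        by (simp add: e_minus[symmetric] e_add[symmetric] left_diff_distrib)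
      finally show "of_real ((norm (D t))^2) = (\<Sum>a<K. \<Sum>b<K. e ((int a - int b) * t^p))" .
    qed
    also have "\<dots> = (\<Sum>a<K. \<Sum>t\<in>?T. \<Sum>b<K. e ((int a - int b) * t^p))" by (rule sum.swap)
    also have "\<dots> = (\<Sum>a<K. \<Sum>b<K. hsum (int a - int b))"
      unfolding hsum_def by (intro sum.cong refl sum.swap)
    finally have eq: "of_real (\<Sum>t\<in>?T. (norm (D t))^2) = (\<Sum>a<K. \<Sum>b<K. hsum (int a - int b))" .
    \<comment> \<open>The differences \<open>a - b\<close> of each sign are distinct, and
      \<open>hsum (-d)\<close> is the conjugate of \<open>hsum d\<close>, so each sign contributes
      at most \<open>\<Sigma>\<close>; the diagonal term is at most \<open>p\<close>.\<close>
    have row: "(\<Sum>b<K. norm (hsum (int a - int b))) \<le> real p + 2 * \<Sigma>" if a: "a < K" for a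
    proof -
      have "{..<K} = {..<a} \<union> insert a {a<..<K}" using a by auto
      moreover have "sum f ({..<a} \<union> insert a {a<..<K}) = sum f {..<a} + (f a + sum f {a<..<K})" for f :: "nat \<Rightarrow> real"
        by (subst sum.union_disjoint) auto
      ultimately have "(\<Sum>b<K. norm (hsum (int a - int b))) =
          (\<Sum>b<a. norm (hsum (int a - int b))) + (norm (hsum 0) + (\<Sum>b\<in>{a<..<K}. norm (hsum (int a - int b))))"
        by simp
      also have "(\<Sum>b<a. norm (hsum (int a - int b))) \<le> \<Sigma>"
      proof -
        have "(\<Sum>b<a. norm (hsum (int a - int b))) = (\<Sum>d\<in>(\<lambda>b. a - b) ` {..<a}. norm (hsum (int d)))"
          by (subst sum.reindex) (auto simp: inj_on_def of_nat_diff)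
        also have "\<dots> \<le> \<Sigma>" unfolding \<Sigma>_def using a by (intro sum_mono2) auto
        finally show ?thesis .
      qed
      also have "(\<Sum>b\<in>{a<..<K}. norm (hsum (int a - int b))) \<le> \<Sigma>"
      proof -
        have "norm (hsum (int a - int b)) = norm (hsum (int (b - a)))" if "a < b" for b
          using hsum_minus[of "int b - int a"] that by (simp add: of_nat_diff)
        then have "(\<Sum>b\<in>{a<..<K}. norm (hsum (int a - int b))) = (\<Sum>d\<in>(\<lambda>b. b - a) ` {a<..<K}. norm (hsum (int d)))"
          by (subst sum.reindex) (auto simp: inj_on_def intro!: sum.cong)
        also have "\<dots> \<le> \<Sigma>" unfolding \<Sigma>_def using a by (intro sum_mono2) auto
        finally show ?thesis .
      qed
      also have "norm (hsum 0) \<le> real p" unfolding hsum_def by (rule order.trans[OF norm_sum]) simp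
      finally show ?thesis by simp
    qed
    have "(\<Sum>t\<in>?T. (norm (D t))^2) = norm (of_real (\<Sum>t\<in>?T. (norm (D t))^2) :: complex)"
      unfolding norm_of_real by (simp add: sum_nonneg)
    also have "\<dots> \<le> (\<Sum>a<K. \<Sum>b<K. norm (hsum (int a - int b)))"
      unfolding eq by (intro order.trans[OF norm_sum] sum_mono norm_sum)
    also have "\<dots> \<le> (\<Sum>a<K. real p + 2 * \<Sigma>)" using row by (intro sum_mono) auto
    finally show ?thesis by simp
  qed
  finally have "real K * (real K * real (card J)) \<le> real K * (4 * (real p + 2 * \<Sigma>))"
    by (simp add: power2_eq_square field_simps)
  then show ?thesis using K by (simp add: J_def \<Sigma>_def)
qed

text \<open>From \<open>sim g 1\<close> follows \<open>g = g^p\<close> modulo \<open>p^2\<close>, so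
  \<open>g\<close> is the \<open>p\<close>-th power of its residue modulo \<open>p\<close>; below
  \<open>p^2\<close> it can be recovered from that power.\<close>

lemma card_sim_1_le:
  assumes M: "M < p^2"
  shows "card {g \<in> {1..M}. sim g 1} \<le> card {t \<in> {1..<int p}. t^p mod (int p)^2 \<in> {1..int M}}"
proof (rule card_inj_on_le[of "\<lambda>g. int g mod int p"])
  have key: "(int g mod int p)^p mod (int p)^2 = int g" if g: "g \<in> {1..M}" "sim g 1" for g
  proof -
    have "[(int g mod int p)^p = (int g)^p] (mod (int p)^2)"
      by (intro cong_pow_p_square) (simp add: cong_def)
    also have "(int g)^p = int g * (int g)^(p-1)" using p_pos by (cases p) auto
    also have "[int g * (int g)^(p-1) = int g * 1] (mod (int p)^2)"
      using g(2) by (intro cong_mult cong_refl) (simp add: sim_int)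
    finally have "(int g mod int p)^p mod (int p)^2 = int g mod (int p)^2" by (simp add: cong_def)
    also have "\<dots> = int g"
    proof -
      have "int g < int (p^2)" using g M by (simp only: of_nat_less_iff) simp
      then show ?thesis by simp
    qed
    finally show ?thesis .
  qed
  show "inj_on (\<lambda>g. int g mod int p) {g \<in> {1..M}. sim g 1}"
  proof (rule inj_onI)
    fix g h assume gh: "g \<in> {g \<in> {1..M}. sim g 1}" "h \<in> {g \<in> {1..M}. sim g 1}" "int g mod int p = int h mod int p"
    have "int g = (int g mod int p)^p mod (int p)^2" using gh(1) by (intro key[symmetric]) auto
    also have "\<dots> = int h" unfolding gh(3) using gh(2) by (intro key) auto
    finally show "g = h" by simp
  qed
  show "(\<lambda>g. int g mod int p) ` {g \<in> {1..M}. sim g 1} \<subseteq> {t \<in> {1..<int p}. t^p mod (int p)^2 \<in> {1..int M}}"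
  proof
    fix t assume "t \<in> (\<lambda>g. int g mod int p) ` {g \<in> {1..M}. sim g 1}"
    then obtain g where g: "g \<in> {1..M}" "sim g 1" "t = int g mod int p" by auto
    have k: "t^p mod (int p)^2 = int g" unfolding g(3) by (rule key[OF g(1,2)])
    have "t \<noteq> 0" using k g(1) p_pos by (intro notI) (simp add: zero_power)
    moreover have "0 \<le> t" "t < int p" using g(3) p_pos by simp_all
    ultimately show "t \<in> {t \<in> {1..<int p}. t^p mod (int p)^2 \<in> {1..int M}}" using k g(1) by auto
  qed
  show "finite {t \<in> {1..<int p}. t^p mod (int p)^2 \<in> {1..int M}}"
    by (rule finite_subset[of _ "{1..<int p}"]) auto
qed

end


section \<open>Fractions of small height in the group of \<open>p\<close>-th powers\<close>

lemma powr_power_eq: "x > 0 \<Longrightarrow> (x powr a) ^ n = x powr (a * real n)"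
  by (simp add: powr_powr flip: powr_realpow)

text \<open>The classical divisor bound argument, for a general \<open>g\<close> so as to cover both
  the number of divisors and \<open>2^omega\<close>. Primes \<open>q \<ge> 2^(1/\<epsilon>)\<close>
  satisfy \<open>e + 1 \<le> q^(\<epsilon> * e)\<close>; each of the finitely many smaller ones
  costs a factor \<open>C0\<close>.\<close>

lemma prime_power_recursion_bound:
  fixes g :: "nat \<Rightarrow> real" and \<epsilon> :: real
  assumes eps: "\<epsilon> > 0" and g1: "g 1 \<le> 1" and g0: "\<And>n. 0 \<le> g n"
    and step: "\<And>q e m. prime q \<Longrightarrow> \<not> q dvd m \<Longrightarrow> m > 0 \<Longrightarrow> e > 0 \<Longrightarrow> g (q^e * m) \<le> real (e + 1) * g m"
  shows "\<exists>C\<ge>1. \<forall>n>0. g n \<le> C * real n powr \<epsilon>"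
proof -
  \<comment> \<open>Chosen so that \<open>e + 1 \<le> C0 * (1 + \<epsilon> * ln 2 * e) \<le> C0 *
    2^(\<epsilon> * e)\<close>.\<close>
  define C0 where "C0 = 1 + 1 / (\<epsilon> * ln 2)"
  define Y where "Y = nat \<lceil>2 powr (1 / \<epsilon>)\<rceil>"
  have C0: "C0 \<ge> 1" using eps by (simp add: C0_def)
  have small: "real (e + 1) \<le> C0 * (real q powr \<epsilon>)^e" if "q \<ge> 2" for q e :: nat
  proof -
    have "1 + \<epsilon> * ln 2 * real e \<le> exp (\<epsilon> * ln 2 * real e)" by (rule exp_ge_add_one_self)
    also have "\<dots> = (2 powr \<epsilon>)^e" by (simp add: powr_def exp_of_nat_mult[symmetric] mult_ac)
    finally have 1: "1 + \<epsilon> * ln 2 * real e \<le> (2 powr \<epsilon>)^e" .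
    have "real (e + 1) \<le> C0 * (1 + \<epsilon> * ln 2 * real e)"
      using eps by (simp add: C0_def field_simps)
    also have "\<dots> \<le> C0 * (real q powr \<epsilon>)^e"
      using C0 eps that by (intro mult_left_mono order.trans[OF 1] power_mono powr_mono2) auto
    finally show ?thesis .
  qed
  have large: "real (e + 1) \<le> (real q powr \<epsilon>)^e" if "q \<ge> Y" for q e :: nat
  proof -
    have "2 powr (1 / \<epsilon>) \<le> real q" using that unfolding Y_def by linarith
    then have "(2 powr (1 / \<epsilon>)) powr \<epsilon> \<le> real q powr \<epsilon>" using eps by (intro powr_mono2) auto
    then have "2 \<le> real q powr \<epsilon>" using eps by (simp add: powr_powr)
    then have "2^e \<le> (real q powr \<epsilon>)^e" by (intro power_mono) auto
    moreover have "real (e + 1) \<le> 2^e" using less_exp[of e] by (metis Suc_eq_plus1 Suc_leI of_nat_le_iff of_nat_numeral of_nat_power)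
    ultimately show ?thesis by linarith
  qed
  define w where "w n = card {q. prime q \<and> q dvd n \<and> q < Y}" for n
  have main: "g n \<le> C0^(w n) * real n powr \<epsilon>" if "n > 0" for n
    using that
  proof (induction n rule: less_induct)
    case (less n)
    show ?case
    proof (cases "n = 1")
      case True
      then show ?thesis using g1 one_le_power[OF C0, of "w 1"] by simp
    next
      case False
      then obtain q where q: "prime q" "q dvd n" using prime_factor_nat by blast
      define e where "e = multiplicity q n"
      obtain m where m: "n = q^e * m" "\<not> q dvd m"
        using multiplicity_decompose'[of n q] less.prems q(1) unfolding e_def by (metis not_prime_unit less_irrefl)
      have e: "e > 0" using q less.prems m by (auto intro: gr0I)
      have q2: "q \<ge> 2" using q prime_ge_2_nat by blast
      have m0: "m > 0" using m less.prems by (auto intro: gr0I)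
      have "1 < q^e" using q2 e by (intro one_less_power) auto
      then have "m < n" using m(1) m0 by simp
      then have IH: "g m \<le> C0^(w m) * real m powr \<epsilon>" using less.IH m0 by blast
      have n_powr: "real n powr \<epsilon> = (real q powr \<epsilon>)^e * real m powr \<epsilon>"
        using q2 m0 unfolding m(1) by (simp add: powr_mult powr_power_eq powr_powr mult.commute flip: powr_realpow)
      have fin: "finite {q. prime q \<and> q dvd n \<and> q < Y}" by (rule finite_subset[of _ "{..<Y}"]) auto
      have bound: "real (e + 1) * C0^(w m) \<le> C0^(w n) * (real q powr \<epsilon>)^e"
      proof (cases "q < Y")
        case True
        have "w m < w n"
          unfolding w_def
        proof (intro psubset_card_mono[OF fin] psubsetI)
          show "{q. prime q \<and> q dvd m \<and> q < Y} \<subseteq> {q. prime q \<and> q dvd n \<and> q < Y}"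
            unfolding m(1) by auto
          show "{q. prime q \<and> q dvd m \<and> q < Y} \<noteq> {q. prime q \<and> q dvd n \<and> q < Y}"
            using q True m(2) by blast
        qed
        have "real (e + 1) * C0^(w m) \<le> (C0 * (real q powr \<epsilon>)^e) * C0^(w m)"
          using C0 by (intro mult_right_mono small q2) auto
        also have "\<dots> = C0^(Suc (w m)) * (real q powr \<epsilon>)^e" by simp
        also have "\<dots> \<le> C0^(w n) * (real q powr \<epsilon>)^e"
          using \<open>w m < w n\<close> C0 by (intro mult_right_mono power_increasing) auto
        finally show ?thesis .
      next
        case False
        have "w m \<le> w n"
          unfolding w_def m(1) using fin unfolding m(1) by (intro card_mono) auto
        have "real (e + 1) * C0^(w m) \<le> (real q powr \<epsilon>)^e * C0^(w m)"
          using C0 False by (intro mult_right_mono large) auto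
        also have "\<dots> \<le> (real q powr \<epsilon>)^e * C0^(w n)"
          using \<open>w m \<le> w n\<close> C0 by (intro mult_left_mono power_increasing) auto
        finally show ?thesis by (simp add: mult.commute)
      qed
      have "g n \<le> real (e + 1) * g m" using step[OF q(1) m(2) m0 e] m(1) by simp
      also have "\<dots> \<le> real (e + 1) * (C0^(w m) * real m powr \<epsilon>)" by (intro mult_left_mono IH) auto
      also have "\<dots> = (real (e + 1) * C0^(w m)) * real m powr \<epsilon>" by simp
      also have "\<dots> \<le> (C0^(w n) * (real q powr \<epsilon>)^e) * real m powr \<epsilon>" by (intro mult_right_mono bound) auto
      finally show ?thesis unfolding n_powr by (simp add: mult.assoc)
    qed
  qed
  have "g n \<le> C0^Y * real n powr \<epsilon>" if "n > 0" for n
  proof -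
    have "w n \<le> card {..<Y}" unfolding w_def by (intro card_mono) auto
    then have "C0^(w n) \<le> C0^Y" using C0 by (intro power_increasing) auto
    then show ?thesis using main[OF that] by (meson mult_right_mono order.trans powr_ge_zero)
  qed
  then show ?thesis using one_le_power[OF C0, of Y] by blast
qed

lemma divisor_bound:
  assumes "(\<epsilon>::real) > 0"
  shows "\<exists>C\<ge>1. \<forall>n>0. real (card {d. d dvd (n::nat)}) \<le> C * real n powr \<epsilon>"
proof (rule prime_power_recursion_bound[OF assms])
  fix q e m :: nat assume q: "prime q" and m: "\<not> q dvd m" "m > 0"
  have "{d. d dvd q^e * m} \<subseteq> (\<lambda>(i, d). q^i * d) ` ({..e} \<times> {d. d dvd m})"
  proof
    fix d assume "d \<in> {d. d dvd q^e * m}"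
    then obtain b c where bc: "d = b * c" "b dvd q^e" "c dvd m" using division_decomp by blast
    then obtain i where "i \<le> e" "b = q^i" using divides_primepow_nat[OF q] by blast
    then show "d \<in> (\<lambda>(i, d). q^i * d) ` ({..e} \<times> {d. d dvd m})"
      using bc by (intro image_eqI[of _ _ "(i, c)"]) auto
  qed
  then have "card {d. d dvd q^e * m} \<le> card ((\<lambda>(i, d). q^i * d) ` ({..e} \<times> {d. d dvd m}))"
    using m by (intro card_mono) auto
  also have "\<dots> \<le> card ({..e} \<times> {d. d dvd m})" using m by (intro card_image_le) auto
  finally have "card {d. d dvd q^e * m} \<le> (e + 1) * card {d. d dvd m}"
    by (simp add: card_cartesian_product)
  then show "real (card {d. d dvd q^e * m}) \<le> real (e + 1) * real (card {d. d dvd m})"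
    by (metis of_nat_le_iff of_nat_mult)
qed auto

lemma two_power_omega_bound:
  assumes "(\<epsilon>::real) > 0"
  shows "\<exists>C\<ge>1. \<forall>n>0. 2 ^ card (prime_factors (n::nat)) \<le> C * real n powr \<epsilon>"
proof (rule prime_power_recursion_bound[OF assms])
  fix q e m :: nat assume q: "prime q" and m: "\<not> q dvd m" "m > 0" and e: "e > 0"
  have "q \<noteq> 0" using q by auto
  then have "prime_factors (q^e * m) = insert q (prime_factors m)"
    using q m e by (auto simp: prime_factors_product prime_factors_power prime_prime_factors)
  then have "card (prime_factors (q^e * m)) \<le> Suc (card (prime_factors m))"
    by (simp add: card_insert_le_m1 card_insert_if)
  then have "(2::real) ^ card (prime_factors (q^e * m)) \<le> 2 ^ Suc (card (prime_factors m))"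
    by (intro power_increasing) auto
  also have "\<dots> \<le> real (e + 1) * 2 ^ card (prime_factors m)" using e by simp
  finally show "(2::real) ^ card (prime_factors (q^e * m)) \<le> real (e + 1) * 2 ^ card (prime_factors m)" .
qed auto

text \<open>Choosing each prime at random as a numerator or a denominator prime keeps a fraction \<open>a/b\<close> with
  probability \<open>2^(- omega(a b))\<close>, and no cancellation occurs among the fractions that are kept.\<close>

lemma noncancelling_subset:
  fixes Q :: "(nat \<times> nat) set" and D :: real
  assumes fin: "finite Q" and cop: "\<And>a b. (a, b) \<in> Q \<Longrightarrow> coprime a b \<and> a > 0 \<and> b > 0"
    and D: "\<And>a b. (a, b) \<in> Q \<Longrightarrow> 2 ^ card (prime_factors a) * 2 ^ card (prime_factors b) \<le> D"
  obtains S where "S \<subseteq> Q" "real (card Q) \<le> D * real (card S)"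
    "\<And>a b c d. (a, b) \<in> S \<Longrightarrow> (c, d) \<in> S \<Longrightarrow> coprime a d"
proof -
  define E where "E = (\<Union>(a, b)\<in>Q. prime_factors a \<union> prime_factors b)"
  have finE: "finite E" using fin by (auto simp: E_def)
  define ok where "ok \<sigma> = (\<lambda>(a, b). prime_factors a \<subseteq> \<sigma> \<and> prime_factors b \<inter> \<sigma> = {})" for \<sigma> :: "nat set"
  have count: "2 ^ card E \<le> D * real (card {\<sigma> \<in> Pow E. ok \<sigma> (a, b)})" if ab: "(a, b) \<in> Q" for a b
  proof -
    let ?A = "prime_factors a" and ?B = "prime_factors b"
    have disj: "?A \<inter> ?B = {}"
    proof (rule ccontr)
      assume "?A \<inter> ?B \<noteq> {}"
      then obtain r where "prime r" "r dvd a" "r dvd b" by (auto simp: prime_factors_dvd)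
      then show False using cop[OF ab] by (metis coprime_common_divisor not_prime_unit)
    qed
    have sub: "?A \<subseteq> E" "?B \<subseteq> E" using ab by (auto simp: E_def)
    have "card (Pow (E - ?A - ?B)) \<le> card {\<sigma> \<in> Pow E. ok \<sigma> (a, b)}"
    proof (rule card_inj_on_le[of "\<lambda>\<tau>. \<tau> \<union> ?A"])
      show "inj_on (\<lambda>\<tau>. \<tau> \<union> ?A) (Pow (E - ?A - ?B))" by (auto simp: inj_on_def)
      show "(\<lambda>\<tau>. \<tau> \<union> ?A) ` Pow (E - ?A - ?B) \<subseteq> {\<sigma> \<in> Pow E. ok \<sigma> (a, b)}"
        using sub disj by (auto simp: ok_def)
    qed (use finE in auto)
    moreover have "card (Pow (E - ?A - ?B)) = 2 ^ card (E - ?A - ?B)" using finE by (intro card_Pow) auto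
    ultimately have 1: "(2::real) ^ card (E - ?A - ?B) \<le> real (card {\<sigma> \<in> Pow E. ok \<sigma> (a, b)})"
      by (metis of_nat_le_iff of_nat_numeral of_nat_power)
    have "E = (E - ?A - ?B) \<union> (?A \<union> ?B)" using sub by auto
    moreover have "card ((E - ?A - ?B) \<union> (?A \<union> ?B)) = card (E - ?A - ?B) + card (?A \<union> ?B)"
      using finE by (intro card_Un_disjoint) auto
    ultimately have "card E = card (E - ?A - ?B) + card (?A \<union> ?B)" by simp
    also have "card (?A \<union> ?B) = card ?A + card ?B" using disj by (intro card_Un_disjoint) auto
    finally have "(2::real) ^ card E = (2 ^ card ?A * 2 ^ card ?B) * 2 ^ card (E - ?A - ?B)"
      by (simp add: power_add)
    also have "\<dots> \<le> D * real (card {\<sigma> \<in> Pow E. ok \<sigma> (a, b)})"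
      using D[OF ab] 1 by (intro mult_mono) (auto intro: order.trans[OF _ D[OF ab]])
    finally show ?thesis .
  qed
  \<comment> \<open>Averaging over all choices \<open>\<sigma>\<close> of numerator primes: if every
    \<open>\<sigma>\<close> kept too few fractions, double counting would contradict
    \<open>count\<close>.\<close>
  have "\<exists>\<sigma>\<in>Pow E. real (card Q) \<le> D * real (card {z \<in> Q. ok \<sigma> z})"
  proof (rule ccontr)
    assume neg: "\<not> ?thesis"
    have "real (card Q) * 2 ^ card E = (\<Sum>z\<in>Q. 2 ^ card E)" by simp
    also have "\<dots> \<le> (\<Sum>z\<in>Q. D * real (card {\<sigma> \<in> Pow E. ok \<sigma> z}))"
      using count by (intro sum_mono) auto
    also have "\<dots> = D * real (\<Sum>z\<in>Q. card {\<sigma> \<in> Pow E. ok \<sigma> z})" by (simp add: sum_distrib_left)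
    also have "(\<Sum>z\<in>Q. card {\<sigma> \<in> Pow E. ok \<sigma> z}) = (\<Sum>\<sigma>\<in>Pow E. card {z \<in> Q. ok \<sigma> z})"
      using sum_multicount_gen[of Q "Pow E" "\<lambda>z \<sigma>. ok \<sigma> z" "\<lambda>\<sigma>. card {z \<in> Q. ok \<sigma> z}"] fin finE by simp
    also have "D * real \<dots> = (\<Sum>\<sigma>\<in>Pow E. D * real (card {z \<in> Q. ok \<sigma> z}))" by (simp add: sum_distrib_left)
    also have "\<dots> < (\<Sum>\<sigma>\<in>Pow E. real (card Q))"
      using neg finE by (intro sum_strict_mono) (auto simp: not_le)
    also have "\<dots> = real (card Q) * 2 ^ card E" using finE by (simp add: card_Pow)
    finally show False by simp
  qed
  then obtain \<sigma> where \<sigma>: "real (card Q) \<le> D * real (card {z \<in> Q. ok \<sigma> z})" by (rule bexE)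
  define S where "S = {z \<in> Q. ok \<sigma> z}"
  have "coprime a d" if S: "(a, b) \<in> S" "(c, d) \<in> S" for a b c d :: nat
  proof (rule ccontr)
    assume "\<not> coprime a d"
    then have "gcd a d \<noteq> 1" unfolding coprime_iff_gcd_eq_1 .
    then obtain r where r: "prime r" "r dvd gcd a d" using prime_factor_nat by blast
    have Q: "(a, b) \<in> Q" "(c, d) \<in> Q" using S unfolding S_def by simp_all
    have "a > 0" "d > 0" using cop[OF Q(1)] cop[OF Q(2)] by simp_all
    then have "r \<in> prime_factors a" "r \<in> prime_factors d" using r by (simp_all add: prime_factors_dvd)
    then show False using S unfolding S_def ok_def by blast
  qed
  moreover have "S \<subseteq> Q" unfolding S_def by (rule Collect_restrict)
  ultimately show thesis using that[of S] \<sigma> unfolding S_def[symmetric] by blast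
qed

section \<open>Powers and spacing of fractions in the group\<close>

context odd_prime
begin

definition sim_fractions :: "nat \<Rightarrow> (nat \<times> nat) set" where
  "sim_fractions h = {(a, b) \<in> {1..h} \<times> {1..h}. coprime a b \<and> \<not> p dvd a \<and> \<not> p dvd b \<and> sim a b}"

lemma finite_sim_fractions [simp]: "finite (sim_fractions h)"
  unfolding sim_fractions_def by (rule finite_subset[of _ "{1..h} \<times> {1..h}"]) auto

lemma sim_prod:
  assumes "\<And>i. i \<in> I \<Longrightarrow> sim (f i) (g i)"
  shows "sim (prod f I) (prod g I)"
  using assms unfolding sim_def prod_power_distrib by (intro cong_prod)

text \<open>After passing to a subset without cancellation, at the cost of
  \<open>D\<^sub>1^2\<close>, the \<open>n\<close>-fold products are reduced fractions of height at
  most \<open>h^n\<close>. Each product comes from at most \<open>D\<^sub>2^(2*n)\<close> tuples,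
  because the numerators and denominators of the factors divide those of the product.\<close>

lemma card_sim_fractions_power:
  fixes D\<^sub>1 D\<^sub>2 :: real
  assumes D1: "\<And>n. 0 < n \<Longrightarrow> n \<le> h \<Longrightarrow> 2 ^ card (prime_factors n) \<le> D\<^sub>1"
    and D2: "\<And>m. 0 < m \<Longrightarrow> m \<le> h^n \<Longrightarrow> real (card {d. d dvd m}) \<le> D\<^sub>2" and D0: "D\<^sub>1 \<ge> 0" "D\<^sub>2 \<ge> 0"
  shows "real (card (sim_fractions h))^n \<le> D\<^sub>1^(2*n) * D\<^sub>2^(2*n) * real (card (sim_fractions (h^n)))"
proof -
  have cop: "coprime a b \<and> a > 0 \<and> b > 0" and le: "2 ^ card (prime_factors a) * 2 ^ card (prime_factors b) \<le> D\<^sub>1^2"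
    if "(a, b) \<in> sim_fractions h" for a b
  proof -
    show "coprime a b \<and> a > 0 \<and> b > 0" using that by (auto simp: sim_fractions_def)
    have "2 ^ card (prime_factors a) \<le> D\<^sub>1" "2 ^ card (prime_factors b) \<le> D\<^sub>1"
      using that by (auto simp: sim_fractions_def intro!: D1)
    then show "2 ^ card (prime_factors a) * 2 ^ card (prime_factors b) \<le> D\<^sub>1^2"
      unfolding power2_eq_square using D0 by (intro mult_mono) auto
  qed
  obtain S where S: "S \<subseteq> sim_fractions h" "real (card (sim_fractions h)) \<le> D\<^sub>1^2 * real (card S)"
    "\<And>a b c d. (a, b) \<in> S \<Longrightarrow> (c, d) \<in> S \<Longrightarrow> coprime a d"
    using noncancelling_subset[of "sim_fractions h" "D\<^sub>1^2"] cop le finite_sim_fractions by metis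
  have fS: "finite S" using S(1) finite_subset finite_sim_fractions by blast
  define W where "W = ({..<n} \<rightarrow>\<^sub>E S)"
  define \<pi> where "\<pi> f = (\<Prod>i<n. fst (f i), \<Prod>i<n. snd (f i))" for f :: "nat \<Rightarrow> nat \<times> nat"
  have fW: "finite W" using fS by (simp add: W_def finite_PiE)
  have fin_pair: "1 \<le> fst (f i)" "fst (f i) \<le> h" "1 \<le> snd (f i)" "snd (f i) \<le> h" "\<not> p dvd fst (f i)" "\<not> p dvd snd (f i)"
    "sim (fst (f i)) (snd (f i))" "f i \<in> S"
    if "f \<in> W" "i < n" for f i
  proof -
    show "f i \<in> S" using that by (auto simp: W_def)
    then have "f i \<in> sim_fractions h" using S(1) by blast
    then show "1 \<le> fst (f i)" "fst (f i) \<le> h" "1 \<le> snd (f i)" "snd (f i) \<le> h" "\<not> p dvd fst (f i)" "\<not> p dvd snd (f i)"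
      "sim (fst (f i)) (snd (f i))" by (auto simp: sim_fractions_def)
  qed
  have range: "\<pi> f \<in> sim_fractions (h^n)" if f: "f \<in> W" for f
  proof -
    have "coprime (\<Prod>i<n. fst (f i)) (\<Prod>i<n. snd (f i))"
    proof (intro prod_coprime_left prod_coprime_right)
      fix i j assume "i \<in> {..<n}" "j \<in> {..<n}"
      then have "(fst (f i), snd (f i)) \<in> S" "(fst (f j), snd (f j)) \<in> S" using fin_pair(8)[OF f] by auto
      then show "coprime (fst (f i)) (snd (f j))" by (rule S(3))
    qed
    moreover have "(\<Prod>i<n. fst (f i)) \<le> h^n" "(\<Prod>i<n. snd (f i)) \<le> h^n"
      using fin_pair[OF f] prod_mono[of "{..<n}" "\<lambda>i. fst (f i)" "\<lambda>_. h"] prod_mono[of "{..<n}" "\<lambda>i. snd (f i)" "\<lambda>_. h"] by auto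
    moreover have "1 \<le> (\<Prod>i<n. fst (f i))" "1 \<le> (\<Prod>i<n. snd (f i))"
      using fin_pair[OF f] by (intro prod_ge_1; simp)+
    moreover have "\<not> p dvd (\<Prod>i<n. fst (f i))" "\<not> p dvd (\<Prod>i<n. snd (f i))"
      using fin_pair[OF f] prime_p by (simp_all add: prime_dvd_prod_iff)
    moreover have "sim (\<Prod>i<n. fst (f i)) (\<Prod>i<n. snd (f i))"
      using fin_pair[OF f] by (intro sim_prod) simp
    ultimately show ?thesis by (simp add: sim_fractions_def \<pi>_def)
  qed
  have fibre: "real (card {f \<in> W. \<pi> f = z}) \<le> D\<^sub>2^(2*n)" if z: "z \<in> sim_fractions (h^n)" for z
  proof -
    obtain A B where zAB: "z = (A, B)" by (cases z)
    have AB: "0 < A" "A \<le> h^n" "0 < B" "B \<le> h^n" using z unfolding zAB by (auto simp: sim_fractions_def)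
    have "{f \<in> W. \<pi> f = z} \<subseteq> ({..<n} \<rightarrow>\<^sub>E {d. d dvd A} \<times> {d. d dvd B})"
    proof
      fix f assume f: "f \<in> {f \<in> W. \<pi> f = z}"
      then have "fst (f i) dvd A" "snd (f i) dvd B" if "i < n" for i
        using that by (auto simp: \<pi>_def zAB intro!: dvd_prodI)
      then show "f \<in> ({..<n} \<rightarrow>\<^sub>E {d. d dvd A} \<times> {d. d dvd B})"
        using f by (auto simp: W_def PiE_iff mem_Times_iff)
    qed
    then have "card {f \<in> W. \<pi> f = z} \<le> card ({..<n} \<rightarrow>\<^sub>E {d. d dvd A} \<times> {d. d dvd B})"
      using AB by (intro card_mono finite_PiE) auto
    also have "\<dots> = (card {d. d dvd A} * card {d. d dvd B})^n"
      by (simp add: card_PiE card_cartesian_product)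
    finally have "real (card {f \<in> W. \<pi> f = z}) \<le> real ((card {d. d dvd A} * card {d. d dvd B})^n)"
      by (simp only: of_nat_le_iff)
    also have "\<dots> = (real (card {d. d dvd A}) * real (card {d. d dvd B}))^n"
      by (simp only: of_nat_power of_nat_mult)
    also have "\<dots> \<le> (D\<^sub>2 * D\<^sub>2)^n"
      by (intro power_mono mult_mono D2 AB D0) simp_all
    finally show ?thesis by (simp add: power2_eq_square power_mult)
  qed
  have "real (card S)^n = real (card W)" unfolding W_def by (simp add: card_PiE)
  also have "card W = (\<Sum>z\<in>sim_fractions (h^n). card {f \<in> W. \<pi> f = z})"
    using sum.group[OF fW finite_sim_fractions image_subsetI, of \<pi> "h^n" "\<lambda>_. 1::nat"] range by simp
  also have "real \<dots> \<le> (\<Sum>z\<in>sim_fractions (h^n). D\<^sub>2^(2*n))"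
    unfolding of_nat_sum by (intro sum_mono fibre)
  finally have "real (card S)^n \<le> D\<^sub>2^(2*n) * real (card (sim_fractions (h^n)))" by (simp add: mult.commute)
  then have "(D\<^sub>1^2 * real (card S))^n \<le> D\<^sub>1^(2*n) * (D\<^sub>2^(2*n) * real (card (sim_fractions (h^n))))"
    unfolding power_mult_distrib power_mult[symmetric] by (intro mult_left_mono) (auto simp: D0)
  moreover have "real (card (sim_fractions h))^n \<le> (D\<^sub>1^2 * real (card S))^n"
    using S(2) by (intro power_mono) auto
  ultimately show ?thesis by (simp add: mult.assoc)
qed

text \<open>Take \<open>t = a/b\<close> modulo \<open>p\<close>. Then \<open>(t * b)^p = a^p\<close>
  modulo \<open>p^2\<close>, and the congruent units \<open>a^(p-1)\<close> and
  \<open>b^(p-1)\<close> cancel.\<close>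

lemma sim_fraction_residue:
  assumes ab: "(a, b) \<in> sim_fractions h"
  obtains t where "t \<in> {1..<int p}" "[int a = t^p * int b] (mod (int p)^2)"
proof -
  let ?p = "int p"
  have nd: "\<not> ?p dvd int a" "\<not> ?p dvd int b" and s: "[int a^(p-1) = int b^(p-1)] (mod ?p^2)"
    using ab by (auto simp: sim_fractions_def sim_int int_dvd_int_iff)
  have cb: "coprime (int b) ?p" using nd prime_int_p by (metis coprime_commute prime_imp_coprime)
  then obtain i where i: "[int b * i = 1] (mod ?p)" using cong_solve_coprime_int by blast
  define t where "t = int a * i mod ?p"
  have "[t * int b = int a * i * int b] (mod ?p)" unfolding t_def by (intro cong_mult cong_refl) (simp add: cong_def)
  also have "int a * i * int b = int a * (int b * i)" by simp
  also have "[int a * (int b * i) = int a * 1] (mod ?p)" by (intro cong_mult cong_refl i)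
  finally have tb: "[t * int b = int a] (mod ?p)" by simp
  have "t \<noteq> 0" using tb nd by (auto simp: cong_0_iff cong_sym_eq[of 0])
  moreover have "0 \<le> t" "t < ?p" using p_pos by (simp_all add: t_def)
  ultimately have t: "t \<in> {1..<?p}" by auto
  have split: "x^p = x * x^(p-1)" for x :: int using p_pos by (cases p) auto
  have "[(t * int b)^p = int a^p] (mod ?p^2)" using tb by (rule cong_pow_p_square)
  then have "[t^p * int b * int b^(p-1) = int a * int a^(p-1)] (mod ?p^2)"
    unfolding power_mult_distrib split[of "int b"] split[of "int a"] by (simp add: mult.assoc)
  moreover have "[int a * int a^(p-1) = int a * int b^(p-1)] (mod ?p^2)" by (intro cong_mult cong_refl s)
  ultimately have "[t^p * int b * int b^(p-1) = int a * int b^(p-1)] (mod ?p^2)" by (rule cong_trans)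
  moreover have "coprime (int b^(p-1)) (?p^2)" using cb by simp
  ultimately have "[t^p * int b = int a] (mod ?p^2)" using cong_mult_rcancel by blast
  then show thesis using that t cong_sym by blast
qed

text \<open>For a fixed \<open>t\<close> the fractions \<open>a/b\<close> with \<open>a = t^p b\<close> modulo \<open>p^2\<close> have pairwise determinants divisible by
  \<open>p^2\<close>, so they are \<open>p^2/h^2\<close>-separated.\<close>

lemma card_sim_fractions_le:
  assumes h: "h > 0"
  shows "real (card (sim_fractions h)) \<le> 2 * real p * ((real h)^2 / (real p)^2 + 1)"
proof -
  let ?p = "int p"
  define L where "L = nat \<lfloor>(real h)^2 / (real p)^2\<rfloor>"
  have "\<exists>t. t \<in> {1..<?p} \<and> [int a = t^p * int b] (mod ?p^2)" if "(a, b) \<in> sim_fractions h" for a b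
    using sim_fraction_residue[OF that] by blast
  then obtain \<tau> where \<tau>: "\<And>a b. (a, b) \<in> sim_fractions h \<Longrightarrow> \<tau> a b \<in> {1..<?p} \<and> [int a = \<tau> a b^p * int b] (mod ?p^2)"
    by metis
  \<comment> \<open>Inverting the fractions above \<open>1\<close> keeps the slope in
    \<open>[0, 1]\<close>, so \<open>L + 1\<close> cells of length \<open>p^2 / h^2\<close> are
    enough. The flag \<open>a \<le> b\<close> in \<open>\<kappa>\<close> records the inversion and
    accounts for the factor 2.\<close>
  define slope where "slope a b = (if a \<le> b then real a / real b else real b / real a)" for a b :: nat
  define \<kappa> where "\<kappa> = (\<lambda>(a, b). (\<tau> a b, a \<le> b, nat \<lfloor>slope a b * ((real h)^2 / (real p)^2)\<rfloor>))"
  \<comment> \<open>Two fractions in one cell have determinant below \<open>p^2\<close> in absolute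
    value; being divisible by \<open>p^2\<close> it is zero, and reduced fractions with zero
    determinant coincide.\<close>
  have close: "a = c \<and> b = d"
    if pos: "0 < a" "0 < b" "0 < c" "0 < d" "b \<le> h" "d \<le> h" and cop: "coprime a b" "coprime c d"
      and fl: "\<lfloor>real a / real b * ((real h)^2 / (real p)^2)\<rfloor> = \<lfloor>real c / real d * ((real h)^2 / (real p)^2)\<rfloor>"
      and dvd: "?p^2 dvd int a * int d - int c * int b"
    for a b c d :: nat
  proof -
    define H where "H = (real h)^2 / (real p)^2"
    have H: "H > 0" using h p_pos by (simp add: H_def)
    have "\<bar>real a / real b * H - real c / real d * H\<bar> < 1"
      using fl unfolding H_def by linarith
    also have "real a / real b * H - real c / real d * H = (real a * real d - real c * real b) / (real b * real d) * H"
      using pos by (simp add: field_simps)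
    also have "\<bar>\<dots>\<bar> = \<bar>real a * real d - real c * real b\<bar> / (real b * real d) * H"
      using pos H by (simp add: abs_mult)
    finally have "\<bar>real a * real d - real c * real b\<bar> * H < real b * real d"
      using pos by (simp add: field_simps)
    also have "\<dots> \<le> (real h)^2" unfolding power2_eq_square using pos by (intro mult_mono) auto
    finally have "\<bar>real a * real d - real c * real b\<bar> < (real p)^2"
      using h p_pos by (simp add: H_def field_simps)
    then have "\<bar>int a * int d - int c * int b\<bar> < ?p^2"
      by (metis (mono_tags, lifting) of_int_abs of_int_diff of_int_less_iff of_int_mult of_int_of_nat_eq of_int_power)
    then have "int a * int d = int c * int b"
      using dvd by (metis abs_dvd_iff dvd_abs_iff eq_iff_diff_eq_0 abs_le_zero_iff linorder_not_less zdvd_imp_le)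
    then have "a * d = c * b" by (metis of_nat_eq_iff of_nat_mult)
    then show ?thesis using coprime_crossproduct_nat[of a b c d] cop by (auto simp: mult.commute)
  qed
  have "inj_on \<kappa> (sim_fractions h)"
  proof (rule inj_onI, clarify)
    fix a b c d assume m: "(a, b) \<in> sim_fractions h" "(c, d) \<in> sim_fractions h" and eq: "\<kappa> (a, b) = \<kappa> (c, d)"
    have r: "\<tau> a b = \<tau> c d" "a \<le> b \<longleftrightarrow> c \<le> d"
      "nat \<lfloor>slope a b * ((real h)^2 / (real p)^2)\<rfloor> = nat \<lfloor>slope c d * ((real h)^2 / (real p)^2)\<rfloor>"
      using eq by (auto simp: \<kappa>_def)
    have "slope a b * ((real h)^2 / (real p)^2) \<ge> 0" "slope c d * ((real h)^2 / (real p)^2) \<ge> 0" by (auto simp: slope_def)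
    then have fl: "\<lfloor>slope a b * ((real h)^2 / (real p)^2)\<rfloor> = \<lfloor>slope c d * ((real h)^2 / (real p)^2)\<rfloor>"
      using r(3) by (simp add: eq_nat_nat_iff)
    have b: "0 < a" "0 < b" "0 < c" "0 < d" "a \<le> h" "b \<le> h" "c \<le> h" "d \<le> h" "coprime a b" "coprime c d"
      using m by (auto simp: sim_fractions_def)
    have "[int a * int d = \<tau> a b^p * int b * int d] (mod ?p^2)" using \<tau>[OF m(1)] by (intro cong_mult cong_refl) auto
    also have "\<tau> a b^p * int b * int d = \<tau> c d^p * int d * int b" by (simp add: r(1))
    also have "[\<tau> c d^p * int d * int b = int c * int b] (mod ?p^2)"
      using \<tau>[OF m(2)] by (intro cong_mult cong_refl) (auto simp: cong_sym_eq)
    finally have dvd: "?p^2 dvd int a * int d - int c * int b" by (simp only: cong_iff_dvd_diff)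
    show "a = c \<and> b = d"
    proof (cases "a \<le> b")
      case True
      then show ?thesis using b r(2) fl dvd by (intro close) (auto simp: slope_def)
    next
      case False
      have "?p^2 dvd - (int a * int d - int c * int b)" using dvd by (simp only: dvd_minus_iff)
      then have dvd': "?p^2 dvd int b * int c - int d * int a" by (simp add: mult.commute)
      have "b = d \<and> a = c"
        using b r(2) fl dvd' False by (intro close) (auto simp: slope_def coprime_commute)
      then show ?thesis by blast
    qed
  qed
  moreover have "\<kappa> ` sim_fractions h \<subseteq> {1..<?p} \<times> UNIV \<times> {0..L}"
  proof
    fix z assume "z \<in> \<kappa> ` sim_fractions h"
    then obtain a b where ab: "(a, b) \<in> sim_fractions h" "z = \<kappa> (a, b)" by auto
    have "slope a b \<le> 1" using ab(1) by (auto simp: slope_def sim_fractions_def)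
    then have "slope a b * ((real h)^2 / (real p)^2) \<le> 1 * ((real h)^2 / (real p)^2)" by (intro mult_right_mono) auto
    then have "nat \<lfloor>slope a b * ((real h)^2 / (real p)^2)\<rfloor> \<le> L" unfolding L_def by (intro nat_mono floor_mono) simp
    then show "z \<in> {1..<?p} \<times> UNIV \<times> {0..L}" using \<tau>[OF ab(1)] ab(2) by (simp add: \<kappa>_def)
  qed
  ultimately have "card (sim_fractions h) \<le> card ({1..<?p} \<times> (UNIV :: bool set) \<times> {0..L})"
    by (intro card_inj_on_le) auto
  also have "\<dots> = (p - 1) * (2 * (L + 1))" using p_pos by (simp add: card_cartesian_product nat_diff_distrib)
  also have "\<dots> \<le> p * (2 * (L + 1))" by (intro mult_le_mono1) simp
  finally have "real (card (sim_fractions h)) \<le> real (p * (2 * (L + 1)))" by (simp only: of_nat_le_iff)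
  also have "\<dots> = 2 * real p * (real L + 1)" by (simp add: algebra_simps)
  also have "\<dots> \<le> 2 * real p * ((real h)^2 / (real p)^2 + 1)"
    unfolding L_def by (intro mult_left_mono add_right_mono) auto
  finally show ?thesis .
qed

lemma sim_cancel:
  assumes "sim (g * a) (g * b)" "\<not> p dvd g"
  shows "sim a b"
proof -
  have "coprime (g^(p-1)) (p^2)" using assms(2) prime_p
    by (metis coprime_commute coprime_power_left_iff coprime_power_right_iff prime_imp_coprime)
  then show ?thesis
    using assms(1) unfolding sim_def power_mult_distrib by (simp add: cong_mult_lcancel_nat)
qed

text \<open>Dividing by \<open>g = gcd a b\<close> leaves a reduced fraction of height at most
  \<open>K div g\<close>, and \<open>K < p\<close> makes \<open>g\<close> a unit, so the equivalence
  survives.\<close>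

lemma card_sim_pairs:
  assumes K: "K < p"
  shows "card (sim_pairs K) \<le> (\<Sum>g=1..K. card (sim_fractions (K div g)))"
proof -
  define \<gamma> where "\<gamma> = (\<lambda>(a::nat, b::nat). (gcd a b, (a div gcd a b, b div gcd a b)))"
  have "inj_on \<gamma> (sim_pairs K)"
  proof (rule inj_onI, clarify)
    fix a b c d assume "\<gamma> (a, b) = \<gamma> (c, d)"
    then have "gcd a b = gcd c d" "a div gcd a b = c div gcd c d" "b div gcd a b = d div gcd c d"
      by (auto simp: \<gamma>_def)
    then show "a = c \<and> b = d" by (metis dvd_mult_div_cancel gcd_dvd1 gcd_dvd2)
  qed
  moreover have "\<gamma> ` sim_pairs K \<subseteq> (SIGMA g:{1..K}. sim_fractions (K div g))"
  proof (rule image_subsetI)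
    fix z assume z: "z \<in> sim_pairs K"
    obtain a b where zab: "z = (a, b)" by (cases z)
    have ab: "(a, b) \<in> sim_pairs K" using z unfolding zab .
    define g where "g = gcd a b"
    have r: "1 \<le> a" "a \<le> K" "1 \<le> b" "b \<le> K" "sim a b" using ab by (auto simp: sim_pairs_def)
    have g0: "g > 0" using r by (simp add: g_def)
    define a' b' where "a' = a div g" and "b' = b div g"
    have a: "a = g * a'" "b = g * b'" unfolding a'_def b'_def g_def by simp_all
    have cop: "coprime a' b'" unfolding a'_def b'_def g_def using r(1) by (intro div_gcd_coprime) simp
    have "a' > 0" "b' > 0" using a r(1,3) by (auto intro!: gr0I)
    have gK: "g \<le> K" using gcd_le1_nat[of a b] r unfolding g_def by linarith
    have le: "a' \<le> K div g" "b' \<le> K div g" unfolding a'_def b'_def using r by (auto intro: div_le_mono)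
    then have lt: "a' < p" "b' < p" "g < p" using div_le_dividend[of K g] K gK by linarith+
    have nd: "\<not> p dvd a'" "\<not> p dvd b'" "\<not> p dvd g"
      by (rule nat_dvd_not_less[OF \<open>a' > 0\<close> lt(1)], rule nat_dvd_not_less[OF \<open>b' > 0\<close> lt(2)],
          rule nat_dvd_not_less[OF g0 lt(3)])
    have "sim (g * a') (g * b')" using r(5) by (simp only: a[symmetric])
    then have "sim a' b'" using nd(3) by (rule sim_cancel)
    then have "(a', b') \<in> sim_fractions (K div g)"
      using cop le nd \<open>a' > 0\<close> \<open>b' > 0\<close> by (simp add: sim_fractions_def)
    then have "(g, (a', b')) \<in> (SIGMA g:{1..K}. sim_fractions (K div g))" using g0 gK by auto
    then show "\<gamma> z \<in> (SIGMA g:{1..K}. sim_fractions (K div g))"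
      by (simp only: zab \<gamma>_def a'_def b'_def g_def prod.case)
  qed
  ultimately have "card (sim_pairs K) \<le> card (SIGMA g:{1..K}. sim_fractions (K div g))"
    by (intro card_inj_on_le) auto
  then show ?thesis by simp
qed

end


section \<open>Choosing the power of the height closest to \<open>p\<close>\<close>

lemma le_of_power_le:
  fixes x y :: real
  assumes "x^n \<le> y^n" "n > 0" "0 \<le> y"
  shows "x \<le> y"
  using assms by (metis not_le power_strict_mono)

text \<open>Up to a constant and \<open>p^\<delta>\<close>, the \<open>n\<close>-th power of the
  count is at most \<open>p + h^(2*n) / p\<close>. As \<open>n * s\<close> is within
  \<open>n / 84\<close> of \<open>1\<close>, both terms are at most
  \<open>p^(n * (s + 1/84))\<close>, and the \<open>n\<close>-th root is
  \<open>h * p^(1/84)\<close>.\<close>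

lemma sim_fractions_near:
  fixes \<delta> :: real
  assumes n: "n > 0" and \<delta>: "\<delta> > 0"
  shows "\<exists>C\<ge>1. \<forall>p h s. odd_prime p \<longrightarrow> h \<ge> 1 \<longrightarrow> real h = real p powr s \<longrightarrow> 0 \<le> s \<longrightarrow> s \<le> 1 \<longrightarrow>
    \<bar>s - 1 / real n\<bar> \<le> 1 / 84 \<longrightarrow> real (card (odd_prime.sim_fractions p h)) \<le> C * real h * real p powr (1/84 + \<delta>)"
proof -
  \<comment> \<open>Chosen so that \<open>2*n\<close> factors \<open>h^\<eta>\<close> from the prime
    factors and \<open>2*n\<close> factors \<open>h^(n * \<eta>)\<close> from the divisors make up
    \<open>h^\<delta>\<close>.\<close>
  define \<eta> where "\<eta> = \<delta> / (2 * real n + 2 * real n * real n)"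
  have den: "2 * real n + 2 * real n * real n > 0" using n by (intro add_pos_pos mult_pos_pos) auto
  have \<eta>: "\<eta> > 0" unfolding \<eta>_def using \<delta> den by (intro divide_pos_pos)
  have \<eta>n: "\<eta> * (2 * real n + 2 * real n * real n) = \<delta>" unfolding \<eta>_def using den by simp
  obtain C1 where C1: "C1 \<ge> 1" "\<And>m. m > 0 \<Longrightarrow> real (card {d. d dvd (m::nat)}) \<le> C1 * real m powr \<eta>"
    using divisor_bound[OF \<eta>] by blast
  obtain C2 where C2: "C2 \<ge> 1" "\<And>m. m > 0 \<Longrightarrow> 2 ^ card (prime_factors (m::nat)) \<le> C2 * real m powr \<eta>"
    using two_power_omega_bound[OF \<eta>] by blast
  define C where "C = (C1 * C2)^(2*n) * 4"
  have "1 \<le> C1 * C2" using mult_mono[of 1 C1 1 C2] C1(1) C2(1) by simp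
  then have "1 \<le> (C1 * C2)^(2*n)" by (rule one_le_power)
  then have C: "C \<ge> 1" unfolding C_def by linarith
  have "real (card (odd_prime.sim_fractions p h)) \<le> C * real h * real p powr (1/84 + \<delta>)"
    if op: "odd_prime p" and h: "h \<ge> 1" and hs: "real h = real p powr s" and s: "0 \<le> s" "s \<le> 1" "\<bar>s - 1 / real n\<bar> \<le> 1 / 84"
    for p h s
  proof -
    interpret odd_prime p by (rule op)
    have p1: "real p > 1" using p_gt_2 by simp
    have h0: "real h > 0" using h by simp
    define M where "M = real (card (sim_fractions h))"
    have "M^n \<le> (C2 * real h powr \<eta>)^(2*n) * (C1 * real (h^n) powr \<eta>)^(2*n) * real (card (sim_fractions (h^n)))"
      unfolding M_def
    proof (rule card_sim_fractions_power)
      fix m :: nat assume m: "0 < m" "m \<le> h"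
      have "C2 * real m powr \<eta> \<le> C2 * real h powr \<eta>" using m C2(1) \<eta> by (intro mult_left_mono powr_mono2) auto
      then show "2 ^ card (prime_factors m) \<le> C2 * real h powr \<eta>" using C2(2)[OF m(1)] by linarith
    next
      fix m :: nat assume m: "0 < m" "m \<le> h^n"
      then have "real m \<le> real (h^n)" by (simp only: of_nat_le_iff)
      then have "C1 * real m powr \<eta> \<le> C1 * real (h^n) powr \<eta>" using C1(1) \<eta> by (intro mult_left_mono powr_mono2) auto
      then show "real (card {d. d dvd m}) \<le> C1 * real (h^n) powr \<eta>" using C1(2)[OF m(1)] by linarith
    qed (use C1 C2 in auto)
    also have "(C2 * real h powr \<eta>)^(2*n) * (C1 * real (h^n) powr \<eta>)^(2*n) = (C1 * C2)^(2*n) * real h powr \<delta>"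
    proof -
      have "(real h powr \<eta>)^(2*n) * (real (h^n) powr \<eta>)^(2*n) = real h powr (\<eta> * real (2*n) + real n * \<eta> * real (2*n))"
      proof -
        have "real (h^n) powr \<eta> = real h powr (real n * \<eta>)"
          using h0 by (simp add: powr_realpow[symmetric] powr_powr)
        then show ?thesis using h0 by (simp only: powr_power_eq powr_add)
      qed
      also have "\<eta> * real (2*n) + real n * \<eta> * real (2*n) = \<delta>" unfolding \<eta>n[symmetric] by (simp add: algebra_simps)
      finally show ?thesis by (simp add: power_mult_distrib mult_ac)
    qed
    also have "(C1 * C2)^(2*n) * real h powr \<delta> * real (card (sim_fractions (h^n)))
        \<le> (C1 * C2)^(2*n) * real p powr \<delta> * (2 * real p * ((real (h^n))^2 / (real p)^2 + 1))"
    proof (intro mult_mono)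
      have "real h \<le> real p powr 1" unfolding hs using s p1 by (intro powr_mono) auto
      then show "real h powr \<delta> \<le> real p powr \<delta>" using \<delta> p1 by (intro powr_mono2) auto
      show "real (card (sim_fractions (h^n))) \<le> 2 * real p * ((real (h^n))^2 / (real p)^2 + 1)"
        using h by (intro card_sim_fractions_le) simp
    qed (use C1 C2 in auto)
    also have "2 * real p * ((real (h^n))^2 / (real p)^2 + 1) = 2 * (real p powr (2 * s * real n - 1) + real p powr 1)"
    proof -
      have "(real (h^n))^2 = real p powr (2 * s * real n)"
        using p1 by (simp add: hs powr_powr powr_realpow[symmetric] power_mult[symmetric] mult_ac)
      moreover have "real p powr (2 * s * real n - 1) = real p powr (2 * s * real n) / real p"
        using p1 by (simp add: powr_diff)
      ultimately show ?thesis using p1 by (simp add: field_simps power2_eq_square)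
    qed
    also have "\<dots> \<le> 2 * (real p powr (real n * (s + 1/84)) + real p powr (real n * (s + 1/84)))"
    proof (intro mult_left_mono add_mono powr_mono)
      have "real n * \<bar>s - 1 / real n\<bar> \<le> real n * (1 / 84)" using s(3) by (intro mult_left_mono) auto
      moreover have "real n * \<bar>s - 1 / real n\<bar> = \<bar>real n * (s - 1 / real n)\<bar>" by (simp add: abs_mult)
      moreover have "real n * (s - 1 / real n) = real n * s - 1" using n by (simp add: right_diff_distrib)
      ultimately have "\<bar>real n * s - 1\<bar> \<le> real n / 84" by simp
      then have "real n * s - 1 \<le> real n / 84" "1 - real n * s \<le> real n / 84" by linarith+
      then show "2 * s * real n - 1 \<le> real n * (s + 1/84)" "1 \<le> real n * (s + 1/84)"
        by (simp_all add: distrib_left mult.commute[of s])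
    qed (use p1 in auto)
    finally have "M^n \<le> (C1 * C2)^(2*n) * real p powr \<delta> * (2 * (real p powr (real n * (s + 1/84)) + real p powr (real n * (s + 1/84))))"
      using C1(1) C2(1) by (simp add: mult_left_mono)
    also have "\<dots> = C * (real p powr \<delta> * real p powr (real n * (s + 1/84)))" by (simp add: C_def)
    also have "\<dots> \<le> C^n * (real p powr (real n * \<delta>) * real p powr (real n * (s + 1/84)))"
    proof (intro mult_mono powr_mono)
      show "C \<le> C^n" using C n by (simp add: self_le_power)
      have "1 * \<delta> \<le> real n * \<delta>" using n \<delta> by (intro mult_right_mono) auto
      then show "\<delta> \<le> real n * \<delta>" by simp
    qed (use C p1 s(1) in auto)
    also have "\<dots> = (C * real h * real p powr (1/84 + \<delta>))^n"
    proof -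
      have "(real h * real p powr (1/84 + \<delta>)) = real p powr (s + (1/84 + \<delta>))" by (simp only: hs powr_add)
      then have "(real h * real p powr (1/84 + \<delta>))^n = real p powr ((s + (1/84 + \<delta>)) * real n)"
        using p1 by (simp add: powr_power_eq)
      also have "\<dots> = real p powr (real n * \<delta>) * real p powr (real n * (s + 1/84))"
        by (simp add: powr_add[symmetric] algebra_simps)
      finally show ?thesis by (simp only: power_mult_distrib mult.assoc)
    qed
    finally have "M^n \<le> (C * real h * real p powr (1/84 + \<delta>))^n" .
    then have "M \<le> C * real h * real p powr (1/84 + \<delta>)"
      by (rule le_of_power_le[OF _ n]) (use C in simp)
    then show ?thesis by (simp add: M_def)
  qed
  with C show ?thesis by blast
qed

text \<open>The reciprocals \<open>1/n\<close> and \<open>1/(n+1)\<close> around \<open>s\<close>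
  have \<open>n \<ge> 6\<close>, so they differ by at most \<open>1/42\<close> and the nearer one is
  within \<open>1/84\<close>. The lower bound on \<open>s\<close> gives \<open>n \<le> 84\<close>,
  hence the range up to 85.\<close>

lemma reciprocal_near:
  fixes s :: real
  assumes "1 / 84 < s" "s \<le> 1 / 6"
  obtains n where "n \<in> {1..85::nat}" "\<bar>s - 1 / real n\<bar> \<le> 1 / 84"
proof -
  define n where "n = nat \<lfloor>1 / s\<rfloor>"
  have "6 \<le> 1 / s" "1 / s < 84" using assms by (simp_all add: field_simps)
  then have n: "6 \<le> n" "real n \<le> 1 / s" "1 / s < real n + 1" "n \<le> 84" unfolding n_def by linarith+
  have ub: "s \<le> 1 / real n" using n(1,2) assms by (simp add: field_simps)
  have lb: "1 / (real n + 1) \<le> s" using n(3) assms by (simp add: field_simps)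
  have "6 * 7 \<le> real n * (real n + 1)" using n(1) by (intro mult_mono) auto
  then have "1 / (real n * (real n + 1)) \<le> 1 / 42" by (intro divide_left_mono) auto
  moreover have "1 / real n - 1 / (real n + 1) = 1 / (real n * (real n + 1))" using n(1) by (simp add: field_simps)
  ultimately have gap: "1 / real n - 1 / (real n + 1) \<le> 1 / 42" by simp
  show thesis
  proof (cases "1 / real n - s \<le> 1 / 84")
    case True
    then show thesis using that[of n] n ub by simp
  next
    case False
    then have "\<bar>s - 1 / real (Suc n)\<bar> \<le> 1 / 84" using lb gap by (simp add: add.commute)
    then show thesis using that[of "Suc n"] n by simp
  qed
qed

text \<open>Heights up to \<open>p^(1/84)\<close> are covered by the trivial bound
  \<open>h^2\<close>. Above, only finitely many \<open>n\<close> occur, so their constants can be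
  summed into one.\<close>

lemma sim_fractions_bound:
  fixes \<delta> :: real
  assumes \<delta>: "\<delta> > 0"
  shows "\<exists>C\<ge>1. \<forall>p h. odd_prime p \<longrightarrow> h \<ge> 1 \<longrightarrow> real h \<le> real p powr (1/6) \<longrightarrow>
    real (card (odd_prime.sim_fractions p h)) \<le> C * real h * real p powr (1/84 + \<delta>)"
proof -
  have "\<forall>n\<in>{1..85::nat}. \<exists>C\<ge>1. \<forall>p h s. odd_prime p \<longrightarrow> h \<ge> 1 \<longrightarrow> real h = real p powr s \<longrightarrow> 0 \<le> s \<longrightarrow> s \<le> 1 \<longrightarrow>
    \<bar>s - 1 / real n\<bar> \<le> 1 / 84 \<longrightarrow> real (card (odd_prime.sim_fractions p h)) \<le> C * real h * real p powr (1/84 + \<delta>)"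
    using sim_fractions_near[OF _ \<delta>] by simp
  from bchoice[OF this] obtain Cf where Cf_all: "\<forall>n\<in>{1..85::nat}. Cf n \<ge> 1 \<and> (\<forall>p h s. odd_prime p \<longrightarrow> h \<ge> 1 \<longrightarrow> real h = real p powr s \<longrightarrow> 0 \<le> s \<longrightarrow> s \<le> 1 \<longrightarrow>
    \<bar>s - 1 / real n\<bar> \<le> 1 / 84 \<longrightarrow> real (card (odd_prime.sim_fractions p h)) \<le> Cf n * real h * real p powr (1/84 + \<delta>))"
    by (rule exE)
  then have Cf: "Cf n \<ge> 1" if "n \<in> {1..85}" for n using that by blast
  define C where "C = (\<Sum>n\<in>{1..85}. Cf n)"
  have CfC: "Cf n \<le> C" if "n \<in> {1..85}" for n
    unfolding C_def using that Cf by (intro member_le_sum) (auto intro: order.trans[OF zero_le_one])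
  have C1: "C \<ge> 1" using CfC[of 1] Cf[of 1] by simp
  have "real (card (odd_prime.sim_fractions p h)) \<le> C * real h * real p powr (1/84 + \<delta>)"
    if op: "odd_prime p" and h: "h \<ge> 1" and hp: "real h \<le> real p powr (1/6)" for p h
  proof -
    interpret odd_prime p by (rule op)
    have p1: "real p > 1" using p_gt_2 by simp
    define s where "s = ln (real h) / ln (real p)"
    have hs: "real h = real p powr s" using p1 h by (simp add: s_def powr_def)
    have s0: "0 \<le> s" using p1 h by (simp add: s_def)
    have s6: "s \<le> 1 / 6" using hp p1 unfolding hs by (simp add: powr_le_cancel_iff)
    show ?thesis
    proof (cases "s \<le> 1 / 84")
      case True
      have "card (sim_fractions h) \<le> card ({1..h} \<times> {1..h})"
        unfolding sim_fractions_def by (intro card_mono) auto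
      then have "real (card (sim_fractions h)) \<le> real (h * h)" by (simp only: of_nat_le_iff) simp
      also have "\<dots> = real h * real p powr s" by (simp add: hs)
      also have "\<dots> \<le> real h * real p powr (1/84 + \<delta>)"
        using True p1 \<delta> by (intro mult_left_mono powr_mono) auto
      also have "\<dots> \<le> C * (real h * real p powr (1/84 + \<delta>))" using mult_right_mono[OF C1, of "real h * real p powr (1/84 + \<delta>)"] by simp
      finally show ?thesis by (simp add: mult.assoc)
    next
      case False
      then obtain n where n: "n \<in> {1..85::nat}" "\<bar>s - 1 / real n\<bar> \<le> 1 / 84" using reciprocal_near[of s] s6 by auto
      have "real (card (sim_fractions h)) \<le> Cf n * real h * real p powr (1/84 + \<delta>)"
        using bspec[OF Cf_all n(1)] op h hs s0 n(2) s6 by simp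
      also have "\<dots> \<le> C * real h * real p powr (1/84 + \<delta>)" using CfC[OF n(1)] by (intro mult_right_mono) auto
      finally show ?thesis .
    qed
  qed
  with C1 show ?thesis by blast
qed

lemma sum_inverse_le_ln: "K \<ge> 1 \<Longrightarrow> (\<Sum>g=1..K. 1 / real g) \<le> 1 + ln (real K)"
proof (induction K rule: dec_induct)
  case (step K)
  have "ln (real K / real (Suc K)) \<le> real K / real (Suc K) - 1"
    using step by (intro ln_le_minus_one) auto
  also have "\<dots> = - (1 / real (Suc K))" by (simp add: field_simps)
  finally have "1 / real (Suc K) \<le> ln (real (Suc K)) - ln (real K)"
    using step by (simp add: ln_div)
  then show ?case using step by simp
qed simp

text \<open>Summation over the gcd costs a harmonic sum, that is a logarithm, which half of
  \<open>\<epsilon>\<close> absorbs.\<close>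

lemma sim_pairs_bound:
  fixes \<epsilon> :: real
  assumes \<epsilon>: "\<epsilon> > 0"
  shows "\<exists>C\<ge>1. \<forall>p K. odd_prime p \<longrightarrow> K \<ge> 1 \<longrightarrow> real K \<le> real p powr (1/6) \<longrightarrow>
    real (card (odd_prime.sim_pairs p K)) \<le> C * real K * real p powr (1/84 + \<epsilon>)"
proof -
  define \<delta> where "\<delta> = \<epsilon> / 2"
  have \<delta>: "\<delta> > 0" using \<epsilon> by (simp add: \<delta>_def)
  obtain C where C: "C \<ge> 1" "\<And>p h. odd_prime p \<Longrightarrow> h \<ge> 1 \<Longrightarrow> real h \<le> real p powr (1/6) \<Longrightarrow>
    real (card (odd_prime.sim_fractions p h)) \<le> C * real h * real p powr (1/84 + \<delta>)"
    using sim_fractions_bound[OF \<delta>] by blast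
  define C' where "C' = C * (1 + 1 / \<delta>)"
  have C': "C' \<ge> 1" unfolding C'_def using mult_mono[of 1 C 1 "1 + 1/\<delta>"] C(1) \<delta> by simp
  have "real (card (odd_prime.sim_pairs p K)) \<le> C' * real K * real p powr (1/84 + \<epsilon>)"
    if op: "odd_prime p" and K: "K \<ge> 1" "real K \<le> real p powr (1/6)" for p K
  proof -
    interpret odd_prime p by (rule op)
    have p1: "real p > 1" using p_gt_2 by simp
    have "real p powr (1/6) < real p powr 1" using p1 by (intro powr_less_mono) auto
    then have Kp: "real K < real p" using K(2) p1 by simp
    then have "card (sim_pairs K) \<le> (\<Sum>g=1..K. card (sim_fractions (K div g)))"
      by (intro card_sim_pairs) simp
    then have "real (card (sim_pairs K)) \<le> real (\<Sum>g=1..K. card (sim_fractions (K div g)))"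
      by (simp only: of_nat_le_iff)
    also have "\<dots> = (\<Sum>g=1..K. real (card (sim_fractions (K div g))))" by simp
    also have "\<dots> \<le> (\<Sum>g=1..K. (C * real K * real p powr (1/84 + \<delta>)) * (1 / real g))"
    proof (rule sum_mono)
      fix g assume g: "g \<in> {1..K}"
      have "K div g \<ge> 1" using g by (simp add: Suc_le_eq div_greater_zero_iff)
      moreover have "real (K div g) \<le> real K" by (simp add: div_le_dividend)
      ultimately have "real (card (sim_fractions (K div g))) \<le> C * real (K div g) * real p powr (1/84 + \<delta>)"
        using K(2) by (intro C(2) op) linarith+
      also have "\<dots> \<le> C * (real K / real g) * real p powr (1/84 + \<delta>)"
        using C(1) by (intro mult_right_mono mult_left_mono of_nat_div_le_of_nat) auto
      finally show "real (card (sim_fractions (K div g))) \<le> (C * real K * real p powr (1/84 + \<delta>)) * (1 / real g)" by simp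
    qed
    also have "\<dots> = (C * real K * real p powr (1/84 + \<delta>)) * (\<Sum>g=1..K. 1 / real g)"
      by (rule sum_distrib_left[symmetric])
    also have "\<dots> \<le> (C * real K * real p powr (1/84 + \<delta>)) * ((1 + 1/\<delta>) * real p powr \<delta>)"
    proof (intro mult_left_mono)
      have "ln (real K) \<le> ln (real p)" using K Kp by (intro ln_mono) auto
      also have "\<dots> \<le> real p powr \<delta> / \<delta>" using p1 \<delta> by (intro ln_powr_bound) auto
      finally have "ln (real K) \<le> real p powr \<delta> / \<delta>" .
      moreover have "1 \<le> real p powr \<delta>" using p1 \<delta> by (intro ge_one_powr_ge_zero) auto
      ultimately show "(\<Sum>g=1..K. 1 / real g) \<le> (1 + 1/\<delta>) * real p powr \<delta>"
        using sum_inverse_le_ln[OF K(1)] by (simp add: algebra_simps)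
    qed (use C(1) in auto)
    also have "\<dots> = C' * real K * (real p powr (1/84 + \<delta>) * real p powr \<delta>)" by (simp add: C'_def)
    also have "real p powr (1/84 + \<delta>) * real p powr \<delta> = real p powr (1/84 + \<epsilon>)"
      by (simp add: powr_add[symmetric] \<delta>_def add.commute)
    finally show ?thesis .
  qed
  with C' show ?thesis by blast
qed

section \<open>Small elements of the group and vanishing Fermat quotients\<close>

text \<open>For \<open>M\<close> of order \<open>p^2\<close> or more. As \<open>g = g^p\<close>
  modulo \<open>p^2\<close>, an element of the group is fixed modulo \<open>p^2\<close> by its
  residue modulo \<open>p\<close>, so a block of length \<open>p^2\<close> holds at most
  \<open>p\<close> of them.\<close>

lemma (in odd_prime) card_sim_1_long:
  "card {g \<in> {1..M}. sim g 1} \<le> p * (M div p^2 + 1)"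
proof -
  have "inj_on (\<lambda>g. (g mod p, g div p^2)) {g \<in> {1..M}. sim g 1}"
  proof (rule inj_onI)
    fix g h assume gh: "g \<in> {g \<in> {1..M}. sim g 1}" "h \<in> {g \<in> {1..M}. sim g 1}"
      "(g mod p, g div p^2) = (h mod p, h div p^2)"
    have pw: "[int g^p = int g] (mod (int p)^2)" if "sim g 1" for g
    proof -
      have "int g^p = int g * int g^(p-1)" using p_pos by (cases p) auto
      also have "[int g * int g^(p-1) = int g * 1] (mod (int p)^2)"
        using that by (intro cong_mult cong_refl) (simp add: sim_int)
      finally show ?thesis by simp
    qed
    have "[g = h] (mod p)" using gh(3) by (simp add: cong_def)
    then have "[int g = int h] (mod int p)" by (simp only: cong_int_iff)
    then have "[int g^p = int h^p] (mod (int p)^2)" by (rule cong_pow_p_square)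
    then have "[int g = int h] (mod (int p)^2)" using pw[of g] pw[of h] gh(1,2) by (metis (no_types, lifting) cong_sym cong_trans mem_Collect_eq)
    then have "[g = h] (mod p^2)" by (simp flip: of_nat_power add: cong_int_iff)
    then have "g mod p^2 = h mod p^2" by (simp only: cong_def)
    moreover have "g div p^2 = h div p^2" using gh(3) by simp
    ultimately show "g = h" by (metis div_mult_mod_eq)
  qed
  moreover have "(\<lambda>g. (g mod p, g div p^2)) ` {g \<in> {1..M}. sim g 1} \<subseteq> {..<p} \<times> {..M div p^2}"
    using p_pos by (auto intro: div_le_mono)
  ultimately have "card {g \<in> {1..M}. sim g 1} \<le> card ({..<p} \<times> {..M div p^2})"
    by (intro card_inj_on_le) auto
  then show ?thesis by (simp add: card_cartesian_product)
qed

lemma card_sim_1_bound: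
  fixes \<alpha> :: real
  assumes \<alpha>: "\<alpha> > 463 / 252"
  shows "\<exists>C\<ge>1. \<forall>p M. odd_prime p \<longrightarrow> p \<ge> 2500 \<longrightarrow> real p powr \<alpha> \<le> real M \<longrightarrow>
    real (card {g \<in> {1..M}. odd_prime.sim p g 1}) \<le> C * real M / real p"
proof -
  define \<eta> where "\<eta> = \<alpha> - 463 / 252"
  have \<eta>: "\<eta> > 0" using \<alpha> by (simp add: \<eta>_def)
  obtain C1 where C1: "C1 \<ge> 1" "\<And>p K. odd_prime p \<Longrightarrow> K \<ge> 1 \<Longrightarrow> real K \<le> real p powr (1/6) \<Longrightarrow>
    real (card (odd_prime.sim_pairs p K)) \<le> C1 * real K * real p powr (1/84 + 3 * \<eta>)"
    using sim_pairs_bound[of "3 * \<eta>"] \<eta> by auto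
  define C2 where "C2 = 96000 * C1"
  have C2: "C2 \<ge> 1" using C1(1) by (simp add: C2_def)
  define C where "C = 48 * (1 + 2 * C2)"
  have C: "C \<ge> 7" using C2 by (simp add: C_def)
  have "real (card {g \<in> {1..M}. odd_prime.sim p g 1}) \<le> C * real M / real p"
    if op: "odd_prime p" and big: "p \<ge> 2500" and M: "real p powr \<alpha> \<le> real M" for p M
  proof -
    interpret odd_prime p by (rule op)
    have p1: "real p > 1" using p_gt_2 by simp
    have "0 < real p powr \<alpha>" using p1 by simp
    then have M0: "M > 0" using M by (auto intro: gr0I)
    \<comment> \<open>The largest \<open>K\<close> that \<open>card_small_pow\<close> admits. It is
      \<open>0\<close> exactly when \<open>p^2 < 6 * M\<close>, where the count by blocks takes
      over.\<close>
    define K where "K = p^2 div (6 * M)"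
    define J where "J = real (card {g \<in> {1..M}. sim g 1})"
    show ?thesis
    proof (cases "K = 0")
      case True
      then have "p^2 < 6 * M" using M0 by (simp add: K_def div_eq_0_iff)
      then have "real (p^2) < real (6 * M)" by (simp only: of_nat_less_iff)
      then have 1: "(real p)^2 \<le> 6 * real M" by simp
      have "J \<le> real (p * (M div p^2 + 1))" unfolding J_def using card_sim_1_long by (simp only: of_nat_le_iff)
      also have "\<dots> \<le> real p * (real M / real (p^2) + 1)"
        unfolding of_nat_mult of_nat_add by (intro mult_left_mono add_mono of_nat_div_le_of_nat) auto
      also have "\<dots> = (real M + (real p)^2) / real p" using p1 by (simp add: field_simps power2_eq_square)
      also have "\<dots> \<le> (7 * real M) / real p" using 1 p1 by (intro divide_right_mono) auto
      also have "\<dots> \<le> (C * real M) / real p" using C p1 by (intro divide_right_mono mult_right_mono) auto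
      finally show ?thesis by (simp add: J_def)
    next
      case False
      then have K0: "K > 0" by simp
      have "K * (6 * M) \<le> p^2" unfolding K_def by simp
      then have KM: "6 * K * M \<le> p^2" by (simp add: mult_ac)
      have KM': "real K * real M * 6 \<le> (real p)^2"
      proof -
        have "real (6 * K * M) \<le> real (p^2)" using KM by (simp only: of_nat_le_iff)
        then show ?thesis by (simp add: mult_ac)
      qed
      have "real K * real p powr \<alpha> \<le> real K * real M" using M by (intro mult_left_mono) auto
      also have "\<dots> \<le> real K * real M * 6" by simp
      also have "\<dots> \<le> real p powr 2" using KM' p1 by (simp add: powr_numeral)
      finally have "real K \<le> real p powr 2 / real p powr \<alpha>" using p1 by (simp add: field_simps)
      also have "\<dots> = real p powr (2 - \<alpha>)" by (rule powr_diff[symmetric])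
      also have "2 - \<alpha> = 41/252 - \<eta>" by (simp add: \<eta>_def)
      finally have Kb: "real K \<le> real p powr (41/252 - \<eta>)" .
      also have "\<dots> \<le> real p powr (1/6)" using p1 \<eta> by (intro powr_mono) auto
      finally have K6: "real K \<le> real p powr (1/6)" .
      have "real p powr (1/6) < real p powr 1" using p1 by (intro powr_less_mono) auto
      then have Kp: "K < p" using K6 p1 by simp
      define \<Sigma> where "\<Sigma> = (\<Sum>d=1..K. norm (hsum (int d)))"
      have "\<Sigma>^4 \<le> 96000 * ((real K)^2 * real (card (sim_pairs K)) * ((real p)^3 * sqrt p))"
        unfolding \<Sigma>_def by (rule sum_norm_hsum[OF Kp big])
      also have "\<dots> \<le> 96000 * ((real K)^2 * (C1 * real K * real p powr (1/84 + 3 * \<eta>)) * ((real p)^3 * sqrt p))"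
        using C1(2)[OF op _ K6] K0 by (intro mult_left_mono mult_right_mono) auto
      also have "\<dots> = C2 * ((real K)^3 * (real p powr (1/84 + 3 * \<eta>) * ((real p)^3 * sqrt p)))"
        by (simp add: C2_def power3_eq_cube power2_eq_square mult_ac)
      also have "\<dots> \<le> C2 * ((real p powr (41/252 - \<eta>))^3 * (real p powr (1/84 + 3 * \<eta>) * ((real p)^3 * sqrt p)))"
        using Kb C2 by (intro mult_left_mono mult_right_mono power_mono) auto
      \<comment> \<open>The \<open>3 * \<eta>\<close> requested for \<open>C1\<close> cancels the
        saving in \<open>K^3\<close>, and the rest is \<open>41/84 + 1/84 + 3 + 1/2 = 4\<close>.
        This identity fixes the threshold \<open>463/252 = 2 - 41/252\<close>.\<close>
      also have "(real p powr (41/252 - \<eta>))^3 * (real p powr (1/84 + 3 * \<eta>) * ((real p)^3 * sqrt p)) = (real p)^4"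
      proof -
        have "(real p powr (41/252 - \<eta>))^3 = real p powr ((41/252 - \<eta>) * 3)" using p1 by (simp add: powr_power_eq)
        moreover have "(real p)^3 = real p powr 3" "(real p)^4 = real p powr 4" using p1 by (simp_all add: powr_numeral)
        moreover have "sqrt (real p) = real p powr (1/2)" using p1 by (simp add: powr_half_sqrt)
        ultimately show ?thesis by (simp only: powr_add[symmetric]) (simp add: algebra_simps)
      qed
      also have "C2 * (real p)^4 \<le> C2^4 * (real p)^4" using C2 by (intro mult_right_mono self_le_power) auto
      finally have "\<Sigma>^4 \<le> (C2 * real p)^4" by (simp only: power_mult_distrib)
      then have \<Sigma>: "\<Sigma> \<le> C2 * real p" by (rule le_of_power_le) (use C2 in simp_all)
      have "M < p^2"
      proof -
        have "6 * M \<le> p^2" using False unfolding K_def by (metis div_less not_le)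
        then show ?thesis using M0 by linarith
      qed
      then have "J \<le> real (card {t \<in> {1..<int p}. t^p mod (int p)^2 \<in> {1..int M}})"
        unfolding J_def using card_sim_1_le by (simp only: of_nat_le_iff)
      then have "real K * J \<le> real K * real (card {t \<in> {1..<int p}. t^p mod (int p)^2 \<in> {1..int M}})"
        by (intro mult_left_mono) auto
      also have "\<dots> \<le> 4 * (real p + 2 * \<Sigma>)" unfolding \<Sigma>_def by (rule card_small_pow[OF K0 KM])
      also have "\<dots> \<le> 4 * (real p + 2 * (C2 * real p))" using \<Sigma> by simp
      finally have KJ: "real K * J \<le> 4 * (1 + 2 * C2) * real p" by (simp add: algebra_simps)
      \<comment> \<open>Rounding down in \<open>K\<close> costs at most a factor 2, since
        \<open>K \<ge> 1\<close> gives \<open>K + 1 \<le> 2 * K\<close>.\<close>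
      have "p^2 < (K + 1) * (6 * M)" unfolding K_def using M0 dividend_less_div_times[of "6 * M" "p^2"] by simp
      then have "real (p^2) < real ((K + 1) * (6 * M))" by (simp only: of_nat_less_iff)
      then have "(real p)^2 \<le> (real K + 1) * (6 * real M)" by (simp add: algebra_simps)
      also have "\<dots> \<le> (2 * real K) * (6 * real M)" using K0 by (intro mult_right_mono) auto
      finally have "(real p)^2 * J \<le> 12 * real M * (real K * J)"
        using mult_right_mono[of "(real p)^2" "(2 * real K) * (6 * real M)" J] by (simp add: J_def mult_ac)
      also have "\<dots> \<le> 12 * real M * (4 * (1 + 2 * C2) * real p)" using KJ by (intro mult_left_mono) auto
      finally have "real p * (real p * J) \<le> real p * (C * real M)" by (simp add: C_def power2_eq_square mult_ac)
      then have "real p * J \<le> C * real M" using p1 by simp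
      then show ?thesis unfolding J_def[symmetric] using p1 by (simp add: field_simps)
    qed
  qed
  moreover have "C \<ge> 1" using C by simp
  ultimately show ?thesis by blast
qed

section \<open>From the group to vanishing Fermat quotients\<close>

lemma (in odd_prime) sim_1_of_vanishing:
  assumes "prime l" "l \<noteq> p" "fermat_quotient p (int l) = 0"
  shows "sim l 1"
proof -
  have cop: "coprime (int l) (int p)" using primes_coprime[OF assms(1) prime_p assms(2)] by simp
  have "((int l)^(p-1) - 1) div int p mod int p = 0"
    unfolding fermat_quotient_eq_mod[OF prime_p cop, symmetric] by (rule assms(3))
  then have "int p dvd ((int l)^(p-1) - 1) div int p" by (simp add: dvd_eq_mod_eq_0)
  then have "int p * int p dvd int p * (((int l)^(p-1) - 1) div int p)" by (rule mult_dvd_mono[OF dvd_refl])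
  also have "\<dots> = (int l)^(p-1) - 1" using fermat_quotient_exact[OF prime_p cop] by simp
  finally show ?thesis by (simp add: sim_int cong_iff_dvd_diff power2_eq_square)
qed

lemma prod_primes_inj:
  "inj_on (\<lambda>A. \<Prod>A) {A. finite A \<and> (\<forall>l\<in>A. prime (l::nat))}"
proof (rule inj_onI)
  fix A B :: "nat set"
  assume A: "A \<in> {A. finite A \<and> (\<forall>l\<in>A. prime l)}" and B: "B \<in> {A. finite A \<and> (\<forall>l\<in>A. prime l)}"
    and eq: "\<Prod>A = \<Prod>B"
  have mem: "l \<in> A \<longleftrightarrow> prime l \<and> l dvd \<Prod>A" if A: "A \<in> {A. finite A \<and> (\<forall>l\<in>A. prime l)}" for A and l :: nat
  proof
    assume "l \<in> A" then show "prime l \<and> l dvd \<Prod>A" using A by (auto intro: dvd_prodI)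
  next
    assume l: "prime l \<and> l dvd \<Prod>A"
    then obtain q where "q \<in> A" "l dvd q" using A by (auto simp: prime_dvd_prod_iff)
    then have "l = q" using l A primes_dvd_imp_eq by blast
    then show "l \<in> A" using \<open>q \<in> A\<close> by simp
  qed
  show "A = B"
  proof (rule Set.set_eqI)
    fix l
    have "l \<in> A \<longleftrightarrow> prime l \<and> l dvd \<Prod>B" using mem[OF A, of l] unfolding eq .
    also have "\<dots> \<longleftrightarrow> l \<in> B" by (rule mem[OF B, symmetric])
    finally show "l \<in> A \<longleftrightarrow> l \<in> B" .
  qed
qed

text \<open>The \<open>r choose k\<close> products of \<open>k\<close> primes are distinct group
  elements of size at most about \<open>N^k\<close>. With \<open>(r/k)^k \<le> r choose k\<close>, a
  \<open>k\<close>-th root gives \<open>r \<le> 2 * C * k * Q\<close>. The hypothesis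
  \<open>p \<le> N^k\<close> makes \<open>Q \<ge> 1\<close>, which covers the case
  \<open>r < k\<close> and one extra prime.\<close>

lemma vanishing_primes_count:
  fixes N \<alpha> C :: real and k :: nat
  assumes op: "odd_prime p" and C: "C \<ge> 1" and k: "k > 0" and N: "N \<ge> 1" and Np: "real p \<le> N^k"
    and sim: "\<And>M. N^k \<le> real M \<Longrightarrow> real (card {g \<in> {1..M}. odd_prime.sim p g 1}) \<le> C * real M / real p"
  shows "real (card (vanishing_primes p N)) \<le> 4 * C * real k * (N * real p powr (- 1 / real k))"
proof -
  interpret odd_prime p by (rule op)
  have p1: "real p > 1" using p_gt_2 by simp
  \<comment> \<open>The Fermat quotient of \<open>p\<close> is \<open>0\<close> by convention
    although \<open>p\<close> is not in the group, so \<open>p\<close> is counted apart.\<close>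
  define L where "L = vanishing_primes p N - {p}"
  define r where "r = card L"
  define Q where "Q = N * real p powr (- 1 / real k)"
  have fL: "finite L" by (simp add: L_def finite_vanishing_primes)
  have Qk: "Q^k = N^k / real p"
  proof -
    have "(real p powr (- 1 / real k))^k = real p powr (- 1 / real k * real k)"
      using p1 by (intro powr_power_eq) simp
    also have "- 1 / real k * real k = - 1" using k by simp
    also have "real p powr (- 1) = 1 / real p" using p1 by (simp add: powr_minus_divide)
    finally show ?thesis by (simp add: Q_def power_mult_distrib)
  qed
  have Q0: "Q > 0" using N p1 by (simp add: Q_def)
  have "1^k \<le> Q^k" unfolding Qk using Np p1 by simp
  then have Q1: "1 \<le> Q" by (rule le_of_power_le[OF _ k]) (use Q0 in simp)
  have "card (vanishing_primes p N) \<le> Suc r"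
    unfolding r_def L_def using finite_vanishing_primes by (metis card_Diff1_le card_Suc_Diff1 card.insert_remove insert_Diff_single Diff_empty Diff_insert0 le_SucI order_refl)
  then have 1: "real (card (vanishing_primes p N)) \<le> real r + 1" by simp
  have 2: "real r \<le> 2 * C * real k * Q"
  proof (cases "r < k")
    case True
    then have "real r \<le> 1 * real k * 1" by simp
    also have "\<dots> \<le> 2 * C * real k * Q" using C Q1 by (intro mult_mono) auto
    finally show ?thesis .
  next
    case False
    define M where "M = nat \<lceil>N^k\<rceil>"
    have Nk: "1 \<le> N^k" using N by (rule one_le_power)
    have M: "N^k \<le> real M" "real M \<le> 2 * N^k" unfolding M_def using Nk by linarith+
    have "inj_on (\<lambda>A. \<Prod>A) {A. A \<subseteq> L \<and> card A = k}"
      by (rule inj_on_subset[OF prod_primes_inj]) (auto simp: L_def vanishing_primes_def intro: finite_subset[OF _ fL[unfolded L_def vanishing_primes_def]])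
    moreover have "(\<lambda>A. \<Prod>A) ` {A. A \<subseteq> L \<and> card A = k} \<subseteq> {g \<in> {1..M}. sim g 1}"
    proof (rule image_subsetI)
      fix A assume A: "A \<in> {A. A \<subseteq> L \<and> card A = k}"
      have el: "1 \<le> l" "real l \<le> N" "sim l 1" if "l \<in> A" for l
      proof -
        have l: "prime l" "real l \<le> N" "l \<noteq> p" "fermat_quotient p (int l) = 0"
          using that A by (auto simp: L_def vanishing_primes_def)
        show "1 \<le> l" using prime_gt_0_nat[OF l(1)] by simp
        show "real l \<le> N" by fact
        show "sim l 1" using l by (intro sim_1_of_vanishing)
      qed
      have "real (\<Prod>A) = (\<Prod>l\<in>A. real l)" by simp
      also have "\<dots> \<le> (\<Prod>l\<in>A. N)" using el by (intro prod_mono) auto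
      also have "\<dots> \<le> real M" using A M by simp
      finally have "\<Prod>A \<le> M" by (simp only: of_nat_le_iff)
      moreover have "1 \<le> \<Prod>A" using el by (intro prod_ge_1) auto
      moreover have "sim (\<Prod>A) 1" using sim_prod[of A "\<lambda>l. l" "\<lambda>_. 1"] el by simp
      ultimately show "\<Prod>A \<in> {g \<in> {1..M}. sim g 1}" by simp
    qed
    ultimately have "card {A. A \<subseteq> L \<and> card A = k} \<le> card {g \<in> {1..M}. sim g 1}"
      by (intro card_inj_on_le) auto
    then have "r choose k \<le> card {g \<in> {1..M}. sim g 1}" by (simp add: n_subsets[OF fL] r_def)
    then have "real (r choose k) \<le> real (card {g \<in> {1..M}. sim g 1})" by (simp only: of_nat_le_iff)
    also have "\<dots> \<le> C * real M / real p" by (rule sim[OF M(1)])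
    also have "\<dots> \<le> C * (2 * N^k) / real p" using M C p1 by (intro divide_right_mono mult_left_mono) auto
    also have "\<dots> = (2 * C) * Q^k" by (simp add: Qk)
    also have "\<dots> \<le> (2 * C)^k * Q^k" using C k Q0 by (intro mult_right_mono self_le_power) auto
    finally have "real (r choose k) \<le> (2 * C * Q)^k" by (simp only: power_mult_distrib)
    moreover have "(real r / real k)^k \<le> real (r choose k)"
      using False by (intro binomial_ge_n_over_k_pow_k) simp
    ultimately have "(real r / real k)^k \<le> (2 * C * Q)^k" by linarith
    then have "real r / real k \<le> 2 * C * Q" by (rule le_of_power_le[OF _ k]) (use C Q0 in simp)
    then show ?thesis using k by (simp add: field_simps)
  qed
  have "1 * 1 \<le> 2 * C * real k * Q" using C k Q1 by (intro mult_mono) (auto simp: mult_ge1_I)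
  then show ?thesis using 1 2 unfolding Q_def by simp
qed

text \<open>The constant and the threshold are chosen before \<open>N\<close>, so the bound is
  uniform over all choices of \<open>N(p)\<close>.\<close>

theorem theorem7:
  fixes \<alpha> :: real
  assumes "\<alpha> > 463 / 252"
  shows "\<exists>c > 0. \<exists>p\<^sub>0 :: nat. \<forall>N :: nat \<Rightarrow> real.
    (\<forall>p. prime p \<longrightarrow> N p \<ge> 2 \<and> ln (real p) / ln (N p) \<ge> 1) \<longrightarrow>
    (\<forall>p \<ge> p\<^sub>0. prime p \<longrightarrow>
      (let u = ln (real p) / ln (N p)
       in real (card (vanishing_primes p (N p)))
            \<le> c * u * N p * real p powr (- 1 / real_of_int \<lceil>\<alpha> * u\<rceil>)))"
proof -
  obtain C where C: "C \<ge> 1" "\<And>p M. odd_prime p \<Longrightarrow> p \<ge> 2500 \<Longrightarrow> real p powr \<alpha> \<le> real M \<Longrightarrow>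
    real (card {g \<in> {1..M}. odd_prime.sim p g 1}) \<le> C * real M / real p"
    using card_sim_1_bound[OF assms] by blast
  \<comment> \<open>The factor \<open>\<alpha> + 1\<close> comes from
    \<open>k \<le> \<alpha> * u + 1 \<le> (\<alpha> + 1) * u\<close>, valid as
    \<open>u \<ge> 1\<close>.\<close>
  define c where "c = 4 * C * (\<alpha> + 1)"
  have c: "c > 0" using C(1) assms by (simp add: c_def)
  have "real (card (vanishing_primes p N)) \<le> c * u * N * real p powr (- 1 / real_of_int \<lceil>\<alpha> * u\<rceil>)"
    if p: "prime p" "p \<ge> 2500" and N: "N \<ge> 2" and u: "u = ln (real p) / ln N" "u \<ge> 1" for p N u
  proof -
    have op: "odd_prime p" using p by unfold_locales auto
    have p1: "real p > 1" using p by simp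
    have lnN: "ln N > 0" using N by simp
    define k where "k = nat \<lceil>\<alpha> * u\<rceil>"
    have au: "\<alpha> * u \<ge> 1" using mult_mono[of 1 \<alpha> 1 u] assms u(2) by simp
    have kr: "real k = real_of_int \<lceil>\<alpha> * u\<rceil>" using au by (simp add: k_def)
    have k: "k > 0" "\<alpha> * u \<le> real k" "real k \<le> \<alpha> * u + 1" unfolding kr using au by (auto simp: k_def)
    have Nk: "real p powr \<alpha> \<le> N^k"
    proof -
      have "\<alpha> * ln (real p) = (\<alpha> * u) * ln N" using lnN by (simp add: u(1))
      also have "\<dots> \<le> real k * ln N" using k(2) lnN by (intro mult_right_mono) auto
      finally have "exp (\<alpha> * ln (real p)) \<le> exp (real k * ln N)" by simp
      then show ?thesis using p1 N by (simp add: powr_def exp_of_nat_mult)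
    qed
    have "real p = real p powr 1" using p1 by simp
    also have "\<dots> \<le> real p powr \<alpha>" using assms p1 by (intro powr_mono) auto
    finally have pN: "real p \<le> N^k" using Nk by linarith
    have "real (card (vanishing_primes p N)) \<le> 4 * C * real k * (N * real p powr (- 1 / real k))"
      using N Nk by (intro vanishing_primes_count[OF op C(1) k(1) _ pN] C(2)[OF op p(2)]) auto
    also have "\<dots> \<le> 4 * C * ((\<alpha> + 1) * u) * (N * real p powr (- 1 / real k))"
    proof (intro mult_right_mono mult_left_mono)
      show "real k \<le> (\<alpha> + 1) * u" using k(3) u(2) by (simp add: distrib_right)
    qed (use C(1) N in auto)
    finally show ?thesis unfolding kr[symmetric] c_def by (simp add: mult_ac)
  qed
  then show ?thesis
    using c by (intro exI[of _ c] conjI exI[of _ 2500]) (auto simp: Let_def)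
qed

end
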